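(* Let $T>0$, $\sigma>0$, $\theta>1$, $s\geq1$, and consider in one space dimension the operator $$M=D_t+D_x^2+i\langle x\rangle^{-\sigma}D_x,\qquad t\in[0,T],\ x\in\mathbb{R}.$$ If the Cauchy problem $$Mu(t,x)=f(t,x),\quad t\in[0,T],\ x\in\mathbb{R},\qquad u(0,x)=g(x),\quad x\in\mathbb{R},$$ is $\mathcal{S}^\theta_s$ well-posed, then $$\max\left\{\frac1\theta,\frac1s\right\}\geq 1-\sigma.$$
   Context: Notation: $D_t=-i\partial_t$, $D_x=-i\partial_x$, $\langle x\rangle=(1+x^2)^{1/2}$. For $\rho_1>0$, $e^{\rho_1\langle D\rangle^{1/\theta}}$ is the Fourier multiplier with symbol $e^{\rho_1\langle\xi\rangle^{1/\theta}}$. For $\theta>1$, $s\geq1$ and $\rho=(\rho_1,\rho_2)$ with $\rho_1,\rho_2>0$, $$H^0_{\rho;\theta,s}(\mathbb{R})=\{u\in\mathscr{S}'(\mathbb{R}): e^{\rho_2\langle x\rangle^{1/s}}e^{\rho_1\langle D\rangle^{1/\theta}}u\in L^2(\mathbb{R})\},$$ with norm $\|u\|_{H^0_{\rho;\theta,s}}=\|e^{\rho_2\langle x\rangle^{1/s}}e^{\rho_1\langle D\rangle^{1/\theta}}u\|_{L^2}$. Definition ($\mathcal{S}^\theta_s$ well-posedness): the Cauchy problem is $\mathcal{S}^\theta_s$ well-posed when for any given $\rho=(\rho_1,\rho_2)$, $\rho_1,\rho_2>0$, there exist $\tilde\rho=(\tilde\rho_1,\tilde\rho_2)$, $\tilde\rho_1,\tilde\rho_2>0$,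 and a constant $C=C(\rho,T)>0$ such that for all $f\in C([0,T];H^0_{\rho;\theta,s}(\mathbb{R}))$ and $g\in H^0_{\rho;\theta,s}(\mathbb{R})$ there exists a unique solution $u\in C^1([0,T];H^0_{\tilde\rho;\theta,s}(\mathbb{R}))$ and, for all $t\in[0,T]$, $$\|u(t,\cdot)\|^2_{H^0_{\tilde\rho;\theta,s}}\leq C\left\{\|g\|^2_{H^0_{\rho;\theta,s}}+\int_0^t\|f(\tau,\cdot)\|^2_{H^0_{\rho;\theta,s}}\,d\tau\right\}.$$ *)

theory Defs
  imports "HOL-Analysis.Analysis"
begin

definition Dfun :: "(real \<Rightarrow> complex) \<Rightarrow> real \<Rightarrow> complex" where
  "Dfun f = (\<lambda>x. vector_derivative f (at x))"

definition smooth :: "(real \<Rightarrow> complex) \<Rightarrow> bool" where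
  "smooth f \<longleftrightarrow> (\<forall>k x. (Dfun ^^ k) f differentiable (at x))"

definition schwartz :: "(real \<Rightarrow> complex) set" where
  "schwartz = {\<phi>. smooth \<phi> \<and>
     (\<forall>j k. bounded (range (\<lambda>x. complex_of_real (x ^ j) * (Dfun ^^ k) \<phi> x)))}"

definition test_fun :: "(real \<Rightarrow> complex) set" where
  "test_fun = {\<phi>. smooth \<phi> \<and> (\<exists>R. \<forall>x. \<bar>x\<bar> > R \<longrightarrow> \<phi> x = 0)}"

definition schwartz_seminorm :: "nat \<Rightarrow> nat \<Rightarrow> (real \<Rightarrow> complex) \<Rightarrow> real" where
  "schwartz_seminorm j k \<phi> = (SUP x. cmod (complex_of_real (x ^ j) * (Dfun ^^ k) \<phi> x))"

text \<open>A distribution is a functional on all functions which is only meaningful on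
  \<^const>\<open>schwartz\<close>; it is normalised to be 0 elsewhere, so that equality of tempered
  distributions is equality of HOL functions.\<close>

type_synonym distr = "(real \<Rightarrow> complex) \<Rightarrow> complex"

definition tempered :: "distr set" where
  "tempered = {u.
     (\<forall>\<phi>. \<phi> \<notin> schwartz \<longrightarrow> u \<phi> = 0) \<and>
     (\<forall>\<phi>\<in>schwartz. \<forall>\<psi>\<in>schwartz. \<forall>a b. u (\<lambda>x. a * \<phi> x + b * \<psi> x) = a * u \<phi> + b * u \<psi>) \<and>
     (\<exists>C N. \<forall>\<phi>\<in>schwartz. cmod (u \<phi>) \<le> C * (\<Sum>j\<le>N. \<Sum>k\<le>N. schwartz_seminorm j k \<phi>))}"

definition distr_deriv :: "distr \<Rightarrow> distr" where
  "distr_deriv u = (\<lambda>\<phi>. if \<phi> \<in> schwartz then - u (Dfun \<phi>) else 0)"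

text \<open>Multiplication by a smooth function all of whose derivatives grow at most
  polynomially.\<close>

definition distr_mult :: "(real \<Rightarrow> complex) \<Rightarrow> distr \<Rightarrow> distr" where
  "distr_mult m u = (\<lambda>\<phi>. if \<phi> \<in> schwartz then u (\<lambda>x. m x * \<phi> x) else 0)"

text \<open>Multiplication by an arbitrary smooth \<open>m\<close>: the product \<open>m v\<close> is a priori only
  defined on compactly supported test functions, and \<open>is_product m v w\<close> says that it is
  (the restriction of) the tempered distribution \<open>w\<close>, which is then unique by density.\<close>

definition is_product :: "(real \<Rightarrow> complex) \<Rightarrow> distr \<Rightarrow> distr \<Rightarrow> bool" where
  "is_product m v w \<longleftrightarrow>
     w \<in> tempered \<and> (\<forall>\<phi>\<in>test_fun. w \<phi> = v (\<lambda>x. m x * \<phi> x))"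

definition fourier :: "(real \<Rightarrow> complex) \<Rightarrow> real \<Rightarrow> complex" where
  "fourier \<phi> = (\<lambda>\<xi>. LINT x|lborel. cis (- (x * \<xi>)) * \<phi> x)"

definition distr_fourier :: "distr \<Rightarrow> distr" where
  "distr_fourier u = (\<lambda>\<phi>. if \<phi> \<in> schwartz then u (fourier \<phi>) else 0)"

text \<open>\<open>is_fourier_multiplier m u w\<close>: the tempered distribution \<open>w\<close> equals \<open>m(D) u\<close>.\<close>

definition is_fourier_multiplier :: "(real \<Rightarrow> complex) \<Rightarrow> distr \<Rightarrow> distr \<Rightarrow> bool" where
  "is_fourier_multiplier m u w \<longleftrightarrow>
     w \<in> tempered \<and> is_product m (distr_fourier u) (distr_fourier w)"

definition L2 :: "(real \<Rightarrow> complex) set" where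
  "L2 = {h. h \<in> borel_measurable lborel \<and> integrable lborel (\<lambda>x. (cmod (h x))\<^sup>2)}"

definition L2_norm :: "(real \<Rightarrow> complex) \<Rightarrow> real" where
  "L2_norm h = sqrt (LINT x|lborel. (cmod (h x))\<^sup>2)"

definition distr_of :: "(real \<Rightarrow> complex) \<Rightarrow> distr" where
  "distr_of h = (\<lambda>\<phi>. if \<phi> \<in> schwartz then (LINT x|lborel. h x * \<phi> x) else 0)"

definition jap :: "real \<Rightarrow> real" where
  "jap x = sqrt (1 + x\<^sup>2)"

definition exp_weight :: "real \<Rightarrow> real \<Rightarrow> real \<Rightarrow> complex" where
  "exp_weight r p = (\<lambda>x. complex_of_real (exp (r * jap x powr (1 / p))))"

text \<open>\<open>H_rep \<theta> s \<rho>1 \<rho>2 u h\<close>: the distribution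
  \<open>exp (\<rho>2 \<langle>x\<rangle>^(1/s)) exp (\<rho>1 \<langle>D\<rangle>^(1/\<theta>)) u\<close> is the square-integrable function \<open>h\<close>.\<close>

definition H_rep ::
  "real \<Rightarrow> real \<Rightarrow> real \<Rightarrow> real \<Rightarrow> distr \<Rightarrow> (real \<Rightarrow> complex) \<Rightarrow> bool" where
  "H_rep \<theta> s \<rho>1 \<rho>2 u h \<longleftrightarrow> h \<in> L2 \<and>
     (\<exists>w. is_fourier_multiplier (exp_weight \<rho>1 \<theta>) u w \<and>
          is_product (exp_weight \<rho>2 s) w (distr_of h))"

definition H_space :: "real \<Rightarrow> real \<Rightarrow> real \<Rightarrow> real \<Rightarrow> distr set" where
  "H_space \<theta> s \<rho>1 \<rho>2 = {u \<in> tempered. \<exists>h. H_rep \<theta> s \<rho>1 \<rho>2 u h}"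

text \<open>For \<open>u\<close> in the space, \<open>h\<close> is unique up to a null set, so the choice is immaterial.\<close>

definition H_norm :: "real \<Rightarrow> real \<Rightarrow> real \<Rightarrow> real \<Rightarrow> distr \<Rightarrow> real" where
  "H_norm \<theta> s \<rho>1 \<rho>2 u = L2_norm (SOME h. H_rep \<theta> s \<rho>1 \<rho>2 u h)"

definition C0_H :: "real \<Rightarrow> real \<Rightarrow> real \<Rightarrow> real \<Rightarrow> real \<Rightarrow> (real \<Rightarrow> distr) set" where
  "C0_H T \<theta> s \<rho>1 \<rho>2 = {u. \<forall>t\<in>{0..T}. u t \<in> H_space \<theta> s \<rho>1 \<rho>2 \<and>
     ((\<lambda>\<tau>. H_norm \<theta> s \<rho>1 \<rho>2 (\<lambda>\<phi>. u \<tau> \<phi> - u t \<phi>)) \<longlongrightarrow> 0) (at t within {0..T})}"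

definition C1_H :: "real \<Rightarrow> real \<Rightarrow> real \<Rightarrow> real \<Rightarrow> real \<Rightarrow> (real \<Rightarrow> distr) set" where
  "C1_H T \<theta> s \<rho>1 \<rho>2 = {u \<in> C0_H T \<theta> s \<rho>1 \<rho>2. \<exists>v \<in> C0_H T \<theta> s \<rho>1 \<rho>2. \<forall>t\<in>{0..T}.
     ((\<lambda>\<tau>. H_norm \<theta> s \<rho>1 \<rho>2 (\<lambda>\<phi>. (u \<tau> \<phi> - u t \<phi>) / complex_of_real (\<tau> - t) - v t \<phi>))
        \<longlongrightarrow> 0) (at t within {0..T})}"

definition Dx :: "distr \<Rightarrow> distr" where
  "Dx u = (\<lambda>\<phi>. - \<i> * distr_deriv u \<phi>)"

text \<open>The time derivative is taken weakly in the space of tempered distributions (one-sided at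
  the end points); for elements of \<^const>\<open>C1_H\<close> it is the derivative in the \<open>H\<close>-norm.\<close>

definition Dt :: "real \<Rightarrow> (real \<Rightarrow> distr) \<Rightarrow> real \<Rightarrow> distr" where
  "Dt T u t = (\<lambda>\<phi>. - \<i> * vector_derivative (\<lambda>\<tau>. u \<tau> \<phi>) (at t within {0..T}))"

definition M_op :: "real \<Rightarrow> real \<Rightarrow> (real \<Rightarrow> distr) \<Rightarrow> real \<Rightarrow> distr" where
  "M_op T \<sigma> u t = (\<lambda>\<phi>. Dt T u t \<phi> + Dx (Dx (u t)) \<phi>
     + \<i> * distr_mult (\<lambda>x. complex_of_real (jap x powr (- \<sigma>))) (Dx (u t)) \<phi>)"

definition solves_Cauchy ::
  "real \<Rightarrow> real \<Rightarrow> (real \<Rightarrow> distr) \<Rightarrow> distr \<Rightarrow> (real \<Rightarrow> distr) \<Rightarrow> bool" where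
  "solves_Cauchy T \<sigma> f g u \<longleftrightarrow> (\<forall>t\<in>{0..T}. M_op T \<sigma> u t = f t) \<and> u 0 = g"

text \<open>Uniqueness is equality on the interval from 0 to \<open>T\<close>, as values of \<open>u\<close> at other times
  carry no meaning.\<close>

definition well_posed :: "real \<Rightarrow> real \<Rightarrow> real \<Rightarrow> real \<Rightarrow> bool" where
  "well_posed T \<sigma> \<theta> s \<longleftrightarrow>
     (\<forall>\<rho>1>0. \<forall>\<rho>2>0. \<exists>\<rho>1'>0. \<exists>\<rho>2'>0. \<exists>C>0.
        \<forall>f \<in> C0_H T \<theta> s \<rho>1 \<rho>2. \<forall>g \<in> H_space \<theta> s \<rho>1 \<rho>2.
          \<exists>u \<in> C1_H T \<theta> s \<rho>1' \<rho>2'.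
            solves_Cauchy T \<sigma> f g u \<and>
            (\<forall>v \<in> C1_H T \<theta> s \<rho>1' \<rho>2'. solves_Cauchy T \<sigma> f g v \<longrightarrow> (\<forall>t\<in>{0..T}. v t = u t)) \<and>
            (\<forall>t\<in>{0..T}. (H_norm \<theta> s \<rho>1' \<rho>2' (u t))\<^sup>2 \<le>
               C * ((H_norm \<theta> s \<rho>1 \<rho>2 g)\<^sup>2
                    + integral {0..t} (\<lambda>\<tau>. (H_norm \<theta> s \<rho>1 \<rho>2 (f \<tau>))\<^sup>2))))"

end

theory Submission
  imports Defs "HOL-Probability.Probability" "HOL-Real_Asymp.Real_Asymp"
begin

text \<open>With \<open>a = \<langle>x\<rangle>^(-\<sigma>)\<close> and \<open>A' = a\<close>, the homogeneous equation reads
  \<open>u\<^sub>t = i (u'' - a u')\<close>, and conjugation by \<open>exp (A / 2)\<close> turns it into a Schroedinger equation with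
  the bounded potential \<open>a' / 2 - a\<^sup>2 / 4\<close>. The transposed spatial operator therefore has local
  solutions \<open>\<phi> = exp (- A / 2 - i k x) m\<close> of \<open>\<phi>'' + (a \<phi>)' = - k\<^sup>2 \<phi>\<close> with \<open>m\<close> close to 1,
  for \<open>k = \<nu> + i \<kappa>\<close>. Choose \<open>\<nu> = N X\<close> and \<open>\<kappa> = a(X) / 2\<close>. Then \<open>|exp (- A / 2 - i k x)|\<close> attains
  its maximum \<open>B \<ge> exp (c X^(1-\<sigma>))\<close> at \<open>x = - X\<close>, and is at most 1 near 0 and beyond
  \<open>- L\<close> for \<open>L\<close> a large multiple of \<open>X\<close>. Cutting \<open>\<phi>\<close> off there yields a quasimode \<open>\<psi>\<close> whose
  defect \<open>R\<close> is of size \<open>O(X)\<close>, exponentially smaller than \<open>B\<close>.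

  Pairing a solution \<open>u\<close> with \<open>\<psi>\<close> gives \<open>d/dt u(\<psi>) = - i (k\<^sup>2 u(\<psi>) + u(R))\<close>, so \<open>u(\<psi>)\<close> is forced
  to grow like \<open>exp (2 \<nu> \<kappa> t)\<close>, where \<open>2 \<nu> \<kappa>\<close> is of order \<open>X^(1-\<sigma>)\<close>, while well-posedness bounds
  \<open>u(\<psi>)\<close> and \<open>u(R)\<close> by the norm of the data. Data given by a Gaussian packet of width
  \<open>X^((1+\<sigma>)/2)\<close> at position \<open>- X\<close> and frequency \<open>\<nu>\<close> cost only
  \<open>exp (O(X^(1/\<theta>) + X^(1/s)))\<close>, which is a contradiction if \<open>1 - \<sigma>\<close> exceeds both exponents.\<close>

section \<open>Families of smooth functions\<close>

text \<open>The modulus \<open>|exp (- A / 2 - i k x)|\<close> has logarithmic derivative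
  \<open>\<kappa> - a / 2\<close>, so \<open>\<kappa> = a(X) / 2\<close> puts a critical point, a
  maximum, exactly at \<open>- X\<close>. The contraction that yields \<open>m\<close> requires
  \<open>\<nu>\<close> to dominate the length of the window, a multiple of \<open>X\<close>; with
  \<open>\<nu>\<close> proportional to \<open>X\<close>, the exponent of \<open>B\<close> and that
  of the time evolution both have order \<open>X^(1-\<sigma>)\<close>. The packet width is squeezed
  from two sides. Over a length \<open>Y\<close> the exponent may drop only by \<open>O(1)\<close>,
  which needs \<open>Y^2\<close> at most of order \<open>X^(1+\<sigma>)\<close>; replacing the
  multiplier by its value at \<open>\<nu>\<close> costs a relative error of order
  \<open>X / Y^2\<close>, which needs \<open>Y^2\<close> much larger than \<open>X\<close>. The
  radii of the solution space are unknown. Pairings are therefore estimated through the L1 norms of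
  \<open>\<psi>\<close> and \<open>R\<close>, and these radii enter only through a constant.
  Products with the exponentially growing weights are specified on compactly supported functions
  only, so every identity has to be extended by density; this is why smooth functions are handled in
  families with a rate.\<close>

type_synonym family = "nat \<Rightarrow> real \<Rightarrow> complex"

text \<open>\<open>P\<close> speaks about a whole family, so uniformity in the index and in
  \<open>x\<close> is hidden in \<open>P\<close>, while \<open>k\<close> counts derivatives. The
  recursion differentiates the family first, so that inductions on \<open>k\<close> with arbitrary
  \<open>F\<close> run along the product rule.\<close>

fun cls :: "(family \<Rightarrow> bool) \<Rightarrow> nat \<Rightarrow> family \<Rightarrow> bool" where
  "cls P 0 F \<longleftrightarrow> P F"
| "cls P (Suc k) F \<longleftrightarrow> P F \<and> (\<forall>n x. F n differentiable (at x)) \<and> cls P k (\<lambda>n. Dfun (F n))"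

lemma Dfun_eqI: "(\<And>x. (f has_vector_derivative f' x) (at x)) \<Longrightarrow> Dfun f = f'"
  unfolding Dfun_def by (auto intro!: ext vector_derivative_at)

lemma differentiableI_vd: "(f has_vector_derivative f') (at x) \<Longrightarrow> f differentiable (at x)"
  for f :: "real \<Rightarrow> complex"
  by (rule differentiableI_vector)

lemma has_vd_Dfun: "f differentiable (at x) \<Longrightarrow> (f has_vector_derivative Dfun f x) (at x)"
  unfolding Dfun_def by (simp add: vector_derivative_works)

lemma cls_0: "cls P k F \<Longrightarrow> P F"
  by (cases k) auto

lemma cls_le_Suc: "cls P (Suc k) F \<Longrightarrow> cls P k F"
proof (induction k arbitrary: F)
  case 0 then show ?case by simp
next
  case (Suc k)
  then show ?case by (metis cls.simps(2))
qed

lemma cls_mono: "(\<And>F. P F \<Longrightarrow> Q F) \<Longrightarrow> cls P k F \<Longrightarrow> cls Q k F"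
  by (induction k arbitrary: F) auto

lemma cls_add:
  assumes "\<And>F G. P F \<Longrightarrow> P G \<Longrightarrow> P (\<lambda>n x. F n x + G n x)"
  shows "cls P k F \<Longrightarrow> cls P k G \<Longrightarrow> cls P k (\<lambda>n x. F n x + G n x)"
proof (induction k arbitrary: F G)
  case 0 then show ?case using assms by simp
next
  case (Suc k)
  have d: "((\<lambda>x. F n x + G n x) has_vector_derivative (Dfun (F n) x + Dfun (G n) x)) (at x)" for n x
    using Suc.prems by (auto intro!: has_vector_derivative_add has_vd_Dfun)
  have "Dfun (\<lambda>x. F n x + G n x) = (\<lambda>x. Dfun (F n) x + Dfun (G n) x)" for n
    by (rule Dfun_eqI, rule d)
  then show ?case using Suc assms differentiableI_vd[OF d] by auto
qed

text \<open>Leibniz rule as an induction: in each summand the undifferentiated factor drops one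
  order by \<open>cls_le_Suc\<close>. Separate predicates for the factors allow products such as
  rapid times slow.\<close>

lemma cls_mult:
  assumes PQ: "\<And>F G. P F \<Longrightarrow> Q G \<Longrightarrow> R (\<lambda>n x. F n x * G n x)"
    and RR: "\<And>F G. R F \<Longrightarrow> R G \<Longrightarrow> R (\<lambda>n x. F n x + G n x)"
  shows "cls P k F \<Longrightarrow> cls Q k G \<Longrightarrow> cls R k (\<lambda>n x. F n x * G n x)"
proof (induction k arbitrary: F G)
  case 0 then show ?case using PQ by simp
next
  case (Suc k)
  have d: "((\<lambda>x. F n x * G n x) has_vector_derivative (F n x * Dfun (G n) x + Dfun (F n) x * G n x)) (at x)" for n x
    using Suc.prems by (auto intro!: has_vector_derivative_mult has_vd_Dfun)
  have e: "Dfun (\<lambda>x. F n x * G n x) = (\<lambda>x. F n x * Dfun (G n) x + Dfun (F n) x * G n x)" for n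
    by (rule Dfun_eqI, rule d)
  have "cls R k (\<lambda>n x. F n x * Dfun (G n) x + Dfun (F n) x * G n x)"
  proof (rule cls_add[where P = R])
    show "R F \<Longrightarrow> R G \<Longrightarrow> R (\<lambda>n x. F n x + G n x)" for F G by (rule RR)
    show "cls R k (\<lambda>n x. F n x * Dfun (G n) x)"
      by (rule Suc.IH[OF cls_le_Suc]) (use Suc.prems in auto)
    show "cls R k (\<lambda>n x. Dfun (F n) x * G n x)"
      by (rule Suc.IH[OF _ cls_le_Suc]) (use Suc.prems in auto)
  qed
  moreover have "R (\<lambda>n x. F n x * G n x)" using Suc.prems PQ by auto
  ultimately show ?case using e differentiableI_vd[OF d] by auto
qed

text \<open>Order \<open>k\<close> for \<open>F\<close> gives order \<open>k\<close> for its
  derivative, hence order \<open>k + 1\<close> for \<open>F\<close>. This serves functions whose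
  derivative is expressed through themselves.\<close>

lemma cls_bootstrap:
  assumes d: "\<And>n x. (F n has_vector_derivative F' n x) (at x)"
    and b: "\<And>k. cls P k F \<Longrightarrow> cls P k F'" and P: "P F"
  shows "cls P k F"
proof (induction k)
  case 0 show ?case using P by simp
next
  case (Suc k)
  have "Dfun (F n) = F' n" for n by (rule Dfun_eqI, rule d)
  then show ?case using Suc b P differentiableI_vd[OF d] by auto
qed

lemma cls_SucI:
  assumes d: "\<And>n x. (F n has_vector_derivative F' n x) (at x)"
    and "cls P k F'" and "P F"
  shows "cls P (Suc k) F"
proof -
  have "Dfun (F n) = F' n" for n by (rule Dfun_eqI, rule d)
  then show ?thesis using assms differentiableI_vd[OF d] by auto
qed

lemma cls_iff: "cls P k F \<longleftrightarrow> (\<forall>i\<le>k. P (\<lambda>n. (Dfun ^^ i) (F n))) \<and>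
    (\<forall>i<k. \<forall>n x. (Dfun ^^ i) (F n) differentiable (at x))"
proof (induction k arbitrary: F)
  case 0 show ?case by simp
next
  case (Suc k)
  have sw: "(Dfun ^^ i) (Dfun f) = (Dfun ^^ Suc i) f" for i f
    by (simp add: funpow_swap1)
  have b: "(\<forall>i<Suc l. Q i) \<longleftrightarrow> Q 0 \<and> (\<forall>i<l. Q (Suc i))" for Q l
    by (rule All_less_Suc2)
  have a: "(\<forall>i\<le>Suc k. Q i) \<longleftrightarrow> Q 0 \<and> (\<forall>i\<le>k. Q (Suc i))" for Q
    using b[of "Suc k" Q] by (simp only: less_Suc_eq_le)
  show ?case unfolding cls.simps Suc.IH sw a b by auto
qed

lemma cls_all_iff: "(\<forall>k. cls P k F) \<longleftrightarrow> (\<forall>k. P (\<lambda>n. (Dfun ^^ k) (F n))) \<and> (\<forall>n. smooth (F n))"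
  unfolding cls_iff smooth_def by blast

lemma smooth_cls: "smooth f \<longleftrightarrow> (\<forall>k. cls (\<lambda>_. True) k (\<lambda>_. f))"
  unfolding cls_all_iff by simp

text \<open>The gauge \<open>c\<close> measures a family uniformly in its index: the constant gauge 1 and a constant
  family give slowly increasing and Schwartz functions, while \<open>c n = 1 / (n + 1)\<close> expresses
  convergence to 0 with a rate, so that no limits in the Schwartz topology are needed.\<close>

definition Pslow :: "(nat \<Rightarrow> real) \<Rightarrow> family \<Rightarrow> bool" where
  "Pslow c F \<longleftrightarrow> (\<exists>C N. \<forall>n x. cmod (F n x) \<le> C * c n * (1 + \<bar>x\<bar>) ^ N)"

definition Prapid :: "(nat \<Rightarrow> real) \<Rightarrow> family \<Rightarrow> bool" where
  "Prapid c F \<longleftrightarrow> (\<forall>j. \<exists>C. \<forall>n x. cmod (F n x) * (1 + \<bar>x\<bar>) ^ j \<le> C * c n)"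

definition slowf :: "(nat \<Rightarrow> real) \<Rightarrow> family \<Rightarrow> bool" where "slowf c F \<longleftrightarrow> (\<forall>k. cls (Pslow c) k F)"

definition schf :: "(nat \<Rightarrow> real) \<Rightarrow> family \<Rightarrow> bool" where "schf c F \<longleftrightarrow> (\<forall>k. cls (Prapid c) k F)"

abbreviation slow :: "(real \<Rightarrow> complex) \<Rightarrow> bool" where "slow f \<equiv> slowf (\<lambda>_. 1) (\<lambda>_. f)"

lemma Prapid_add: "Prapid c F \<Longrightarrow> Prapid c G \<Longrightarrow> Prapid c (\<lambda>n x. F n x + G n x)"
  unfolding Prapid_def
proof
  fix j
  assume "\<forall>j. \<exists>C. \<forall>n x. cmod (F n x) * (1 + \<bar>x\<bar>) ^ j \<le> C * c n"
    "\<forall>j. \<exists>C. \<forall>n x. cmod (G n x) * (1 + \<bar>x\<bar>) ^ j \<le> C * c n"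
  then obtain C D where
    C: "\<And>n x. cmod (F n x) * (1 + \<bar>x\<bar>) ^ j \<le> C * c n" and D: "\<And>n x. cmod (G n x) * (1 + \<bar>x\<bar>) ^ j \<le> D * c n"
    by meson
  have "cmod (F n x + G n x) * (1 + \<bar>x\<bar>) ^ j \<le> (C + D) * c n" for n x
  proof -
    have "cmod (F n x + G n x) * (1 + \<bar>x\<bar>) ^ j \<le> (cmod (F n x) + cmod (G n x)) * (1 + \<bar>x\<bar>) ^ j"
      by (intro mult_right_mono norm_triangle_ineq) simp
    also have "\<dots> \<le> (C + D) * c n" using C[of n x] D[of n x] by (simp add: algebra_simps)
    finally show ?thesis .
  qed
  then show "\<exists>C. \<forall>n x. cmod (F n x + G n x) * (1 + \<bar>x\<bar>) ^ j \<le> C * c n" by blast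
qed

text \<open>Neither the constant nor the gauge carries a sign; the bound at \<open>x = 0\<close>
  shows \<open>C * c n \<ge> 0\<close>, which permits raising the exponent and multiplying two
  bounds.\<close>

lemma PslowD:
  assumes "Pslow c F"
  shows "\<exists>C N. (\<forall>M\<ge>N. \<forall>n x. cmod (F n x) \<le> C * c n * (1 + \<bar>x\<bar>) ^ M) \<and> (\<forall>n. C * c n \<ge> 0)"
proof -
  obtain C N where C: "\<And>n x. cmod (F n x) \<le> C * c n * (1 + \<bar>x\<bar>) ^ N"
    using assms unfolding Pslow_def by blast
  have 0: "C * c n \<ge> 0" for n using order_trans[OF norm_ge_zero C[of n 0]] by simp
  have "cmod (F n x) \<le> C * c n * (1 + \<bar>x\<bar>) ^ M" if "M \<ge> N" for n x M
    by (rule order_trans[OF C mult_left_mono[OF power_increasing[OF that]]]) (auto simp: 0)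
  then show ?thesis using 0 by blast
qed

lemma Pslow_add:
  assumes "Pslow c F" "Pslow c G" shows "Pslow c (\<lambda>n x. F n x + G n x)"
proof -
  obtain C N where C: "\<And>n x M. M \<ge> N \<Longrightarrow> cmod (F n x) \<le> C * c n * (1 + \<bar>x\<bar>) ^ M" "\<And>n. C * c n \<ge> 0"
    using PslowD[OF assms(1)] by blast
  obtain D K where D: "\<And>n x M. M \<ge> K \<Longrightarrow> cmod (G n x) \<le> D * c n * (1 + \<bar>x\<bar>) ^ M" "\<And>n. D * c n \<ge> 0"
    using PslowD[OF assms(2)] by blast
  have "cmod (F n x + G n x) \<le> (C + D) * c n * (1 + \<bar>x\<bar>) ^ (N + K)" for n x
    using C(1)[of "N+K" n x] D(1)[of "N+K" n x] norm_triangle_ineq[of "F n x" "G n x"] by (simp add: algebra_simps)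
  then show ?thesis unfolding Pslow_def by blast
qed

lemma Pslow_mult:
  assumes "Pslow c F" "Pslow d G" shows "Pslow (\<lambda>n. c n * d n) (\<lambda>n x. F n x * G n x)"
proof -
  obtain C N where C: "\<And>n x M. M \<ge> N \<Longrightarrow> cmod (F n x) \<le> C * c n * (1 + \<bar>x\<bar>) ^ M" "\<And>n. C * c n \<ge> 0"
    using PslowD[OF assms(1)] by blast
  obtain D K where D: "\<And>n x M. M \<ge> K \<Longrightarrow> cmod (G n x) \<le> D * d n * (1 + \<bar>x\<bar>) ^ M" "\<And>n. D * d n \<ge> 0"
    using PslowD[OF assms(2)] by blast
  have "cmod (F n x * G n x) \<le> (C * D) * (c n * d n) * (1 + \<bar>x\<bar>) ^ (N + K)" for n x
  proof -
    have "cmod (F n x) * cmod (G n x) \<le> (C * c n * (1 + \<bar>x\<bar>) ^ N) * (D * d n * (1 + \<bar>x\<bar>) ^ K)"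
      by (rule mult_mono) (use C D in auto)
    then show ?thesis by (simp add: norm_mult power_add mult_ac)
  qed
  then show ?thesis unfolding Pslow_def by blast
qed

lemma Prapid_mult:
  assumes "Prapid c F" "Pslow d G" shows "Prapid (\<lambda>n. c n * d n) (\<lambda>n x. F n x * G n x)"
  unfolding Prapid_def
proof
  fix j
  obtain D K where D: "\<And>n x M. M \<ge> K \<Longrightarrow> cmod (G n x) \<le> D * d n * (1 + \<bar>x\<bar>) ^ M" "\<And>n. D * d n \<ge> 0"
    using PslowD[OF assms(2)] by blast
  \<comment> \<open>Decay of order \<open>j + K\<close> pays for the growth of order
    \<open>K\<close> of the other factor.\<close>
  obtain C where C: "\<And>n x. cmod (F n x) * (1 + \<bar>x\<bar>) ^ (j+K) \<le> C * c n"
    using assms(1) unfolding Prapid_def by blast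
  have "cmod (F n x * G n x) * (1 + \<bar>x\<bar>) ^ j \<le> (C * D) * (c n * d n)" for n x
  proof -
    have "cmod (F n x * G n x) * (1 + \<bar>x\<bar>) ^ j = cmod (G n x) * (cmod (F n x) * (1 + \<bar>x\<bar>) ^ j)"
      by (simp add: norm_mult)
    also have "\<dots> \<le> (D * d n * (1 + \<bar>x\<bar>) ^ K) * (cmod (F n x) * (1 + \<bar>x\<bar>) ^ j)"
      by (intro mult_right_mono D) auto
    also have "\<dots> = D * d n * (cmod (F n x) * (1 + \<bar>x\<bar>) ^ (j + K))" by (simp add: power_add)
    also have "\<dots> \<le> D * d n * (C * c n)" by (intro mult_left_mono C D)
    finally show ?thesis by (simp add: algebra_simps)
  qed
  then show "\<exists>C. \<forall>n x. cmod (F n x * G n x) * (1 + \<bar>x\<bar>) ^ j \<le> C * (c n * d n)" by blast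
qed

lemma Prapid_imp_Pslow: "Prapid c F \<Longrightarrow> Pslow c F"
  unfolding Prapid_def Pslow_def by (metis mult.right_neutral power_0)

lemma Pslow_const: "Pslow (\<lambda>_. 1) (\<lambda>_ _. b)"
  unfolding Pslow_def by (rule exI[of _ "cmod b"], rule exI[of _ 0]) auto

lemma Pslow_id: "Pslow (\<lambda>_. 1) (\<lambda>_ x. complex_of_real x)"
  unfolding Pslow_def by (rule exI[of _ 1], rule exI[of _ 1]) auto

lemma Dfun_const: "Dfun (\<lambda>_. b) = (\<lambda>_. 0)"
  by (rule Dfun_eqI) auto

lemma cls_const:
  assumes "\<And>b. P (\<lambda>_ _. b)" shows "cls P k (\<lambda>_ _. b)"
  by (induction k arbitrary: b) (auto simp: assms Dfun_const)

lemma cls_id: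
  assumes "\<And>b. P (\<lambda>_ _. b)" and "P (\<lambda>_ x. complex_of_real x)"
  shows "cls P k (\<lambda>_ x. complex_of_real x)"
proof (rule cls_bootstrap[where F' = "\<lambda>_ _. 1"])
  show "(complex_of_real has_vector_derivative 1) (at x)" for x
    using has_vector_derivative_of_real[OF has_real_derivative_iff_has_vector_derivative[THEN iffD2, OF has_vector_derivative_id]] by simp
qed (auto intro: assms cls_const)

lemma slow_const: "slow (\<lambda>_. b)"
  unfolding slowf_def using cls_const Pslow_const by blast

lemma slow_id: "slow complex_of_real"
  unfolding slowf_def using cls_id[of "Pslow (\<lambda>_. 1)"] Pslow_const Pslow_id by blast

lemma smooth_const: "smooth (\<lambda>_. b)"
  unfolding smooth_cls using cls_const[of "\<lambda>_. True"] by blast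

lemma slowf_mult: "slowf c F \<Longrightarrow> slowf d G \<Longrightarrow> slowf (\<lambda>n. c n * d n) (\<lambda>n x. F n x * G n x)"
  unfolding slowf_def
  using cls_mult[where P = "Pslow c" and Q = "Pslow d" and R = "Pslow (\<lambda>n. c n * d n)", of _ F G] Pslow_mult Pslow_add by blast

lemma slow_mult: "slow f \<Longrightarrow> slow g \<Longrightarrow> slow (\<lambda>x. f x * g x)"
  using slowf_mult[of "\<lambda>_. 1" _ "\<lambda>_. 1"] by simp

lemma schf_mult: "schf c F \<Longrightarrow> slowf d G \<Longrightarrow> schf (\<lambda>n. c n * d n) (\<lambda>n x. F n x * G n x)"
  unfolding schf_def slowf_def
  using cls_mult[where P = "Prapid c" and Q = "Pslow d" and R = "Prapid (\<lambda>n. c n * d n)", of _ F G] Prapid_mult Prapid_add by blast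

lemma schf_mult_slow: "schf c F \<Longrightarrow> slow g \<Longrightarrow> schf c (\<lambda>n x. g x * F n x)"
  using schf_mult[of c F "\<lambda>_. 1" "\<lambda>_. g"] by (simp add: mult.commute)

lemma schf_add: "schf c F \<Longrightarrow> schf c G \<Longrightarrow> schf c (\<lambda>n x. F n x + G n x)"
  unfolding schf_def using cls_add[where P = "Prapid c"] Prapid_add by blast

lemma schf_Dfun: "schf c F \<Longrightarrow> schf c (\<lambda>n. Dfun (F n))"
  unfolding schf_def by (metis cls.simps(2))

lemma smooth_mult: "smooth f \<Longrightarrow> smooth g \<Longrightarrow> smooth (\<lambda>x. f x * g x)"
  unfolding smooth_cls by (intro allI cls_mult[of "\<lambda>_. True" "\<lambda>_. True" "\<lambda>_. True"]) auto

lemma smooth_add: "smooth f \<Longrightarrow> smooth g \<Longrightarrow> smooth (\<lambda>x. f x + g x)"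
  unfolding smooth_cls by (intro allI cls_add[of "\<lambda>_. True"]) auto

lemma smooth_Dfun: "smooth f \<Longrightarrow> smooth (Dfun f)"
proof -
  assume "smooth f"
  then have "cls (\<lambda>_. True) (Suc k) (\<lambda>_. f)" for k unfolding smooth_cls by blast
  then show ?thesis unfolding smooth_cls by simp
qed

lemma smooth_vd: "smooth f \<Longrightarrow> (f has_vector_derivative Dfun f x) (at x)"
  by (metis smooth_def funpow_0 has_vd_Dfun)

lemma slow_smooth: "slow f \<Longrightarrow> smooth f"
  unfolding slowf_def cls_all_iff by blast

lemma schf_smooth: "schf c F \<Longrightarrow> smooth (F n)"
  unfolding schf_def cls_all_iff by blast

lemma schf_Prapid: "schf c F \<Longrightarrow> Prapid c F"
  unfolding schf_def by (metis cls.simps(1))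

lemma schf_imp_slow: "schf c F \<Longrightarrow> slowf c F"
  unfolding schf_def slowf_def by (auto intro: cls_mono[of "Prapid c" "Pslow c", OF Prapid_imp_Pslow])

lemma one_plus_abs_power_le: "(1 + \<bar>x\<bar>) ^ j \<le> 2 ^ j * (1 + \<bar>x ^ j\<bar>)" for x :: real
proof (cases "\<bar>x\<bar> \<le> 1")
  case True
  have "(1 + \<bar>x\<bar>) ^ j \<le> 2 ^ j * 1" using True by (simp add: power_mono)
  also have "\<dots> \<le> 2 ^ j * (1 + \<bar>x ^ j\<bar>)" by (intro mult_left_mono) auto
  finally show ?thesis .
next
  case False
  have "(1 + \<bar>x\<bar>) ^ j \<le> (2 * \<bar>x\<bar>) ^ j" using False by (intro power_mono) auto
  also have "\<dots> \<le> 2 ^ j * (1 + \<bar>x ^ j\<bar>)" by (simp add: power_mult_distrib power_abs)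
  finally show ?thesis .
qed

text \<open>Bounds with \<open>(1 + |x|)^j\<close> and bounds with the monomials \<open>x^j\<close>
  and \<open>x^0\<close> are equivalent for each derivative. The former multiply well, the latter
  are the ones in \<open>schwartz\<close>.\<close>

lemma schwartz_iff: "\<phi> \<in> schwartz \<longleftrightarrow> schf (\<lambda>_. 1) (\<lambda>_. \<phi>)"
proof -
  have "Prapid (\<lambda>_. 1) (\<lambda>_. f) \<longleftrightarrow> (\<forall>j. bounded (range (\<lambda>x. complex_of_real (x ^ j) * f x)))" for f
  proof
    assume R: "Prapid (\<lambda>_. 1) (\<lambda>_. f)"
    show "\<forall>j. bounded (range (\<lambda>x. complex_of_real (x ^ j) * f x))"
    proof
      fix j
      obtain C where C: "\<And>x. cmod (f x) * (1 + \<bar>x\<bar>) ^ j \<le> C"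
        using R unfolding Prapid_def by (metis mult.right_neutral)
      have "cmod (complex_of_real (x ^ j) * f x) \<le> C" for x
      proof -
        have "\<bar>x\<bar> ^ j \<le> (1 + \<bar>x\<bar>) ^ j" by (intro power_mono) auto
        then have "cmod (complex_of_real (x ^ j) * f x) \<le> cmod (f x) * (1 + \<bar>x\<bar>) ^ j"
          unfolding norm_mult norm_of_real power_abs by (subst mult.commute) (rule mult_left_mono, auto)
        then show ?thesis using C[of x] by linarith
      qed
      then show "bounded (range (\<lambda>x. complex_of_real (x ^ j) * f x))"
        unfolding bounded_iff by blast
    qed
  next
    assume B: "\<forall>j. bounded (range (\<lambda>x. complex_of_real (x ^ j) * f x))"
    show "Prapid (\<lambda>_. 1) (\<lambda>_. f)" unfolding Prapid_def
    proof
      fix j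
      obtain C where C: "\<And>x. cmod (complex_of_real (x ^ j) * f x) \<le> C"
        using B[rule_format, of j] unfolding bounded_iff by auto
      obtain D where D: "\<And>x. cmod (complex_of_real (x ^ 0) * f x) \<le> D"
        using B[rule_format, of 0] unfolding bounded_iff by auto
      have "cmod (f x) * (1 + \<bar>x\<bar>) ^ j \<le> 2 ^ j * (D + C)" for x
      proof -
        have "cmod (f x) * (1 + \<bar>x\<bar>) ^ j \<le> cmod (f x) * (2 ^ j * (1 + \<bar>x ^ j\<bar>))"
          by (intro mult_left_mono one_plus_abs_power_le) auto
        also have "\<dots> = 2 ^ j * (cmod (f x) + cmod (complex_of_real (x ^ j) * f x))"
          unfolding norm_mult norm_of_real by (simp add: algebra_simps)
        also have "\<dots> \<le> 2 ^ j * (D + C)" using C[of x] D[of x] by (intro mult_left_mono add_mono) auto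
        finally show ?thesis .
      qed
      then show "\<exists>C. \<forall>n x. cmod (f x) * (1 + \<bar>x\<bar>) ^ j \<le> C * 1" by auto
    qed
  qed
  then show ?thesis unfolding schwartz_def schf_def cls_all_iff by auto
qed

lemma schf_schwartz:
  assumes "schf c F" shows "F n \<in> schwartz"
proof -
  have "Prapid c G \<Longrightarrow> Prapid (\<lambda>_. 1) (\<lambda>_. G n)" for G
    unfolding Prapid_def by (metis mult.right_neutral)
  then show ?thesis using assms unfolding schwartz_iff schf_def cls_all_iff by blast
qed

lemma schf_seminorm:
  assumes "schf c F" shows "\<exists>C. \<forall>n. schwartz_seminorm j k (F n) \<le> C * c n"
proof -
  have "Prapid c (\<lambda>n. (Dfun ^^ k) (F n))" using assms unfolding schf_def cls_all_iff by blast
  then obtain C where C: "\<And>n x. cmod ((Dfun ^^ k) (F n) x) * (1 + \<bar>x\<bar>) ^ j \<le> C * c n"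
    unfolding Prapid_def by blast
  have "cmod (complex_of_real (x ^ j) * (Dfun ^^ k) (F n) x) \<le> C * c n" for n x
  proof -
    have "\<bar>x\<bar> ^ j \<le> (1 + \<bar>x\<bar>) ^ j" by (intro power_mono) auto
    then have "cmod (complex_of_real (x ^ j) * (Dfun ^^ k) (F n) x) \<le> cmod ((Dfun ^^ k) (F n) x) * (1 + \<bar>x\<bar>) ^ j"
      unfolding norm_mult norm_of_real power_abs by (subst mult.commute) (rule mult_left_mono, auto)
    then show ?thesis using C[of n x] by linarith
  qed
  then have "schwartz_seminorm j k (F n) \<le> C * c n" for n
    unfolding schwartz_seminorm_def by (intro cSUP_least) auto
  then show ?thesis by blast
qed

lemma schwartz_seminorm_nonneg:
  assumes "\<phi> \<in> schwartz" shows "schwartz_seminorm j k \<phi> \<ge> 0"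
proof -
  have "bounded (range (\<lambda>x. complex_of_real (x ^ j) * (Dfun ^^ k) \<phi> x))"
    using assms unfolding schwartz_def by blast
  then have "bdd_above (range (\<lambda>x. cmod (complex_of_real (x ^ j) * (Dfun ^^ k) \<phi> x)))"
    unfolding bounded_iff bdd_above_def by auto
  then show ?thesis unfolding schwartz_seminorm_def
    by (rule cSUP_upper2[OF _ UNIV_I]) auto
qed

text \<open>Turns the seminorm estimate into a statement about rates: a family that is small at rate
  \<open>c\<close> has values that are small at rate \<open>c\<close>. The constant in
  \<open>tempered\<close> has no sign, hence \<open>|C|\<close> in the proof.\<close>

lemma tempered_bound:
  assumes u: "u \<in> tempered" and F: "schf c F"
  shows "\<exists>C. \<forall>n. cmod (u (F n)) \<le> C * c n"
proof -
  obtain C N where C: "\<And>\<phi>. \<phi> \<in> schwartz \<Longrightarrow> cmod (u \<phi>) \<le> C * (\<Sum>j\<le>N. \<Sum>k\<le>N. schwartz_seminorm j k \<phi>)"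
    using u unfolding tempered_def by blast
  obtain D where D: "\<And>j k n. schwartz_seminorm j k (F n) \<le> D j k * c n"
    using schf_seminorm[OF F] by metis
  have "cmod (u (F n)) \<le> (\<bar>C\<bar> * (\<Sum>j\<le>N. \<Sum>k\<le>N. D j k)) * c n" for n
  proof -
    have S: "F n \<in> schwartz" using schf_schwartz[OF F] .
    have "cmod (u (F n)) \<le> C * (\<Sum>j\<le>N. \<Sum>k\<le>N. schwartz_seminorm j k (F n))" using C S by blast
    also have "\<dots> \<le> \<bar>C\<bar> * (\<Sum>j\<le>N. \<Sum>k\<le>N. schwartz_seminorm j k (F n))"
      by (intro mult_right_mono sum_nonneg schwartz_seminorm_nonneg S) auto
    also have "\<dots> \<le> \<bar>C\<bar> * (\<Sum>j\<le>N. \<Sum>k\<le>N. D j k * c n)"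
      by (intro mult_left_mono sum_mono D) auto
    finally show ?thesis by (simp add: sum_distrib_right mult.assoc)
  qed
  then show ?thesis by blast
qed

lemma tempered_outside: "u \<in> tempered \<Longrightarrow> \<phi> \<notin> schwartz \<Longrightarrow> u \<phi> = 0"
  unfolding tempered_def by blast

lemma tempered_lin: "u \<in> tempered \<Longrightarrow> \<phi> \<in> schwartz \<Longrightarrow> \<psi> \<in> schwartz \<Longrightarrow>
   u (\<lambda>x. a * \<phi> x + b * \<psi> x) = a * u \<phi> + b * u \<psi>"
  unfolding tempered_def by blast

lemma schwartz_mult: "slow g \<Longrightarrow> \<phi> \<in> schwartz \<Longrightarrow> (\<lambda>x. g x * \<phi> x) \<in> schwartz"
  unfolding schwartz_iff by (rule schf_mult_slow)

lemma schwartz_add: "\<psi> \<in> schwartz \<Longrightarrow> \<phi> \<in> schwartz \<Longrightarrow> (\<lambda>x. \<psi> x + \<phi> x) \<in> schwartz"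
  unfolding schwartz_iff by (rule schf_add)

lemma schwartz_cmult: "\<phi> \<in> schwartz \<Longrightarrow> (\<lambda>x. b * \<phi> x) \<in> schwartz"
  by (rule schwartz_mult[OF slow_const])

lemma schwartz_diff: "\<psi> \<in> schwartz \<Longrightarrow> \<phi> \<in> schwartz \<Longrightarrow> (\<lambda>x. \<psi> x - \<phi> x) \<in> schwartz"
  using schwartz_add[OF _ schwartz_cmult[of \<phi> "-1"], of \<psi>] by simp

lemma schwartz_Dfun: "\<phi> \<in> schwartz \<Longrightarrow> Dfun \<phi> \<in> schwartz"
  unfolding schwartz_iff by (rule schf_Dfun)

lemma schwartz_smooth: "\<phi> \<in> schwartz \<Longrightarrow> smooth \<phi>"
  unfolding schwartz_def by blast

lemma schwartz_imp_slow: "\<phi> \<in> schwartz \<Longrightarrow> slow \<phi>"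
  unfolding schwartz_iff by (rule schf_imp_slow)

lemma smooth_continuous: "smooth f \<Longrightarrow> continuous_on A f"
  by (meson continuous_at_imp_continuous_on has_vector_derivative_continuous smooth_vd)

text \<open>All derivatives vanish on the open set outside the support radius and are continuous on
  the remaining compact interval, hence bounded against every monomial.\<close>

lemma test_fun_schwartz:
  assumes "\<phi> \<in> test_fun" shows "\<phi> \<in> schwartz"
proof -
  obtain R where s: "smooth \<phi>" and R: "\<And>x. \<bar>x\<bar> > R \<Longrightarrow> \<phi> x = 0"
    using assms unfolding test_fun_def by auto
  have Dz: "(Dfun ^^ k) \<phi> x = 0" if "\<bar>x\<bar> > R" for k x using that
  proof (induction k arbitrary: x)
    case 0 then show ?case using R by simp
  next
    case (Suc k)
    have o: "open {y::real. \<bar>y\<bar> > R}" by (intro open_Collect_less continuous_intros)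
    have "((\<lambda>_. 0) has_vector_derivative 0) (at x)" by simp
    then have "((Dfun ^^ k) \<phi> has_vector_derivative 0) (at x)"
      by (rule has_vector_derivative_transform_within_open[OF _ o]) (use Suc in auto)
    then show ?case unfolding funpow.simps comp_def Dfun_def by (rule vector_derivative_at)
  qed
  have "bounded (range (\<lambda>x. complex_of_real (x ^ j) * (Dfun ^^ k) \<phi> x))" for j k
  proof -
    have "smooth ((Dfun ^^ k) \<phi>)" by (induction k) (auto simp: s smooth_Dfun)
    then have "continuous_on {-R..R} (\<lambda>x. complex_of_real (x ^ j) * (Dfun ^^ k) \<phi> x)"
      by (intro continuous_intros smooth_continuous)
    then have "bounded ((\<lambda>x. complex_of_real (x ^ j) * (Dfun ^^ k) \<phi> x) ` {-R..R})"
      by (intro compact_imp_bounded compact_continuous_image) auto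
    moreover have "range (\<lambda>x. complex_of_real (x ^ j) * (Dfun ^^ k) \<phi> x) \<subseteq>
       insert 0 ((\<lambda>x. complex_of_real (x ^ j) * (Dfun ^^ k) \<phi> x) ` {-R..R})"
    proof
      fix y assume "y \<in> range (\<lambda>x. complex_of_real (x ^ j) * (Dfun ^^ k) \<phi> x)"
      then obtain x where y: "y = complex_of_real (x ^ j) * (Dfun ^^ k) \<phi> x" by blast
      show "y \<in> insert 0 ((\<lambda>x. complex_of_real (x ^ j) * (Dfun ^^ k) \<phi> x) ` {-R..R})"
      proof (cases "\<bar>x\<bar> > R")
        case True then show ?thesis using y Dz by simp
      next
        case False then have "x \<in> {-R..R}" by auto
        then show ?thesis using y by blast
      qed
    qed
    ultimately show ?thesis by (meson bounded_insert bounded_subset)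
  qed
  then show ?thesis using s unfolding schwartz_def by blast
qed

lemma test_fun_mult:
  assumes "smooth g" "\<phi> \<in> test_fun" shows "(\<lambda>x. g x * \<phi> x) \<in> test_fun"
proof -
  obtain R where R: "\<forall>x. \<bar>x\<bar> > R \<longrightarrow> \<phi> x = 0" using assms(2) unfolding test_fun_def by blast
  have "smooth (\<lambda>x. g x * \<phi> x)" by (rule smooth_mult) (use assms in \<open>auto simp: test_fun_def\<close>)
  moreover have "\<forall>x. \<bar>x\<bar> > R \<longrightarrow> g x * \<phi> x = 0" using R by simp
  ultimately show ?thesis unfolding test_fun_def by blast
qed

text \<open>For \<open>f' = g f\<close>, each bootstrap round only multiplies by \<open>g\<close>,
  so all derivatives of \<open>f\<close> are controlled by a bound on \<open>f\<close> alone.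
  Exponential weights, Gaussians and the oscillations \<open>cis\<close> are treated in this
  way.\<close>

lemma cls_linear_ode:
  assumes d: "\<And>x. (f has_vector_derivative g x * f x) (at x)"
    and g: "\<And>k. cls Q k (\<lambda>_. g)" and P: "P (\<lambda>_. f)"
    and QP: "\<And>F G. Q F \<Longrightarrow> P G \<Longrightarrow> P (\<lambda>n x. F n x * G n x)"
    and PP: "\<And>F G. P F \<Longrightarrow> P G \<Longrightarrow> P (\<lambda>n x. F n x + G n x)"
  shows "cls P k (\<lambda>_. f)"
proof (rule cls_bootstrap[where F' = "\<lambda>_ x. g x * f x"])
  show "cls P k (\<lambda>_ x. g x * f x)" if "cls P k (\<lambda>_. f)" for k
    by (rule cls_mult[where P = Q and Q = P and R = P]) (use g that QP PP in auto)
qed (use d P in auto)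

lemma slow_linear_ode:
  assumes "\<And>x. (f has_vector_derivative g x * f x) (at x)" "slow g" "Pslow (\<lambda>_. 1) (\<lambda>_. f)"
  shows "slow f"
  unfolding slowf_def
proof
  fix k show "cls (Pslow (\<lambda>_. 1)) k (\<lambda>_. f)"
  proof (rule cls_linear_ode[where Q = "Pslow (\<lambda>_. 1)" and g = g])
    show "Pslow (\<lambda>_. 1) (\<lambda>n x. F n x * G n x)" if "Pslow (\<lambda>_. 1) F" "Pslow (\<lambda>_. 1) G" for F G
      using Pslow_mult[OF that] by simp
  qed (use assms Pslow_add in \<open>auto simp: slowf_def\<close>)
qed

lemma schwartz_linear_ode:
  assumes "\<And>x. (f has_vector_derivative g x * f x) (at x)" "slow g" "Prapid (\<lambda>_. 1) (\<lambda>_. f)"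
  shows "f \<in> schwartz"
  unfolding schwartz_iff schf_def
proof
  fix k show "cls (Prapid (\<lambda>_. 1)) k (\<lambda>_. f)"
  proof (rule cls_linear_ode[where Q = "Pslow (\<lambda>_. 1)" and g = g])
    show "Prapid (\<lambda>_. 1) (\<lambda>n x. F n x * G n x)" if "Pslow (\<lambda>_. 1) F" "Prapid (\<lambda>_. 1) G" for F G
      using Prapid_mult[OF that(2,1)] by (simp add: mult.commute)
  qed (use assms Prapid_add in \<open>auto simp: slowf_def\<close>)
qed

lemma smooth_linear_ode:
  assumes "\<And>x. (f has_vector_derivative g x * f x) (at x)" "smooth g"
  shows "smooth f"
  unfolding smooth_cls
proof
  fix k show "cls (\<lambda>_. True) k (\<lambda>_. f)"
    by (rule cls_linear_ode[where Q = "\<lambda>_. True" and g = g]) (use assms in \<open>auto simp: smooth_cls\<close>)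
qed

lemma smooth_exp:
  assumes d: "\<And>x. (h has_vector_derivative h' x) (at x)" and "smooth h'"
  shows "smooth (\<lambda>x. exp (h x))"
proof (rule smooth_linear_ode)
  show "((\<lambda>x. exp (h x)) has_vector_derivative h' x * exp (h x)) (at x)" for x
    using field_vector_diff_chain_at[OF d, of exp "exp (h x)" x] DERIV_exp[of "h x"]
    by (simp add: comp_def)
qed fact

text \<open>The derivative is \<open>- g'\<close> times the square of the reciprocal, so the
  reciprocal feeds its own regularity.\<close>

lemma smooth_inverse:
  assumes "smooth g" and nz: "\<And>x. g x \<noteq> 0"
  shows "smooth (\<lambda>x. inverse (g x))"
proof (rule smooth_cls[THEN iffD2], rule allI)
  fix k
  show "cls (\<lambda>_. True) k (\<lambda>_ x. inverse (g x))"
  proof (rule cls_bootstrap[where F' = "\<lambda>_ x. (- 1 * Dfun g x) * (inverse (g x) * inverse (g x))"])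
    show "((\<lambda>x. inverse (g x)) has_vector_derivative (- 1 * Dfun g x) * (inverse (g x) * inverse (g x))) (at x)" for x
      using field_vector_diff_chain_at[OF smooth_vd[OF assms(1)], of inverse "- (inverse (g x) * inverse (g x))" x]
        DERIV_inverse[OF nz[of x]]
      by (simp add: comp_def power2_eq_square)
    show "cls (\<lambda>_. True) k (\<lambda>_ x. (- 1 * Dfun g x) * (inverse (g x) * inverse (g x)))"
      if "cls (\<lambda>_. True) k (\<lambda>_ x. inverse (g x))" for k
      using that smooth_Dfun[OF assms(1), unfolded smooth_cls]
      by (intro cls_mult[of "\<lambda>_. True" "\<lambda>_. True" "\<lambda>_. True"] cls_const) auto
  qed auto
qed

lemma affine_vd:
  fixes f :: "real \<Rightarrow> complex"
  assumes "\<And>x. (f has_vector_derivative f' x) (at x)"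
  shows "((\<lambda>x. f (a * x + b)) has_vector_derivative complex_of_real a * f' (a * x + b)) (at x)"
proof -
  have "((\<lambda>x. a * x + b) has_vector_derivative a) (at x)"
    by (auto intro!: derivative_eq_intros simp: has_real_derivative_iff_has_vector_derivative[symmetric])
  from vector_diff_chain_at[OF this assms]
  show ?thesis by (simp add: comp_def scaleR_conv_of_real)
qed

lemma smooth_affine:
  assumes "smooth f" shows "smooth (\<lambda>x. f (a * x + b))"
proof (rule smooth_cls[THEN iffD2], rule allI)
  fix k
  show "cls (\<lambda>_. True) k (\<lambda>_ x. f (a * x + b))" using assms
  proof (induction k arbitrary: f)
    case (Suc k)
    have "cls (\<lambda>_. True) k (\<lambda>_ x. complex_of_real a * Dfun f (a * x + b))"
      by (intro cls_mult[of "\<lambda>_. True" "\<lambda>_. True" "\<lambda>_. True"] Suc.IH smooth_Dfun Suc.prems cls_const) auto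
    then show ?case
      by (intro cls_SucI[OF affine_vd[OF smooth_vd[OF Suc.prems]]]) auto
  qed simp
qed

section \<open>Powers of the Japanese bracket and the exponential weights\<close>

lemma jap_ge_1: "jap x \<ge> 1"
  unfolding jap_def by simp

lemma jap_pos: "jap x > 0"
  using jap_ge_1[of x] by linarith

lemma jap_powr: "jap x powr p = (1 + x\<^sup>2) powr (p / 2)"
  unfolding jap_def by (simp add: powr_half_sqrt[symmetric] powr_powr add_nonneg_nonneg)

lemma jap_minus: "jap (- x) = jap x"
  unfolding jap_def by simp

lemma jap_le: "jap x \<le> 1 + \<bar>x\<bar>"
proof -
  have "1 + x\<^sup>2 \<le> (1 + \<bar>x\<bar>)\<^sup>2" by (simp add: power2_eq_square algebra_simps)
  then show ?thesis unfolding jap_def by (intro real_le_lsqrt) auto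
qed

lemma jap_ge: "jap x \<ge> \<bar>x\<bar>"
  unfolding jap_def by (intro real_le_rsqrt) auto

lemma jap_powr_deriv:
  "((\<lambda>x. jap x powr p) has_real_derivative p * x * jap x powr (p - 2)) (at x)"
proof -
  have "1 + x\<^sup>2 > 0" by (smt (verit) zero_le_power2)
  then have "((\<lambda>x. (1 + x\<^sup>2) powr (p / 2)) has_real_derivative (p / 2) * (1 + x\<^sup>2) powr (p / 2 - 1) * (2 * x)) (at x)"
    by (auto intro!: derivative_eq_intros)
  moreover have "p / 2 - 1 = (p - 2) / 2" by simp
  ultimately show ?thesis unfolding jap_powr by (simp add: mult_ac)
qed

lemma jap_powr_le: "p \<le> real N \<Longrightarrow> jap x powr p \<le> (1 + \<bar>x\<bar>) ^ N"
proof -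
  assume "p \<le> real N"
  then have "jap x powr p \<le> jap x powr real N" by (intro powr_mono jap_ge_1) auto
  also have "\<dots> = jap x ^ N" using jap_pos by (simp add: powr_realpow)
  also have "\<dots> \<le> (1 + \<bar>x\<bar>) ^ N" using jap_le jap_pos by (intro power_mono) (auto intro: less_imp_le)
  finally show ?thesis .
qed

lemma slow_jap: "slow (\<lambda>x. complex_of_real (jap x powr p))"
  unfolding slowf_def
proof
  fix k
  show "cls (Pslow (\<lambda>_. 1)) k (\<lambda>_ x. complex_of_real (jap x powr p))"
  \<comment> \<open>The derivative is a slow factor times the power \<open>p - 2\<close>, so the
    exponent has to vary in the induction.\<close>
  proof (induction k arbitrary: p)
    case 0
    obtain N :: nat where "p \<le> real N" using real_arch_simple by blast
    then have "Pslow (\<lambda>_. 1) (\<lambda>_ x. complex_of_real (jap x powr p))"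
      unfolding Pslow_def using jap_powr_le[of p N] by (intro exI[of _ 1] exI[of _ N]) auto
    then show ?case by simp
  next
    case (Suc k)
    have d: "((\<lambda>x. complex_of_real (jap x powr p)) has_vector_derivative
       (complex_of_real p * complex_of_real x) * complex_of_real (jap x powr (p - 2))) (at x)" for x
      using has_vector_derivative_of_real[OF jap_powr_deriv[of p x]] by simp
    have "cls (Pslow (\<lambda>_. 1)) k (\<lambda>_ x. (complex_of_real p * complex_of_real x) * complex_of_real (jap x powr (p - 2)))"
    proof (rule cls_mult[where P = "Pslow (\<lambda>_. 1)" and Q = "Pslow (\<lambda>_. 1)"])
      show "cls (Pslow (\<lambda>_. 1)) k (\<lambda>_ x. complex_of_real p * complex_of_real x)"
        using slow_mult[OF slow_const slow_id] unfolding slowf_def by blast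
      show "Pslow (\<lambda>_. 1) (\<lambda>n x. F n x * G n x)" if "Pslow (\<lambda>_. 1) F" "Pslow (\<lambda>_. 1) G" for F G
        using Pslow_mult[OF that] by simp
    qed (use Suc Pslow_add in auto)
    then show ?case by (intro cls_SucI[OF d]) (use Suc[of p] cls_0 in auto)
  qed
qed

lemma jap_powr_vd: "((\<lambda>x. complex_of_real (jap x powr p)) has_vector_derivative
   (complex_of_real p * complex_of_real x) * complex_of_real (jap x powr (p - 2))) (at x)"
  using has_vector_derivative_of_real[OF jap_powr_deriv[of p x]] by simp

lemma slow_jap_deriv: "slow (\<lambda>x. (complex_of_real p * complex_of_real x) * complex_of_real (jap x powr (p - 2)))"
  by (intro slow_mult slow_const slow_id slow_jap)

lemma smooth_exp_weight: "smooth (exp_weight r p)"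
proof -
  have "smooth (\<lambda>x. exp (complex_of_real r * complex_of_real (jap x powr (1 / p))))"
    by (rule smooth_exp[OF has_vector_derivative_mult_right[OF jap_powr_vd]])
      (intro slow_smooth slow_mult slow_const slow_jap_deriv)
  then show ?thesis unfolding exp_weight_def by (simp add: exp_of_real[symmetric])
qed

lemma exp_weight_vd: "(exp_weight r p has_vector_derivative
   (complex_of_real r * ((complex_of_real (1/p) * complex_of_real x) * complex_of_real (jap x powr (1/p - 2)))) * exp_weight r p x) (at x)"
proof -
  have "((\<lambda>x. exp (complex_of_real r * complex_of_real (jap x powr (1 / p)))) has_vector_derivative
      (complex_of_real r * ((complex_of_real (1/p) * complex_of_real x) * complex_of_real (jap x powr (1/p - 2)))) *
      exp (complex_of_real r * complex_of_real (jap x powr (1 / p)))) (at x)"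
    using field_vector_diff_chain_at[OF has_vector_derivative_mult_right[OF jap_powr_vd, of "complex_of_real r" "1/p" x], of exp]
      DERIV_exp by (simp add: comp_def)
  then show ?thesis unfolding exp_weight_def by (simp add: exp_of_real[symmetric])
qed

lemma power_le_fact_exp:
  fixes x :: real assumes "x \<ge> 0" shows "x ^ m \<le> fact m * exp x"
proof -
  have "x ^ m / fact m \<le> (\<Sum>n\<in>{m}. x ^ n /\<^sub>R fact n)" by (simp add: divide_inverse)
  also have "\<dots> \<le> exp x" unfolding exp_def
    by (rule sum_le_suminf) (use assms summable_exp_generic[of x] in auto)
  finally show ?thesis by (simp add: field_simps)
qed

text \<open>With \<open>m \<ge> j / p\<close> the power \<open>y^j\<close> is at most
  \<open>(y^p)^m\<close>, and the single term of order \<open>m\<close> of the exponential series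
  already beats it; the constant is \<open>m! / r^m\<close>.\<close>

lemma exp_neg_powr_bound:
  fixes r p :: real
  assumes "r > 0" "p > 0"
  shows "\<exists>C. \<forall>y\<ge>1. exp (- r * y powr p) * y ^ j \<le> C"
proof -
  obtain m :: nat where m: "real j / p \<le> real m" using real_arch_simple by blast
  have "exp (- r * y powr p) * y ^ j \<le> fact m / r ^ m" if y: "y \<ge> 1" for y
  proof -
    have "y ^ j = y powr real j" using y by (simp add: powr_realpow)
    also have "\<dots> \<le> y powr (p * real m)"
      using y m assms by (intro powr_mono) (auto simp: field_simps)
    also have "\<dots> = (y powr p) ^ m" using y by (simp add: powr_powr[symmetric] powr_realpow)
    also have "\<dots> = (r * y powr p) ^ m / r ^ m" using assms by (simp add: power_mult_distrib)
    also have "\<dots> \<le> fact m * exp (r * y powr p) / r ^ m"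
      using assms by (intro divide_right_mono power_le_fact_exp) auto
    finally have "exp (- r * y powr p) * y ^ j \<le> exp (- r * y powr p) * (fact m * exp (r * y powr p) / r ^ m)"
      by (intro mult_left_mono) auto
    also have "\<dots> = fact m / r ^ m" by (simp add: exp_minus field_simps)
    finally show ?thesis .
  qed
  then show ?thesis by blast
qed

text \<open>Makes division by a weight harmless: multiplication by the reciprocal weight preserves
  Schwartz functions, so relations known on test functions can be carried over to all Schwartz
  functions.\<close>

lemma exp_weight_neg_schwartz:
  assumes "r > 0" "p > 0" shows "exp_weight (- r) p \<in> schwartz"
proof (rule schwartz_linear_ode[OF exp_weight_vd])
  show "slow (\<lambda>x. complex_of_real (- r) * ((complex_of_real (1/p) * complex_of_real x) * complex_of_real (jap x powr (1/p - 2))))"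
    by (intro slow_mult slow_const slow_id slow_jap)
  show "Prapid (\<lambda>_. 1) (\<lambda>_. exp_weight (- r) p)"
    unfolding Prapid_def
  proof
    fix j
    obtain C where C: "\<And>y. y \<ge> 1 \<Longrightarrow> exp (- r * y powr (1/p)) * y ^ j \<le> C"
      using exp_neg_powr_bound[of r "1/p" j] assms by auto
    have "cmod (exp_weight (- r) p x) * (1 + \<bar>x\<bar>) ^ j \<le> 2 ^ j * C" for x
    proof -
      have "1 + \<bar>x\<bar> \<le> 2 * jap x" using jap_ge[of x] jap_ge_1[of x] by linarith
      then have "(1 + \<bar>x\<bar>) ^ j \<le> (2 * jap x) ^ j" by (intro power_mono) auto
      then have "cmod (exp_weight (- r) p x) * (1 + \<bar>x\<bar>) ^ j \<le> exp (- r * jap x powr (1/p)) * (2 * jap x) ^ j"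
        unfolding exp_weight_def by (simp add: mult_left_mono)
      also have "\<dots> = 2 ^ j * (exp (- r * jap x powr (1/p)) * jap x ^ j)" by (simp add: power_mult_distrib)
      also have "\<dots> \<le> 2 ^ j * C" by (intro mult_left_mono C jap_ge_1) auto
      finally show ?thesis .
    qed
    then show "\<exists>C. \<forall>n x. cmod (exp_weight (- r) p x) * (1 + \<bar>x\<bar>) ^ j \<le> C * 1" by auto
  qed
qed

lemma exp_weight_inverse: "exp_weight r p x * exp_weight (- r) p x = 1"
  unfolding exp_weight_def by (simp flip: of_real_mult exp_add)

section \<open>Smooth cutoffs\<close>

definition flat :: "nat \<Rightarrow> real \<Rightarrow> real" where
  "flat n x = (if x > 0 then exp (- (1 / x)) / x ^ n else 0)"

text \<open>The division by \<open>x^n\<close> closes the family under differentiation, so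
  smoothness follows by one induction over all \<open>n\<close>. At 0 the right difference quotient
  is \<open>exp (- 1/y) / y^(n+1)\<close>, which the exponential sends to 0.\<close>

lemma flat_vd: "(flat n has_real_derivative - real n * flat (Suc n) x + flat (Suc (Suc n)) x) (at x)"
proof -
  consider "x > 0" | "x < 0" | "x = 0" by linarith
  then show ?thesis
  proof cases
    case 1
    have "((\<lambda>x. exp (- (1 / x)) / x ^ n) has_real_derivative
       (exp (- (1 / x)) * (1 / x\<^sup>2) * x ^ n - exp (- (1 / x)) * (real n * x ^ (n - 1))) / (x ^ n * x ^ n)) (at x)"
      using 1 by (auto intro!: derivative_eq_intros simp: power2_eq_square)
    also have "(exp (- (1 / x)) * (1 / x\<^sup>2) * x ^ n - exp (- (1 / x)) * (real n * x ^ (n - 1))) / (x ^ n * x ^ n)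
        = - real n * flat (Suc n) x + flat (Suc (Suc n)) x"
      using 1 by (cases n) (auto simp: flat_def field_simps power2_eq_square)
    finally show ?thesis
      by (rule has_field_derivative_transform_within_open[of _ _ _ "{0<..}"]) (use 1 in \<open>auto simp: flat_def\<close>)
  next
    case 2
    have "((\<lambda>_. 0) has_real_derivative 0) (at x)" by simp
    then have "(flat n has_real_derivative 0) (at x)"
      by (rule has_field_derivative_transform_within_open[of _ _ _ "{..<0}"]) (use 2 in \<open>auto simp: flat_def\<close>)
    then show ?thesis using 2 by (simp add: flat_def)
  next
    case 3
    have "((\<lambda>y. flat n (0 + y) / y) \<longlongrightarrow> 0) (at_right 0)"
    proof -
      have "((\<lambda>y::real. inverse y ^ Suc n / exp (inverse y)) \<longlongrightarrow> 0) (at_right 0)"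
        by (rule filterlim_compose[OF tendsto_power_div_exp_0 filterlim_inverse_at_top_right])
      then show ?thesis
        by (rule Lim_transform_eventually) (auto simp: eventually_at_filter flat_def exp_minus field_simps)
    qed
    moreover have "((\<lambda>y. flat n (0 + y) / y) \<longlongrightarrow> 0) (at_left 0)"
      by (rule tendsto_eventually) (auto simp: eventually_at_filter flat_def)
    ultimately have "((\<lambda>y. flat n (0 + y) / y) \<longlongrightarrow> 0) (at 0)"
      by (simp add: filterlim_split_at)
    then have "(flat n has_real_derivative 0) (at 0)"
      unfolding DERIV_def by (simp add: flat_def)
    then show ?thesis using 3 by (simp add: flat_def)
  qed
qed

lemma smooth_flat: "smooth (\<lambda>x. complex_of_real (flat n x))"
proof (rule smooth_cls[THEN iffD2], rule allI)
  fix k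
  show "cls (\<lambda>_. True) k (\<lambda>_ x. complex_of_real (flat n x))"
  proof (induction k arbitrary: n)
    case (Suc k)
    have "cls (\<lambda>_. True) k (\<lambda>_ x. complex_of_real (- real n) * complex_of_real (flat (Suc n) x) + complex_of_real (flat (Suc (Suc n)) x))"
      by (intro cls_mult[of "\<lambda>_. True" "\<lambda>_. True" "\<lambda>_. True"] cls_add[of "\<lambda>_. True"] Suc.IH cls_const) auto
    moreover have "((\<lambda>x. complex_of_real (flat n x)) has_vector_derivative
       complex_of_real (- real n) * complex_of_real (flat (Suc n) x) + complex_of_real (flat (Suc (Suc n)) x)) (at x)" for x
      using has_vector_derivative_of_real[OF flat_vd[of n x]] by simp
    ultimately show ?case by (intro cls_SucI[where F' = "\<lambda>_ x. complex_of_real (- real n) * complex_of_real (flat (Suc n) x) + complex_of_real (flat (Suc (Suc n)) x)"]) auto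
  qed simp
qed

definition step :: "real \<Rightarrow> real" where
  "step x = flat 0 x / (flat 0 x + flat 0 (1 - x))"

lemma flat_nonneg: "flat 0 x \<ge> 0" by (simp add: flat_def)

text \<open>At least one of \<open>x\<close> and \<open>1 - x\<close> is positive.\<close>

lemma step_denom_pos: "flat 0 x + flat 0 (1 - x) > 0"
  by (auto simp: flat_def add_pos_pos)

lemma step_bounds: "0 \<le> step x" "step x \<le> 1"
  using step_denom_pos[of x] flat_nonneg[of x] flat_nonneg[of "1 - x"] by (auto simp: step_def)

lemma step_0: "x \<le> 0 \<Longrightarrow> step x = 0"
  by (simp add: step_def flat_def)

lemma step_1: "x \<ge> 1 \<Longrightarrow> step x = 1"
  by (simp add: step_def flat_def)

lemma smooth_step: "smooth (\<lambda>x. complex_of_real (step x))"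
proof -
  have 1: "smooth (\<lambda>x. complex_of_real (flat 0 (1 - x)))"
    using smooth_affine[OF smooth_flat[of 0], of "-1" 1] by simp
  have 2: "smooth (\<lambda>x. complex_of_real (flat 0 x) + complex_of_real (flat 0 (1 - x)))"
    by (rule smooth_add[OF smooth_flat 1])
  have "smooth (\<lambda>x. complex_of_real (flat 0 x) * inverse (complex_of_real (flat 0 x) + complex_of_real (flat 0 (1 - x))))"
    by (rule smooth_mult[OF smooth_flat smooth_inverse[OF 2]])
      (metis of_real_add of_real_eq_0_iff step_denom_pos less_irrefl)
  then show ?thesis unfolding step_def by (simp add: divide_inverse)
qed

definition plateau :: "real \<Rightarrow> real \<Rightarrow> real \<Rightarrow> real" where
  "plateau a b x = step (x - a + 1) * step (b + 1 - x)"

lemma plateau_bounds: "0 \<le> plateau a b x" "plateau a b x \<le> 1"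
  using step_bounds by (auto simp: plateau_def mult_le_one)

lemma plateau_1: "a \<le> x \<Longrightarrow> x \<le> b \<Longrightarrow> plateau a b x = 1"
  by (simp add: plateau_def step_1)

lemma plateau_0: "x \<le> a - 1 \<or> x \<ge> b + 1 \<Longrightarrow> plateau a b x = 0"
  by (auto simp: plateau_def step_0)

lemma smooth_plateau: "smooth (\<lambda>x. complex_of_real (plateau a b x))"
proof -
  have "smooth (\<lambda>x. complex_of_real (step (1 * x + (1 - a))) * complex_of_real (step (-1 * x + (b + 1))))"
    by (intro smooth_mult smooth_affine[OF smooth_step])
  then show ?thesis unfolding plateau_def by (simp add: algebra_simps)
qed

lemma test_fun_plateau: "(\<lambda>x. complex_of_real (plateau a b x)) \<in> test_fun"
proof -
  have "plateau a b x = 0" if "\<bar>x\<bar> > \<bar>a\<bar> + \<bar>b\<bar> + 1" for x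
    by (rule plateau_0) (use that in linarith)
  then show ?thesis unfolding test_fun_def using smooth_plateau by auto
qed

section \<open>The Fourier transform on Schwartz functions\<close>

lemma exp_vd:
  fixes h :: "real \<Rightarrow> complex"
  assumes "(h has_vector_derivative h') (at x)"
  shows "((\<lambda>x. exp (h x)) has_vector_derivative h' * exp (h x)) (at x)"
  using field_vector_diff_chain_at[OF assms DERIV_exp] by (simp add: comp_def)

lemma linear_vd: "((\<lambda>x. b * complex_of_real x) has_vector_derivative b) (at x)"
  using has_vector_derivative_mult_right[OF has_vector_derivative_of_real[OF DERIV_ident], of b "at x"] by simp

lemma cis_vd: "((\<lambda>x. cis (a * x)) has_vector_derivative (\<i> * complex_of_real a) * cis (a * x)) (at x)"
  using exp_vd[OF linear_vd[of "\<i> * complex_of_real a" x]] by (simp add: cis_conv_exp mult.assoc)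

lemma slow_cis: "slow (\<lambda>x. cis (a * x))"
proof (rule slow_linear_ode[OF cis_vd slow_const])
  show "Pslow (\<lambda>_. 1) (\<lambda>_ x. cis (a * x))"
    unfolding Pslow_def by (rule exI[of _ 1], rule exI[of _ 0]) auto
qed

lemma integrable_inverse_square: "integrable lborel (\<lambda>x::real. inverse (1 + x\<^sup>2))"
  using integrable_inverse_1_plus_square by (simp add: set_integrable_def)

lemma smooth_measurable: "smooth f \<Longrightarrow> f \<in> borel_measurable borel"
  by (intro borel_measurable_continuous_onI smooth_continuous)

lemma schf_inverse_square_bound:
  assumes "schf c F"
  shows "\<exists>C. \<forall>n x. cmod (F n x) \<le> C * c n * inverse (1 + x\<^sup>2)"
proof -
  obtain C where C: "\<And>n x. cmod (F n x) * (1 + \<bar>x\<bar>) ^ 2 \<le> C * c n"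
    using schf_Prapid[OF assms] unfolding Prapid_def by blast
  have "cmod (F n x) \<le> C * c n * inverse (1 + x\<^sup>2)" for n x
  proof -
    have p: "1 + x\<^sup>2 > 0" by (smt (verit) zero_le_power2)
    have "1 + x\<^sup>2 \<le> (1 + \<bar>x\<bar>) ^ 2" by (simp add: power2_eq_square algebra_simps)
    then have "cmod (F n x) * (1 + x\<^sup>2) \<le> cmod (F n x) * (1 + \<bar>x\<bar>) ^ 2" by (intro mult_left_mono) auto
    also have "\<dots> \<le> C * c n" by (rule C)
    finally show ?thesis using p by (simp add: field_simps)
  qed
  then show ?thesis by blast
qed

lemma schf_integrable: assumes "schf c F" shows "integrable lborel (F n)"
proof -
  obtain C where C: "\<And>n x. cmod (F n x) \<le> C * c n * inverse (1 + x\<^sup>2)"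
    using schf_inverse_square_bound[OF assms] by blast
  show ?thesis
  proof (rule Bochner_Integration.integrable_bound[where f = "\<lambda>x. C * c n * inverse (1 + x\<^sup>2)"])
    show "F n \<in> borel_measurable lborel" using smooth_measurable[OF schf_smooth[OF assms]] by simp
    show "AE x in lborel. norm (F n x) \<le> norm (C * c n * inverse (1 + x\<^sup>2))"
      using order_trans[OF C abs_ge_self, of n] by (intro AE_I2) auto
  qed (use integrable_inverse_square in auto)
qed

lemma schwartz_integrable: "f \<in> schwartz \<Longrightarrow> integrable lborel f"
  unfolding schwartz_iff by (rule schf_integrable)

lemma schf_L1:
  assumes "schf c F" shows "\<exists>C. \<forall>n. (LINT x|lborel. cmod (F n x)) \<le> C * c n"
proof -
  obtain C where C: "\<And>n x. cmod (F n x) \<le> C * c n * inverse (1 + x\<^sup>2)"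
    using schf_inverse_square_bound[OF assms] by blast
  have "(LINT x|lborel. cmod (F n x)) \<le> (LINT x|lborel. C * c n * inverse (1 + x\<^sup>2))" for n
    using C schf_integrable[OF assms] integrable_inverse_square by (intro integral_mono) auto
  then have "(LINT x|lborel. cmod (F n x)) \<le> (C * (LINT x|lborel. inverse (1 + x\<^sup>2))) * c n" for n
    by (simp add: mult_ac)
  then show ?thesis by blast
qed

lemma integrable_cis_mult:
  assumes "integrable lborel f" shows "integrable lborel (\<lambda>x. cis (a * x) * f x)"
proof (rule Bochner_Integration.integrable_bound[OF assms])
  have [measurable]: "f \<in> borel_measurable borel" using assms by auto
  have [measurable]: "(\<lambda>x. cis (a * x)) \<in> borel_measurable borel"
    by (rule smooth_measurable[OF slow_smooth[OF slow_cis]])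
  show "(\<lambda>x. cis (a * x) * f x) \<in> borel_measurable lborel" by measurable
qed (simp add: norm_mult)

lemma fourier_eq: "fourier f \<xi> = (LINT x|lborel. cis (- \<xi> * x) * f x)"
  unfolding fourier_def by (simp add: mult.commute)

lemma fourier_bound: "cmod (fourier f \<xi>) \<le> (LINT x|lborel. cmod (f x))"
proof -
  have "cmod (fourier f \<xi>) \<le> (LINT x|lborel. cmod (cis (- \<xi> * x) * f x))"
    unfolding fourier_eq by (rule integral_norm_bound)
  then show ?thesis by (simp add: norm_mult)
qed

lemma integral_Dfun_eq_0: assumes "\<psi> \<in> schwartz" shows "(LINT x|lborel. Dfun \<psi> x) = 0"
proof -
  have s: "schf (\<lambda>_. 1) (\<lambda>_. \<psi>)" using assms schwartz_iff by simp
  obtain C where C: "\<And>x. cmod (\<psi> x) \<le> C * inverse (1 + x\<^sup>2)"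
    using schf_inverse_square_bound[OF s] by auto
  have top: "(\<psi> \<longlongrightarrow> 0) at_top"
    by (rule Lim_null_comparison[where g = "\<lambda>x. C * inverse (1 + x\<^sup>2)"]) (use C in \<open>auto, real_asymp\<close>)
  have bot: "(\<psi> \<longlongrightarrow> 0) at_bot"
    by (rule Lim_null_comparison[where g = "\<lambda>x. C * inverse (1 + x\<^sup>2)"]) (use C in \<open>auto, real_asymp\<close>)
  have "(LBINT x=-\<infinity>..\<infinity>. Dfun \<psi> x) = 0 - 0"
  proof (rule interval_integral_FTC_integrable)
    show "(\<psi> has_vector_derivative Dfun \<psi> x) (at x)" for x
      by (rule smooth_vd[OF schwartz_smooth[OF assms]])
    show "isCont (Dfun \<psi>) x" for x
      using smooth_continuous[OF smooth_Dfun[OF schwartz_smooth[OF assms]], of UNIV]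
      by (simp add: continuous_on_eq_continuous_at)
    show "set_integrable lborel (einterval (- \<infinity>) \<infinity>) (Dfun \<psi>)"
      using schwartz_integrable[OF schwartz_Dfun[OF assms]] by (simp add: set_integrable_def)
  qed (use top bot in \<open>auto simp: ereal_tendsto_simps\<close>)
  then show ?thesis by (simp add: interval_lebesgue_integral_def set_lebesgue_integral_def)
qed

lemma fourier_Dfun:
  assumes "\<phi> \<in> schwartz" shows "fourier (Dfun \<phi>) \<xi> = \<i> * complex_of_real \<xi> * fourier \<phi> \<xi>"
proof -
  let ?e = "\<lambda>x. cis (- \<xi> * x)"
  have S: "(\<lambda>x. ?e x * \<phi> x) \<in> schwartz" by (rule schwartz_mult[OF slow_cis assms])
  have d: "Dfun (\<lambda>x. ?e x * \<phi> x) = (\<lambda>x. ?e x * Dfun \<phi> x + (- (\<i> * complex_of_real \<xi>)) * (?e x * \<phi> x))"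
    by (rule Dfun_eqI)
      (use has_vector_derivative_mult[OF cis_vd smooth_vd[OF schwartz_smooth[OF assms]], of "-\<xi>"] in \<open>simp add: mult.assoc\<close>)
  have "0 = (LINT x|lborel. ?e x * Dfun \<phi> x + (- (\<i> * complex_of_real \<xi>)) * (?e x * \<phi> x))"
    using integral_Dfun_eq_0[OF S] d by simp
  also have "\<dots> = (LINT x|lborel. ?e x * Dfun \<phi> x) + (LINT x|lborel. (- (\<i> * complex_of_real \<xi>)) * (?e x * \<phi> x))"
    by (intro Bochner_Integration.integral_add integrable_mult_right integrable_cis_mult schwartz_integrable schwartz_Dfun assms)
  also have "\<dots> = fourier (Dfun \<phi>) \<xi> - \<i> * complex_of_real \<xi> * fourier \<phi> \<xi>"
    unfolding fourier_eq by (simp add: mult.assoc)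
  finally show ?thesis by simp
qed

text \<open>A quadratic Taylor estimate replaces dominated convergence: the increment differs from
  its linear part by at most \<open>h^2\<close> times the second absolute moment \<open>K\<close> of
  \<open>\<phi>\<close>.\<close>

lemma fourier_vd:
  assumes S: "\<phi> \<in> schwartz"
  shows "(fourier \<phi> has_vector_derivative fourier (\<lambda>x. (- \<i> * complex_of_real x) * \<phi> x) \<xi>) (at \<xi>)"
proof -
  let ?D = "fourier (\<lambda>x. (- \<i> * complex_of_real x) * \<phi> x) \<xi>"
  define K where "K = (LINT x|lborel. cmod ((complex_of_real x * complex_of_real x) * \<phi> x))"
  have S1: "(\<lambda>x. (- \<i> * complex_of_real x) * \<phi> x) \<in> schwartz"
    by (intro schwartz_mult[OF slow_mult[OF slow_const slow_id] S])
  have S2: "(\<lambda>x. (complex_of_real x * complex_of_real x) * \<phi> x) \<in> schwartz"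
    by (intro schwartz_mult[OF slow_mult[OF slow_id slow_id] S])
  have *: "cmod (fourier \<phi> (\<xi> + h) - fourier \<phi> \<xi> - h *\<^sub>R ?D) \<le> h\<^sup>2 * K" for h
  proof -
    let ?r = "\<lambda>x. cis (- (\<xi> + h) * x) * \<phi> x - cis (- \<xi> * x) * \<phi> x - complex_of_real h * (cis (- \<xi> * x) * ((- \<i> * complex_of_real x) * \<phi> x))"
    have "fourier \<phi> (\<xi> + h) - fourier \<phi> \<xi> - h *\<^sub>R ?D = (LINT x|lborel. ?r x)"
      unfolding fourier_eq
      by (subst Bochner_Integration.integral_diff Bochner_Integration.integral_mult_right_zero, (intro Bochner_Integration.integrable_diff integrable_mult_right integrable_cis_mult schwartz_integrable S S1)+)+
        (simp add: scaleR_conv_of_real)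
    moreover have "cmod (LINT x|lborel. ?r x) \<le> (LINT x|lborel. h\<^sup>2 * cmod ((complex_of_real x * complex_of_real x) * \<phi> x))"
    proof (rule Bochner_Integration.integral_norm_bound_integral)
      show "integrable lborel ?r"
        by (intro Bochner_Integration.integrable_diff integrable_mult_right integrable_cis_mult schwartz_integrable S S1)
      show "integrable lborel (\<lambda>x. h\<^sup>2 * cmod ((complex_of_real x * complex_of_real x) * \<phi> x))"
        using schwartz_integrable[OF S2] by (intro integrable_mult_right integrable_norm)
      fix x
      \<comment> \<open>With the common factor pulled out, what remains is the first-order Taylor
        remainder of \<open>exp (i y)\<close> at \<open>y = - h x\<close>.\<close>
      have "?r x = (cis (- \<xi> * x) * \<phi> x) * (iexp (- h * x) - (\<Sum>k\<le>1. (\<i> * complex_of_real (- h * x)) ^ k / fact k))"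
        by (simp add: cis_conv_exp exp_add[symmetric] algebra_simps)
      then have "cmod (?r x) = cmod (\<phi> x) * cmod (iexp (- h * x) - (\<Sum>k\<le>1. (\<i> * complex_of_real (- h * x)) ^ k / fact k))"
        by (simp add: norm_mult)
      also have "\<dots> \<le> cmod (\<phi> x) * (\<bar>- h * x\<bar> ^ Suc 1 / fact (Suc 1))"
        by (intro mult_left_mono iexp_approx1) auto
      also have "\<dots> \<le> cmod (\<phi> x) * (\<bar>h * x\<bar> ^ 2)"
        by (intro mult_left_mono) (simp_all add: fact_2 power2_eq_square[symmetric] numeral_2_eq_2[symmetric])
      also have "\<dots> = h\<^sup>2 * cmod ((complex_of_real x * complex_of_real x) * \<phi> x)"
        by (simp add: norm_mult power_mult_distrib power2_eq_square mult_ac)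
      finally show "norm (?r x) \<le> h\<^sup>2 * cmod ((complex_of_real x * complex_of_real x) * \<phi> x)" .
    qed
    ultimately show ?thesis unfolding K_def by simp
  qed
  have "((\<lambda>h. norm (fourier \<phi> (\<xi> + h) - fourier \<phi> \<xi> - h *\<^sub>R ?D) / norm h) \<longlongrightarrow> 0) (at 0)"
  proof (rule Lim_null_comparison[where g = "\<lambda>h. \<bar>h\<bar> * K"])
    show "\<forall>\<^sub>F h in at 0. norm (norm (fourier \<phi> (\<xi> + h) - fourier \<phi> \<xi> - h *\<^sub>R ?D) / norm h) \<le> \<bar>h\<bar> * K"
    proof (rule always_eventually, rule allI)
      fix h show "norm (norm (fourier \<phi> (\<xi> + h) - fourier \<phi> \<xi> - h *\<^sub>R ?D) / norm h) \<le> \<bar>h\<bar> * K"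
        using *[of h] by (cases "h = 0") (auto simp: field_simps power2_eq_square abs_mult_self_eq simp flip: abs_mult)
    qed
    show "((\<lambda>h. \<bar>h\<bar> * K) \<longlongrightarrow> 0) (at 0)" by (auto intro!: tendsto_eq_intros)
  qed
  then show ?thesis
    unfolding has_vector_derivative_def has_derivative_at by (auto intro: bounded_linear_scaleR_left)
qed

text \<open>Decay comes from transforming derivatives, which yields one power of
  \<open>|\<xi>|\<close> per round; regularity comes from multiplying by \<open>- i x\<close> before
  transforming. Both operations keep the gauge, so rates of convergence survive the
  transform.\<close>

lemma schf_fourier: assumes "schf c F" shows "schf c (\<lambda>n. fourier (F n))"
proof -
  have R: "Prapid c (\<lambda>n. fourier (F n))" if "schf c F" for F
  proof -
    have "\<exists>C. \<forall>n \<xi>. cmod (fourier (F n) \<xi>) * (1 + \<bar>\<xi>\<bar>) ^ j \<le> C * c n" for j using that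
    proof (induction j arbitrary: F)
      case 0
      then show ?case using schf_L1[OF 0] fourier_bound by (metis mult.right_neutral order_trans power_0)
    next
      case (Suc j)
      obtain C where C: "\<And>n \<xi>. cmod (fourier (F n) \<xi>) * (1 + \<bar>\<xi>\<bar>) ^ j \<le> C * c n"
        using Suc by blast
      obtain D where D: "\<And>n \<xi>. cmod (fourier (Dfun (F n)) \<xi>) * (1 + \<bar>\<xi>\<bar>) ^ j \<le> D * c n"
        using Suc.IH[OF schf_Dfun[OF Suc.prems]] by blast
      have "cmod (fourier (F n) \<xi>) * (1 + \<bar>\<xi>\<bar>) ^ Suc j \<le> (C + D) * c n" for n \<xi>
        using C[of n \<xi>] D[of n \<xi>] fourier_Dfun[OF schf_schwartz[OF Suc.prems], of n \<xi>]
        by (simp add: norm_mult algebra_simps)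
      then show ?case by blast
    qed
    then show ?thesis unfolding Prapid_def by blast
  qed
  have "cls (Prapid c) k (\<lambda>n. fourier (F n))" for k using assms
  proof (induction k arbitrary: F)
    case 0 then show ?case using R by simp
  next
    case (Suc k)
    show ?case
    proof (rule cls_SucI)
      show "(fourier (F n) has_vector_derivative fourier (\<lambda>x. (- \<i> * complex_of_real x) * F n x) \<xi>) (at \<xi>)" for n \<xi>
        by (rule fourier_vd[OF schf_schwartz[OF Suc.prems]])
      show "cls (Prapid c) k (\<lambda>n. fourier (\<lambda>x. (- \<i> * complex_of_real x) * F n x))"
        by (rule Suc.IH[OF schf_mult_slow[OF Suc.prems slow_mult[OF slow_const slow_id]]])
    qed (use R Suc.prems in auto)
  qed
  then show ?thesis unfolding schf_def by blast
qed

lemma schwartz_fourier: "\<phi> \<in> schwartz \<Longrightarrow> fourier \<phi> \<in> schwartz"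
  unfolding schwartz_iff using schf_fourier[of "\<lambda>_. 1" "\<lambda>_. \<phi>"] by simp

lemma fourier_multiplication_formula:
  assumes f: "integrable lborel f" and g: "integrable lborel g"
  shows "(LINT x|lborel. fourier f x * g x) = (LINT x|lborel. f x * fourier g x)"
proof -
  have [measurable]: "f \<in> borel_measurable borel" "g \<in> borel_measurable borel" using f g by auto
  let ?h = "\<lambda>y x. cis (- x * y) * f y * g x"
  have [measurable]: "(\<lambda>p::real\<times>real. cis (- snd p * fst p)) \<in> borel_measurable (borel \<Otimes>\<^sub>M borel)"
    unfolding cis_conv_exp by measurable
  have int: "integrable (lborel \<Otimes>\<^sub>M lborel) (case_prod ?h)"
  proof (rule lborel_pair.Fubini_integrable)
    show "case_prod ?h \<in> borel_measurable (lborel \<Otimes>\<^sub>M lborel)"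
      unfolding case_prod_unfold by measurable
    have "integrable lborel (\<lambda>y. cmod (f y) * (LINT x|lborel. cmod (g x)))"
      using f by (intro integrable_mult_left integrable_norm)
    then show "integrable lborel (\<lambda>y. LINT x|lborel. norm (case (y, x) of (y, x) \<Rightarrow> ?h y x))"
      by (simp add: norm_mult)
    show "AE y in lborel. integrable lborel (\<lambda>x. case (y, x) of (y, x) \<Rightarrow> ?h y x)"
    proof (rule AE_I2)
      fix y
      have "integrable lborel (\<lambda>x. f y * (cis (- y * x) * g x))"
        by (intro integrable_mult_right integrable_cis_mult g)
      then show "integrable lborel (\<lambda>x. case (y, x) of (y, x) \<Rightarrow> ?h y x)"
        by (simp add: mult_ac)
    qed
  qed
  have "(LINT x|lborel. fourier f x * g x) = (LINT x|lborel. (LINT y|lborel. ?h y x))"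
    unfolding fourier_eq by (intro Bochner_Integration.integral_cong refl) (simp flip: integral_mult_left_zero)
  also have "\<dots> = (LINT y|lborel. (LINT x|lborel. ?h y x))"
    by (rule lborel_pair.Fubini_integral[OF int])
  also have "\<dots> = (LINT y|lborel. f y * fourier g y)"
    unfolding fourier_eq
    by (intro Bochner_Integration.integral_cong refl) (simp flip: integral_mult_right_zero add: mult_ac)
  finally show ?thesis .
qed

section \<open>Gaussians and Fourier inversion\<close>

definition gauss :: "real \<Rightarrow> real \<Rightarrow> complex" where
  "gauss a x = complex_of_real (exp (- (a * x)\<^sup>2 / 2))"

lemma gauss_schwartz: assumes "a \<noteq> 0" shows "gauss a \<in> schwartz"
proof (rule schwartz_linear_ode)
  have "((\<lambda>x. exp (- (a * x)\<^sup>2 / 2)) has_real_derivative (- a\<^sup>2 * x) * exp (- (a * x)\<^sup>2 / 2)) (at x)" for x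
    by (auto intro!: derivative_eq_intros simp: power2_eq_square)
  from has_vector_derivative_of_real[OF this]
  show "(gauss a has_vector_derivative (complex_of_real (- a\<^sup>2) * complex_of_real x) * gauss a x) (at x)" for x
    unfolding gauss_def by simp
  show "slow (\<lambda>x. complex_of_real (- a\<^sup>2) * complex_of_real x)"
    by (intro slow_mult slow_const slow_id)
  show "Prapid (\<lambda>_. 1) (\<lambda>_. gauss a)" unfolding Prapid_def
  proof
    fix j
    obtain C where C: "\<And>y. y \<ge> 1 \<Longrightarrow> exp (- \<bar>a\<bar> * y powr 1) * y ^ j \<le> C"
      using exp_neg_powr_bound[of "\<bar>a\<bar>" 1 j] assms by auto
    have "cmod (gauss a x) * (1 + \<bar>x\<bar>) ^ j \<le> exp (1 / 2 + \<bar>a\<bar>) * C" for x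
    proof -
      \<comment> \<open>Completing the square trades the Gaussian for a simple exponential:
        \<open>- (a x)^2 / 2 \<le> 1/2 - |a x|\<close>; the additional \<open>|a|\<close> in the
        constant accounts for \<open>1 + |x|\<close>.\<close>
      have "0 \<le> (\<bar>a * x\<bar> - 1)\<^sup>2" by simp
      then have "- (a * x)\<^sup>2 / 2 \<le> (1 / 2 + \<bar>a\<bar>) + (- \<bar>a\<bar> * (1 + \<bar>x\<bar>))"
        by (simp add: power2_diff abs_mult algebra_simps)
      then have "exp (- (a * x)\<^sup>2 / 2) \<le> exp (1 / 2 + \<bar>a\<bar>) * exp (- \<bar>a\<bar> * (1 + \<bar>x\<bar>))"
        unfolding exp_add[symmetric] by simp
      then have "cmod (gauss a x) * (1 + \<bar>x\<bar>) ^ j \<le> exp (1 / 2 + \<bar>a\<bar>) * exp (- \<bar>a\<bar> * (1 + \<bar>x\<bar>)) * (1 + \<bar>x\<bar>) ^ j"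
        unfolding gauss_def by (intro mult_right_mono) auto
      also have "\<dots> \<le> exp (1 / 2 + \<bar>a\<bar>) * C"
        using C[of "1 + \<bar>x\<bar>"] by (simp add: mult.assoc)
      finally show ?thesis .
    qed
    then show "\<exists>C. \<forall>n x. cmod (gauss a x) * (1 + \<bar>x\<bar>) ^ j \<le> C * 1" by auto
  qed
qed

text \<open>The case \<open>Y = 1\<close> is the characteristic function of the standard normal
  distribution, taken at \<open>- \<xi>\<close> because of the opposite sign convention; the rest is
  scaling.\<close>

lemma fourier_gauss: assumes "Y > 0"
  shows "fourier (gauss (1 / Y)) \<xi> = complex_of_real (Y * sqrt (2 * pi)) * gauss Y \<xi>"
proof -
  have 1: "fourier (gauss 1) \<xi> = complex_of_real (sqrt (2 * pi)) * gauss 1 \<xi>" for \<xi>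
  proof -
    have "complex_of_real (exp (- (\<xi>^2) / 2)) = char std_normal_distribution (- \<xi>)"
      unfolding char_std_normal_distribution by simp
    also have "\<dots> = (LINT x|lborel. std_normal_density x *\<^sub>R iexp (- \<xi> * x))"
      unfolding char_def by (rule integral_density) auto
    also have "\<dots> = (LINT x|lborel. complex_of_real (1 / sqrt (2 * pi)) * (cis (- \<xi> * x) * gauss 1 x))"
      by (intro Bochner_Integration.integral_cong refl)
        (simp add: std_normal_density_def gauss_def scaleR_conv_of_real cis_conv_exp)
    also have "\<dots> = complex_of_real (1 / sqrt (2 * pi)) * fourier (gauss 1) \<xi>"
      unfolding fourier_eq by simp
    finally show ?thesis by (simp add: gauss_def field_simps)
  qed
  have "fourier (gauss (1 / Y)) \<xi> = \<bar>Y\<bar> *\<^sub>R (LINT x|lborel. cis (- \<xi> * (0 + Y * x)) * gauss (1 / Y) (0 + Y * x))"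
    unfolding fourier_eq by (rule lborel_integral_real_affine) (use assms in simp)
  also have "\<dots> = complex_of_real Y * fourier (gauss 1) (Y * \<xi>)"
    unfolding fourier_eq using assms by (simp add: gauss_def scaleR_conv_of_real mult_ac)
  finally show ?thesis by (simp add: 1 gauss_def mult_ac)
qed

lemma integral_gauss: assumes "Y > 0" shows "(LINT x|lborel. gauss (1/Y) x) = complex_of_real (Y * sqrt (2 * pi))"
  using fourier_gauss[OF assms, of 0] by (simp add: fourier_def gauss_def cis_conv_exp)

text \<open>Inversion at 0. The transform is damped by Gaussians whose width tends to infinity; the
  multiplication formula moves the transform onto the Gaussian, and rescaling turns the other side
  into an integral of \<open>f (z / Y n)\<close> against a fixed Gaussian. Dominated convergence
  applies to both sides.\<close>

lemma integral_fourier: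
  assumes S: "f \<in> schwartz" shows "(LINT \<xi>|lborel. fourier f \<xi>) = complex_of_real (2 * pi) * f 0"
proof -
  define Y where "Y n = real (Suc n)" for n
  have Y: "Y n > 0" for n by (simp add: Y_def)
  have Yinf: "filterlim Y at_top sequentially" unfolding Y_def
    by (rule filterlim_compose[OF filterlim_real_sequentially filterlim_Suc])
  have Y0: "(\<lambda>n. x / Y n) \<longlonglongrightarrow> 0" for x
    by (rule real_tendsto_divide_at_top[OF tendsto_const Yinf])
  have [measurable]: "f \<in> borel_measurable borel" "fourier f \<in> borel_measurable borel"
    by (intro smooth_measurable schwartz_smooth schwartz_fourier S)+
  have [measurable]: "gauss a \<in> borel_measurable borel" for a
    unfolding gauss_def by measurable
  have eq: "(LINT \<xi>|lborel. fourier f \<xi> * gauss (1 / Y n) \<xi>) = complex_of_real (sqrt (2 * pi)) * (LINT z|lborel. f (z / Y n) * gauss 1 z)" for n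
  proof -
    have "(LINT \<xi>|lborel. fourier f \<xi> * gauss (1 / Y n) \<xi>) = (LINT x|lborel. f x * (complex_of_real (Y n * sqrt (2 * pi)) * gauss (Y n) x))"
      by (subst fourier_multiplication_formula) (use S Y[of n] in \<open>auto intro!: schwartz_integrable gauss_schwartz simp: fourier_gauss\<close>)
    also have "\<dots> = complex_of_real (Y n * sqrt (2 * pi)) * (LINT x|lborel. f x * gauss (Y n) x)"
      by (subst Bochner_Integration.integral_mult_right_zero[symmetric]) (simp add: mult_ac)
    also have "(LINT x|lborel. f x * gauss (Y n) x) = \<bar>1 / Y n\<bar> *\<^sub>R (LINT x|lborel. f (0 + (1 / Y n) * x) * gauss (Y n) (0 + (1 / Y n) * x))"
      by (rule lborel_integral_real_affine) (use Y[of n] in simp)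
    also have "\<dots> = complex_of_real (1 / Y n) * (LINT z|lborel. f (z / Y n) * gauss 1 z)"
      using Y[of n] by (simp add: gauss_def scaleR_conv_of_real)
    finally show ?thesis using Y[of n] by (simp add: field_simps)
  qed
  have L: "(\<lambda>n. LINT \<xi>|lborel. fourier f \<xi> * gauss (1 / Y n) \<xi>) \<longlonglongrightarrow> (LINT \<xi>|lborel. fourier f \<xi>)"
  proof (rule integral_dominated_convergence[where w = "\<lambda>\<xi>. cmod (fourier f \<xi>)"])
    show "integrable lborel (\<lambda>\<xi>. cmod (fourier f \<xi>))"
      by (intro integrable_norm schwartz_integrable schwartz_fourier S)
    have "(\<lambda>n. fourier f x * complex_of_real (exp (- (x / Y n)\<^sup>2 / 2))) \<longlonglongrightarrow> fourier f x * complex_of_real (exp (- 0\<^sup>2 / 2))" for x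
      by (intro tendsto_intros Y0) auto
    then show "AE x in lborel. (\<lambda>n. fourier f x * gauss (1 / Y n) x) \<longlonglongrightarrow> fourier f x"
      unfolding gauss_def by simp
    show "AE x in lborel. norm (fourier f x * gauss (1 / Y n) x) \<le> cmod (fourier f x)" for n
      unfolding gauss_def by (simp add: norm_mult mult_left_le)
  qed measurable
  obtain C where C: "\<And>x. cmod (f x) \<le> C"
    using schf_Prapid[OF S[unfolded schwartz_iff]] unfolding Prapid_def
    by (metis mult.right_neutral power_0)
  have R: "(\<lambda>n. LINT z|lborel. f (z / Y n) * gauss 1 z) \<longlonglongrightarrow> (LINT z|lborel. f 0 * gauss 1 z)"
  proof (rule integral_dominated_convergence[where w = "\<lambda>z. C * cmod (gauss 1 z)"])
    show "integrable lborel (\<lambda>z. C * cmod (gauss 1 z))"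
      by (intro integrable_mult_right integrable_norm schwartz_integrable gauss_schwartz) simp
    have "isCont f 0" using smooth_continuous[OF schwartz_smooth[OF S], of UNIV] by (simp add: continuous_on_eq_continuous_at)
    then have "(\<lambda>n. f (z / Y n) * gauss 1 z) \<longlonglongrightarrow> f 0 * gauss 1 z" for z
      by (intro tendsto_intros isCont_tendsto_compose[OF _ Y0])
    then show "AE z in lborel. (\<lambda>n. f (z / Y n) * gauss 1 z) \<longlonglongrightarrow> f 0 * gauss 1 z" by simp
    show "AE z in lborel. norm (f (z / Y n) * gauss 1 z) \<le> C * cmod (gauss 1 z)" for n
      using C by (auto simp: norm_mult intro!: mult_right_mono)
  qed measurable
  have "(LINT z|lborel. f 0 * gauss 1 z) = f 0 * complex_of_real (sqrt (2 * pi))"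
    using integral_gauss[of 1] by simp
  then have "(\<lambda>n. LINT \<xi>|lborel. fourier f \<xi> * gauss (1 / Y n) \<xi>) \<longlonglongrightarrow> complex_of_real (sqrt (2 * pi)) * (f 0 * complex_of_real (sqrt (2 * pi)))"
    unfolding eq using R by (intro tendsto_intros) auto
  from LIMSEQ_unique[OF L this] show ?thesis
    by (simp add: mult_ac flip: of_real_mult)
qed

lemma schwartz_isometry:
  assumes "\<phi> \<in> schwartz" and a: "\<bar>a\<bar> = 1" shows "(\<lambda>x. \<phi> (a * x + b)) \<in> schwartz"
proof -
  have R: "Prapid (\<lambda>_. 1) (\<lambda>_ x. f (a * x + b))" if "Prapid (\<lambda>_. 1) (\<lambda>_. f)" for f
    unfolding Prapid_def
  proof
    fix j
    obtain C where C: "\<And>x. cmod (f x) * (1 + \<bar>x\<bar>) ^ j \<le> C"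
      using \<open>Prapid (\<lambda>_. 1) (\<lambda>_. f)\<close> unfolding Prapid_def by (metis mult.right_neutral)
    have "cmod (f (a * x + b)) * (1 + \<bar>x\<bar>) ^ j \<le> (1 + \<bar>b\<bar>) ^ j * C" for x
    proof -
      have "\<bar>x\<bar> = \<bar>a * x\<bar>" using a by (simp add: abs_mult)
      then have "\<bar>x\<bar> \<le> \<bar>a * x + b\<bar> + \<bar>b\<bar>" by linarith
      then have "1 + \<bar>x\<bar> \<le> (1 + \<bar>b\<bar>) * (1 + \<bar>a * x + b\<bar>)" by (simp add: algebra_simps)
        (smt (verit) mult_nonneg_nonneg)
      then have "(1 + \<bar>x\<bar>) ^ j \<le> ((1 + \<bar>b\<bar>) * (1 + \<bar>a * x + b\<bar>)) ^ j" by (intro power_mono) auto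
      then have "cmod (f (a * x + b)) * (1 + \<bar>x\<bar>) ^ j \<le> cmod (f (a * x + b)) * ((1 + \<bar>b\<bar>) * (1 + \<bar>a * x + b\<bar>)) ^ j"
        by (intro mult_left_mono) auto
      also have "\<dots> = (1 + \<bar>b\<bar>) ^ j * (cmod (f (a * x + b)) * (1 + \<bar>a * x + b\<bar>) ^ j)"
        by (simp add: power_mult_distrib mult_ac)
      also have "\<dots> \<le> (1 + \<bar>b\<bar>) ^ j * C" by (intro mult_left_mono C) auto
      finally show ?thesis .
    qed
    then show "\<exists>C. \<forall>n x. cmod (f (a * x + b)) * (1 + \<bar>x\<bar>) ^ j \<le> C * 1" by auto
  qed
  have "cls (Prapid (\<lambda>_. 1)) k (\<lambda>_ x. \<phi> (a * x + b))" for k using assms(1)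
  proof (induction k arbitrary: \<phi>)
    case 0 then show ?case using R schf_Prapid schwartz_iff by simp
  next
    case (Suc k)
    have "(\<lambda>x. complex_of_real a * Dfun \<phi> x) \<in> schwartz"
      by (intro schwartz_cmult schwartz_Dfun Suc.prems)
    then show ?case
      by (intro cls_SucI[OF affine_vd[OF smooth_vd[OF schwartz_smooth[OF Suc.prems]]]])
        (use Suc.IH R schf_Prapid schwartz_iff Suc.prems in auto)
  qed
  then show ?thesis unfolding schwartz_iff schf_def by blast
qed

text \<open>Inversion at \<open>- x\<close> is inversion at 0 for a translate, whose transform only
  acquires a phase.\<close>

lemma fourier_fourier:
  assumes "f \<in> schwartz" shows "fourier (fourier f) x = complex_of_real (2 * pi) * f (- x)"
proof -
  have "(LINT \<xi>|lborel. fourier (\<lambda>y. f (1 * y + (- x))) \<xi>) = complex_of_real (2 * pi) * f (- x)"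
    using integral_fourier[OF schwartz_isometry[OF assms, of 1 "-x"]] by simp
  moreover have "fourier (\<lambda>y. f (1 * y + (- x))) \<xi> = cis (- x * \<xi>) * fourier f \<xi>" for \<xi>
  proof -
    have "fourier (\<lambda>y. f (1 * y + (- x))) \<xi> = \<bar>1\<bar> *\<^sub>R (LINT y|lborel. cis (- \<xi> * (x + 1 * y)) * f (1 * (x + 1 * y) + (- x)))"
      unfolding fourier_eq by (rule lborel_integral_real_affine) simp
    also have "\<dots> = (LINT y|lborel. cis (- x * \<xi>) * (cis (- \<xi> * y) * f y))"
    proof -
      have "cis (- \<xi> * (x + 1 * y)) = cis (- x * \<xi>) * cis (- \<xi> * y)" for y
        unfolding cis_mult by (simp add: algebra_simps)
      then show ?thesis by (simp add: mult.assoc del: Bochner_Integration.integral_mult_right_zero)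
    qed
    finally show ?thesis unfolding fourier_eq by simp
  qed
  ultimately show ?thesis unfolding fourier_eq[of "fourier f"] by simp
qed

text \<open>The argument is written \<open>-1 * x + 0\<close> to match
  \<open>schwartz_isometry\<close>.\<close>

definition ifourier :: "(real \<Rightarrow> complex) \<Rightarrow> real \<Rightarrow> complex" where
  "ifourier \<psi> = (\<lambda>x. complex_of_real (1 / (2 * pi)) * fourier \<psi> (-1 * x + 0))"

lemma schwartz_ifourier: "\<psi> \<in> schwartz \<Longrightarrow> ifourier \<psi> \<in> schwartz"
  unfolding ifourier_def by (intro schwartz_cmult schwartz_isometry schwartz_fourier) auto

lemma fourier_reflect: "fourier (\<lambda>x. f (- x)) \<xi> = fourier f (- \<xi>)"
  unfolding fourier_eq
  by (subst lborel_integral_real_affine[where c = "-1" and t = 0]) auto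

lemma fourier_ifourier:
  assumes "\<psi> \<in> schwartz" shows "fourier (ifourier \<psi>) = \<psi>"
proof
  fix \<xi>
  have "fourier (ifourier \<psi>) \<xi> = complex_of_real (1 / (2 * pi)) * fourier (\<lambda>x. fourier \<psi> (- x)) \<xi>"
    unfolding ifourier_def fourier_eq[of _ \<xi>] by (simp add: mult.left_commute)
  also have "\<dots> = \<psi> \<xi>"
    unfolding fourier_reflect fourier_fourier[OF assms] by simp
  finally show "fourier (ifourier \<psi>) \<xi> = \<psi> \<xi>" .
qed

lemma ifourier_fourier:
  assumes "\<psi> \<in> schwartz" shows "ifourier (fourier \<psi>) = \<psi>"
  unfolding ifourier_def using fourier_fourier[OF assms] by simp

lemma ifourier_bound: "cmod (ifourier f x) \<le> (LINT x|lborel. cmod (f x)) / (2 * pi)"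
  using fourier_bound[of f "-1 * x + 0"] unfolding ifourier_def by (simp add: norm_mult norm_divide divide_right_mono)

section \<open>Density of test functions and the weighted spaces\<close>

text \<open>Each derivative of the dilated function releases another factor
  \<open>1 / (n + 1)\<close>. It is collected in the coefficient \<open>c n\<close>, whose bound
  persists, so the induction ranges over both \<open>b\<close> and \<open>c\<close>.\<close>

lemma cls_Pslow_dilate:
  assumes "b \<in> schwartz" "\<And>n. \<bar>c n\<bar> \<le> 1 / real (Suc n)"
  shows "cls (Pslow (\<lambda>n. 1 / real (Suc n))) k (\<lambda>n x. complex_of_real (c n) * b (1 / real (Suc n) * x + 0))"
  using assms
proof (induction k arbitrary: b c)
  case (0 b c)
  have "Prapid (\<lambda>_. 1) (\<lambda>_. b)" using 0(1) schf_Prapid schwartz_iff by blast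
  then obtain B where B: "\<And>x. cmod (b x) \<le> B"
    unfolding Prapid_def by (metis mult.right_neutral power_0)
  have "cmod (complex_of_real (c n) * b (1 / real (Suc n) * x + 0)) \<le> B * (1 / real (Suc n)) * (1 + \<bar>x\<bar>) ^ 0" for n x
    using mult_mono[OF B[of "1 / real (Suc n) * x + 0"] 0(2)[of n]] order_trans[OF norm_ge_zero B[of 0]]
    by (simp add: norm_mult mult.commute)
  then show ?case unfolding cls.simps Pslow_def by blast
next
  case (Suc k b c)
  have B: "cls (Pslow (\<lambda>n. 1 / real (Suc n))) k (\<lambda>n x. complex_of_real (c n * (1 / real (Suc n))) * Dfun b (1 / real (Suc n) * x + 0))"
  proof (rule Suc.IH)
    show "\<bar>c n * (1 / real (Suc n))\<bar> \<le> 1 / real (Suc n)" for n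
    proof -
      have "\<bar>c n\<bar> \<le> 1" using Suc.prems(2)[of n] by (rule order_trans) simp
      then show ?thesis by (simp add: divide_simps)
    qed
  qed (use Suc.prems schwartz_Dfun in auto)
  show ?case
  proof (rule cls_SucI)
    show "((\<lambda>x. complex_of_real (c n) * b (1 / real (Suc n) * x + 0)) has_vector_derivative
       complex_of_real (c n * (1 / real (Suc n))) * Dfun b (1 / real (Suc n) * x + 0)) (at x)" for n x
      using has_vector_derivative_mult_right[OF affine_vd[OF smooth_vd[OF schwartz_smooth[OF Suc.prems(1)]]], of "complex_of_real (c n)" "1 / real (Suc n)" 0 x]
      by (simp add: mult.assoc)
    show "Pslow (\<lambda>n. 1 / real (Suc n)) (\<lambda>n x. complex_of_real (c n) * b (1 / real (Suc n) * x + 0))"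
      by (rule cls_0[OF Suc.IH[OF Suc.prems]])
  qed (rule B)
qed

text \<open>Dilated cutoffs differ from 1 only where \<open>|x|\<close> exceeds
  \<open>n + 1\<close>, and there one power of \<open>1 + |x|\<close> buys the factor
  \<open>1 / (n + 1)\<close>. The slow class tolerates this power and \<open>\<phi>\<close> absorbs
  it, so the truncations converge with a rate in every seminorm.\<close>

lemma test_fun_dense:
  assumes "\<phi> \<in> schwartz"
  shows "\<exists>F. (\<forall>n. F n \<in> test_fun) \<and> schf (\<lambda>n. 1 / real (Suc n)) (\<lambda>n x. F n x - \<phi> x)"
proof -
  let ?p = "\<lambda>x. complex_of_real (plateau (- 1) 1 x)"
  let ?c = "\<lambda>n. 1 / real (Suc n)"
  have pS: "?p \<in> schwartz" by (rule test_fun_schwartz[OF test_fun_plateau])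
  have P: "Pslow ?c (\<lambda>n x. ?p (?c n * x + 0) - 1)"
  proof -
    have "cmod (?p (?c n * x + 0) - 1) \<le> 1 * ?c n * (1 + \<bar>x\<bar>) ^ 1" for n x
    proof (cases "\<bar>x\<bar> \<le> real (Suc n)")
      case True
      then have "plateau (- 1) 1 (?c n * x + 0) = 1"
        by (intro plateau_1) (auto simp: field_simps)
      then show ?thesis by simp
    next
      case False
      have "cmod (?p (?c n * x + 0) - 1) = \<bar>plateau (- 1) 1 (?c n * x + 0) - 1\<bar>"
        by (metis norm_of_real of_real_1 of_real_diff)
      also have "\<dots> \<le> 1" using plateau_bounds[of "-1" 1 "?c n * x + 0"] by linarith
      also have "\<dots> \<le> 1 * ?c n * (1 + \<bar>x\<bar>) ^ 1" using False by (simp add: field_simps)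
      finally show ?thesis .
    qed
    then show ?thesis unfolding Pslow_def by blast
  qed
  have d: "((\<lambda>x. ?p (?c n * x + 0) - 1) has_vector_derivative complex_of_real (?c n) * Dfun ?p (?c n * x + 0)) (at x)" for n x
    using has_vector_derivative_diff[OF affine_vd[OF smooth_vd[OF schwartz_smooth[OF pS]], of "?c n" 0 x] has_vector_derivative_const[of 1]]
    by simp
  have "cls (Pslow ?c) (Suc k) (\<lambda>n x. ?p (?c n * x + 0) - 1)" for k
    by (rule cls_SucI[OF d cls_Pslow_dilate[OF schwartz_Dfun[OF pS]] P]) simp
  then have "slowf ?c (\<lambda>n x. ?p (?c n * x + 0) - 1)" unfolding slowf_def using cls_le_Suc by blast
  from schf_mult[OF assms[unfolded schwartz_iff] this]
  have "schf ?c (\<lambda>n x. ?p (?c n * x + 0) * \<phi> x - \<phi> x)" by (simp add: algebra_simps)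
  moreover have "(\<lambda>x. ?p (?c n * x + 0) * \<phi> x) \<in> test_fun" for n
  proof -
    have "smooth (\<lambda>x. ?p (?c n * x + 0) * \<phi> x)"
      by (intro smooth_mult smooth_affine[of ?p] smooth_plateau schwartz_smooth assms)
    moreover have "?p (?c n * x + 0) * \<phi> x = 0" if x: "\<bar>x\<bar> > 2 * real (Suc n)" for x
    proof -
      have "plateau (- 1) 1 (?c n * x + 0) = 0"
        by (rule plateau_0) (use x in \<open>auto simp: field_simps abs_if split: if_splits\<close>)
      then show ?thesis by simp
    qed
    ultimately show ?thesis unfolding test_fun_def by blast
  qed
  ultimately show ?thesis by (intro exI[of _ "\<lambda>n x. ?p (?c n * x + 0) * \<phi> x"]) auto
qed

text \<open>Linearity and preservation of rates are what a density argument consumes. The condition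
  passes to compositions with the Fourier transform or with a slow multiplier without computing
  seminorms, and it makes no demand outside \<open>schwartz\<close>.\<close>

definition seqcont :: "distr \<Rightarrow> bool" where
  "seqcont A \<longleftrightarrow> (\<forall>\<phi>\<in>schwartz. \<forall>\<psi>\<in>schwartz. \<forall>a b. A (\<lambda>x. a * \<phi> x + b * \<psi> x) = a * A \<phi> + b * A \<psi>) \<and>
     (\<forall>c F. schf c F \<longrightarrow> (\<exists>C. \<forall>n. cmod (A (F n)) \<le> C * c n))"

lemma seqcont_tempered: "u \<in> tempered \<Longrightarrow> seqcont u"
  unfolding seqcont_def using tempered_bound tempered_lin by blast

lemma fourier_lin:
  assumes "\<phi> \<in> schwartz" "\<psi> \<in> schwartz"
  shows "fourier (\<lambda>x. a * \<phi> x + b * \<psi> x) = (\<lambda>x. a * fourier \<phi> x + b * fourier \<psi> x)"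
proof
  fix \<xi>
  have "fourier (\<lambda>x. a * \<phi> x + b * \<psi> x) \<xi> = (LINT x|lborel. a * (cis (- \<xi> * x) * \<phi> x) + b * (cis (- \<xi> * x) * \<psi> x))"
    unfolding fourier_eq by (simp add: algebra_simps)
  also have "\<dots> = (LINT x|lborel. a * (cis (- \<xi> * x) * \<phi> x)) + (LINT x|lborel. b * (cis (- \<xi> * x) * \<psi> x))"
    by (intro Bochner_Integration.integral_add integrable_mult_right integrable_cis_mult schwartz_integrable assms)
  finally show "fourier (\<lambda>x. a * \<phi> x + b * \<psi> x) \<xi> = a * fourier \<phi> \<xi> + b * fourier \<psi> \<xi>"
    unfolding fourier_eq by simp
qed

lemma seqcont_fourier: assumes "seqcont A" shows "seqcont (\<lambda>\<phi>. A (fourier \<phi>))"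
  unfolding seqcont_def
proof (intro conjI ballI allI impI)
  fix \<phi> \<psi> a b assume "\<phi> \<in> schwartz" "\<psi> \<in> schwartz"
  then show "A (fourier (\<lambda>x. a * \<phi> x + b * \<psi> x)) = a * A (fourier \<phi>) + b * A (fourier \<psi>)"
    using assms unfolding seqcont_def by (simp add: fourier_lin schwartz_fourier)
next
  fix c F assume "schf c F"
  then show "\<exists>C. \<forall>n. cmod (A (fourier (F n))) \<le> C * c n"
    using assms schf_fourier unfolding seqcont_def by blast
qed

lemma seqcont_mult: assumes "seqcont A" "slow g" shows "seqcont (\<lambda>\<phi>. A (\<lambda>x. g x * \<phi> x))"
  unfolding seqcont_def
proof (intro conjI ballI allI impI)
  fix \<phi> \<psi> a b assume S: "\<phi> \<in> schwartz" "\<psi> \<in> schwartz"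
  have "(\<lambda>x. g x * (a * \<phi> x + b * \<psi> x)) = (\<lambda>x. a * (g x * \<phi> x) + b * (g x * \<psi> x))"
    by (simp add: algebra_simps)
  then show "A (\<lambda>x. g x * (a * \<phi> x + b * \<psi> x)) = a * A (\<lambda>x. g x * \<phi> x) + b * A (\<lambda>x. g x * \<psi> x)"
    using assms(1) schwartz_mult[OF assms(2) S(1)] schwartz_mult[OF assms(2) S(2)] unfolding seqcont_def by simp
next
  fix c F assume "schf c F"
  then have "schf c (\<lambda>n x. g x * F n x)" by (rule schf_mult_slow[OF _ assms(2)])
  then show "\<exists>C. \<forall>n. cmod (A (\<lambda>x. g x * F n x)) \<le> C * c n"
    using assms(1) unfolding seqcont_def by blast
qed

text \<open>The difference of the values at \<open>\<phi>\<close> is, up to sign, the difference of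
  the values at \<open>F n - \<phi>\<close>, hence \<open>O(1 / (n + 1))\<close> for every
  \<open>n\<close>.\<close>

lemma seqcont_eqI:
  assumes A: "seqcont A" and B: "seqcont B" and eq: "\<And>\<phi>. \<phi> \<in> test_fun \<Longrightarrow> A \<phi> = B \<phi>"
    and S: "\<phi> \<in> schwartz"
  shows "A \<phi> = B \<phi>"
proof -
  obtain F where F: "\<And>n. F n \<in> test_fun" and s: "schf (\<lambda>n. 1 / real (Suc n)) (\<lambda>n x. F n x - \<phi> x)"
    using test_fun_dense[OF S] by blast
  have lin: "X (\<lambda>x. F n x - \<phi> x) = X (F n) - X \<phi>" if "seqcont X" for X n
  proof -
    have "X (\<lambda>x. 1 * F n x + (-1) * \<phi> x) = 1 * X (F n) + (-1) * X \<phi>"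
      using that S test_fun_schwartz[OF F] unfolding seqcont_def by blast
    then show ?thesis by simp
  qed
  obtain C where C: "\<And>n. cmod (A (\<lambda>x. F n x - \<phi> x)) \<le> C * (1 / real (Suc n))"
    using A s unfolding seqcont_def by blast
  obtain D where D: "\<And>n. cmod (B (\<lambda>x. F n x - \<phi> x)) \<le> D * (1 / real (Suc n))"
    using B s unfolding seqcont_def by blast
  have le: "cmod (A \<phi> - B \<phi>) \<le> (C + D) * (1 / real (Suc n))" for n
  proof -
    have "A \<phi> - B \<phi> = B (\<lambda>x. F n x - \<phi> x) - A (\<lambda>x. F n x - \<phi> x)"
      unfolding lin[OF A] lin[OF B] by (simp add: eq[OF F])
    then have "cmod (A \<phi> - B \<phi>) \<le> cmod (B (\<lambda>x. F n x - \<phi> x)) + cmod (A (\<lambda>x. F n x - \<phi> x))"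
      by (simp only: norm_triangle_ineq4)
    also have "\<dots> \<le> D * (1 / real (Suc n)) + C * (1 / real (Suc n))" by (intro add_mono C D)
    finally show ?thesis by (simp only: distrib_right add.commute)
  qed
  have "(\<lambda>n. (C + D) * (1 / real (Suc n))) \<longlonglongrightarrow> (C + D) * 0"
    using LIMSEQ_inverse_real_of_nat by (intro tendsto_intros) (simp add: inverse_eq_divide)
  then have "cmod (A \<phi> - B \<phi>) \<le> (C + D) * 0" by (rule LIMSEQ_le_const) (use le in blast)
  then show ?thesis by simp
qed

lemma tempered_lincomb:
  assumes "u \<in> tempered" "v \<in> tempered" shows "(\<lambda>\<phi>. a * u \<phi> + b * v \<phi>) \<in> tempered"
proof -
  obtain C N where C: "\<And>\<phi>. \<phi> \<in> schwartz \<Longrightarrow> cmod (u \<phi>) \<le> C * (\<Sum>j\<le>N. \<Sum>k\<le>N. schwartz_seminorm j k \<phi>)"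
    using assms(1) unfolding tempered_def by blast
  obtain D K where D: "\<And>\<phi>. \<phi> \<in> schwartz \<Longrightarrow> cmod (v \<phi>) \<le> D * (\<Sum>j\<le>K. \<Sum>k\<le>K. schwartz_seminorm j k \<phi>)"
    using assms(2) unfolding tempered_def by blast
  have mono: "E * (\<Sum>j\<le>L. \<Sum>k\<le>L. schwartz_seminorm j k \<phi>) \<le> \<bar>E\<bar> * (\<Sum>j\<le>N+K. \<Sum>k\<le>N+K. schwartz_seminorm j k \<phi>)"
    if "\<phi> \<in> schwartz" "L \<le> N + K" for E L \<phi>
  proof -
    have "(\<Sum>j\<le>L. \<Sum>k\<le>L. schwartz_seminorm j k \<phi>) \<le> (\<Sum>j\<le>L. \<Sum>k\<le>N+K. schwartz_seminorm j k \<phi>)"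
      using that by (intro sum_mono sum_mono2) (auto intro: schwartz_seminorm_nonneg)
    also have "\<dots> \<le> (\<Sum>j\<le>N+K. \<Sum>k\<le>N+K. schwartz_seminorm j k \<phi>)"
      using that by (intro sum_mono2) (auto intro!: sum_nonneg schwartz_seminorm_nonneg)
    finally have 1: "(\<Sum>j\<le>L. \<Sum>k\<le>L. schwartz_seminorm j k \<phi>) \<le> (\<Sum>j\<le>N+K. \<Sum>k\<le>N+K. schwartz_seminorm j k \<phi>)" .
    have "0 \<le> (\<Sum>j\<le>L. \<Sum>k\<le>L. schwartz_seminorm j k \<phi>)"
      using that by (intro sum_nonneg schwartz_seminorm_nonneg)
    then have "E * (\<Sum>j\<le>L. \<Sum>k\<le>L. schwartz_seminorm j k \<phi>) \<le> \<bar>E\<bar> * (\<Sum>j\<le>L. \<Sum>k\<le>L. schwartz_seminorm j k \<phi>)"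
      by (intro mult_right_mono) auto
    also have "\<dots> \<le> \<bar>E\<bar> * (\<Sum>j\<le>N+K. \<Sum>k\<le>N+K. schwartz_seminorm j k \<phi>)"
      by (intro mult_left_mono 1) auto
    finally show ?thesis .
  qed
  have "cmod (a * u \<phi> + b * v \<phi>) \<le> (cmod a * \<bar>C\<bar> + cmod b * \<bar>D\<bar>) * (\<Sum>j\<le>N+K. \<Sum>k\<le>N+K. schwartz_seminorm j k \<phi>)"
    if S: "\<phi> \<in> schwartz" for \<phi>
  proof -
    have "cmod (a * u \<phi> + b * v \<phi>) \<le> cmod a * cmod (u \<phi>) + cmod b * cmod (v \<phi>)"
      by (metis norm_triangle_ineq norm_mult)
    also have "\<dots> \<le> cmod a * (\<bar>C\<bar> * (\<Sum>j\<le>N+K. \<Sum>k\<le>N+K. schwartz_seminorm j k \<phi>)) + cmod b * (\<bar>D\<bar> * (\<Sum>j\<le>N+K. \<Sum>k\<le>N+K. schwartz_seminorm j k \<phi>))"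
      by (intro add_mono mult_left_mono order_trans[OF C[OF S] mono[OF S]] order_trans[OF D[OF S] mono[OF S]]) auto
    finally show ?thesis by (simp add: algebra_simps)
  qed
  moreover have "a * u (\<lambda>x. a' * \<phi> x + b' * \<psi> x) + b * v (\<lambda>x. a' * \<phi> x + b' * \<psi> x) =
     a' * (a * u \<phi> + b * v \<phi>) + b' * (a * u \<psi> + b * v \<psi>)" if "\<phi> \<in> schwartz" "\<psi> \<in> schwartz" for \<phi> \<psi> a' b'
    using tempered_lin[OF assms(1) that] tempered_lin[OF assms(2) that] by (simp add: algebra_simps)
  moreover have "a * u \<phi> + b * v \<phi> = 0" if "\<phi> \<notin> schwartz" for \<phi>
    using assms that by (simp add: tempered_outside)
  ultimately show ?thesis unfolding tempered_def by blast
qed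

lemma schwartz_le_seminorm:
  assumes "\<phi> \<in> schwartz" shows "cmod (\<phi> x) \<le> schwartz_seminorm 0 0 \<phi>"
proof -
  have "bounded (range (\<lambda>x. complex_of_real (x ^ 0) * (Dfun ^^ 0) \<phi> x))"
    using assms unfolding schwartz_def by blast
  then have "bdd_above (range (\<lambda>x. cmod (complex_of_real (x ^ 0) * (Dfun ^^ 0) \<phi> x)))"
    unfolding bounded_iff bdd_above_def by auto
  from cSUP_upper[OF UNIV_I this, of x] show ?thesis unfolding schwartz_seminorm_def by simp
qed

lemma schwartz_measurable: "\<phi> \<in> schwartz \<Longrightarrow> \<phi> \<in> borel_measurable borel"
  by (intro smooth_measurable schwartz_smooth)

lemma integrable_mult_schwartz:
  assumes h: "integrable lborel h" and S: "\<phi> \<in> schwartz" shows "integrable lborel (\<lambda>x. h x * \<phi> x)"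
proof (rule Bochner_Integration.integrable_bound)
  show "integrable lborel (\<lambda>x. schwartz_seminorm 0 0 \<phi> * cmod (h x))"
    using h by (intro integrable_mult_right integrable_norm)
  have [measurable]: "h \<in> borel_measurable borel" "\<phi> \<in> borel_measurable borel"
    using h schwartz_measurable[OF S] by auto
  show "(\<lambda>x. h x * \<phi> x) \<in> borel_measurable lborel" by measurable
  show "AE x in lborel. norm (h x * \<phi> x) \<le> norm (schwartz_seminorm 0 0 \<phi> * cmod (h x))"
    using schwartz_le_seminorm[OF S] schwartz_seminorm_nonneg[OF S]
    by (intro AE_I2) (simp add: norm_mult, subst mult.commute, simp add: mult_right_mono)
qed

lemma distr_of_tempered:
  assumes h: "integrable lborel h" shows "distr_of h \<in> tempered"
proof -
  have "distr_of h (\<lambda>x. a * \<phi> x + b * \<psi> x) = a * distr_of h \<phi> + b * distr_of h \<psi>"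
    if S: "\<phi> \<in> schwartz" "\<psi> \<in> schwartz" for \<phi> \<psi> a b
  proof -
    have "(\<lambda>x. a * \<phi> x + b * \<psi> x) \<in> schwartz" by (intro schwartz_add schwartz_cmult S)
    then have "distr_of h (\<lambda>x. a * \<phi> x + b * \<psi> x) = (LINT x|lborel. a * (h x * \<phi> x) + b * (h x * \<psi> x))"
      unfolding distr_of_def by (simp add: algebra_simps)
    also have "\<dots> = (LINT x|lborel. a * (h x * \<phi> x)) + (LINT x|lborel. b * (h x * \<psi> x))"
      by (intro Bochner_Integration.integral_add integrable_mult_right integrable_mult_schwartz h S)
    finally show ?thesis using S unfolding distr_of_def by simp
  qed
  moreover have "cmod (distr_of h \<phi>) \<le> (LINT x|lborel. cmod (h x)) * (\<Sum>j\<le>0. \<Sum>k\<le>0. schwartz_seminorm j k \<phi>)"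
    if S: "\<phi> \<in> schwartz" for \<phi>
  proof -
    have "cmod (LINT x|lborel. h x * \<phi> x) \<le> (LINT x|lborel. cmod (h x) * schwartz_seminorm 0 0 \<phi>)"
    proof (rule Bochner_Integration.integral_norm_bound_integral)
      show "norm (h x * \<phi> x) \<le> cmod (h x) * schwartz_seminorm 0 0 \<phi>" for x
        using schwartz_le_seminorm[OF S] by (simp add: norm_mult mult_left_mono)
    qed (use h S in \<open>auto intro: integrable_mult_schwartz\<close>)
    then show ?thesis using S unfolding distr_of_def by simp
  qed
  moreover have "distr_of h \<phi> = 0" if "\<phi> \<notin> schwartz" for \<phi>
    using that unfolding distr_of_def by simp
  ultimately show ?thesis unfolding tempered_def by blast
qed

section \<open>Square-integrable functions\<close>

lemma L2_integrable_sq: "h \<in> L2 \<Longrightarrow> integrable lborel (\<lambda>x. (cmod (h x))\<^sup>2)"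
  unfolding L2_def by blast

lemma L2_measurable: "h \<in> L2 \<Longrightarrow> h \<in> borel_measurable borel"
  unfolding L2_def by simp

lemma mult_le_sum_squares: "a * b \<le> a\<^sup>2 + b\<^sup>2" for a b :: real
  using sum_squares_bound[of a b] zero_le_power2[of a] zero_le_power2[of b] by linarith

lemma L2_mult_integrable:
  assumes "h \<in> L2" "k \<in> L2" shows "integrable lborel (\<lambda>x. h x * k x)"
proof (rule Bochner_Integration.integrable_bound)
  show "integrable lborel (\<lambda>x. (cmod (h x))\<^sup>2 + (cmod (k x))\<^sup>2)"
    by (intro Bochner_Integration.integrable_add L2_integrable_sq assms)
  have [measurable]: "h \<in> borel_measurable borel" "k \<in> borel_measurable borel" using assms L2_measurable by auto
  show "(\<lambda>x. h x * k x) \<in> borel_measurable lborel" by measurable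
  show "AE x in lborel. norm (h x * k x) \<le> norm ((cmod (h x))\<^sup>2 + (cmod (k x))\<^sup>2)"
    using mult_le_sum_squares by (intro AE_I2) (simp add: norm_mult)
qed

lemma schwartz_L2: assumes "\<phi> \<in> schwartz" shows "\<phi> \<in> L2"
proof -
  have "integrable lborel (\<lambda>x. norm (\<phi> x * \<phi> x))"
    by (intro integrable_norm integrable_mult_schwartz schwartz_integrable assms)
  then show ?thesis unfolding L2_def using schwartz_measurable[OF assms]
    by (simp add: norm_mult power2_eq_square)
qed

lemma L2_lincomb:
  assumes "h \<in> L2" "k \<in> L2" shows "(\<lambda>x. a * h x + b * k x) \<in> L2"
proof -
  have [measurable]: "h \<in> borel_measurable borel" "k \<in> borel_measurable borel" using assms L2_measurable by auto
  have "integrable lborel (\<lambda>x. (cmod (a * h x + b * k x))\<^sup>2)"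
  proof (rule Bochner_Integration.integrable_bound)
    show "integrable lborel (\<lambda>x. 2 * (cmod a)\<^sup>2 * (cmod (h x))\<^sup>2 + 2 * (cmod b)\<^sup>2 * (cmod (k x))\<^sup>2)"
      by (intro Bochner_Integration.integrable_add integrable_mult_right L2_integrable_sq assms)
    have "(cmod (a * h x + b * k x))\<^sup>2 \<le> 2 * (cmod a)\<^sup>2 * (cmod (h x))\<^sup>2 + 2 * (cmod b)\<^sup>2 * (cmod (k x))\<^sup>2" for x
    proof -
      have "(cmod (a * h x + b * k x))\<^sup>2 \<le> (cmod (a * h x) + cmod (b * k x))\<^sup>2"
        by (intro power_mono norm_triangle_ineq) auto
      also have "\<dots> \<le> 2 * (cmod (a * h x))\<^sup>2 + 2 * (cmod (b * k x))\<^sup>2"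
        using sum_squares_bound[of "cmod (a * h x)" "cmod (b * k x)"] by (simp add: power2_sum)
      finally show ?thesis by (simp add: norm_mult power_mult_distrib)
    qed
    then show "AE x in lborel. norm ((cmod (a * h x + b * k x))\<^sup>2) \<le> norm (2 * (cmod a)\<^sup>2 * (cmod (h x))\<^sup>2 + 2 * (cmod b)\<^sup>2 * (cmod (k x))\<^sup>2)"
      by (intro AE_I2) auto
    show "(\<lambda>x. (cmod (a * h x + b * k x))\<^sup>2) \<in> borel_measurable lborel" by measurable
  qed
  then show ?thesis unfolding L2_def by simp
qed

text \<open>Only an approximate form of the Cauchy--Schwarz inequality, which avoids the degenerate case
  \<open>D = 0\<close> in the choice of the minimiser \<open>B / D\<close>.\<close>

lemma L2_cauchy_schwarz:
  assumes "h \<in> L2" "k \<in> L2"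
  shows "(LINT x|lborel. cmod (h x * k x)) \<le> L2_norm h * sqrt ((LINT x|lborel. (cmod (k x))\<^sup>2) + 1)"
proof -
  let ?A = "LINT x|lborel. (cmod (h x))\<^sup>2" and ?B = "LINT x|lborel. cmod (h x * k x)" and ?D = "LINT x|lborel. (cmod (k x))\<^sup>2"
  define t where "t = ?B / (?D + 1)"
  have D: "?D \<ge> 0" by (intro integral_nonneg_AE) auto
  have iA: "integrable lborel (\<lambda>x. (cmod (h x))\<^sup>2)" "integrable lborel (\<lambda>x. (cmod (k x))\<^sup>2)"
    "integrable lborel (\<lambda>x. cmod (h x * k x))"
    using assms by (auto intro!: L2_integrable_sq integrable_norm[OF L2_mult_integrable])
  have "0 \<le> (LINT x|lborel. (cmod (h x) - t * cmod (k x))\<^sup>2)" by (intro integral_nonneg_AE) auto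
  also have "\<dots> = (LINT x|lborel. ((cmod (h x))\<^sup>2 - (2 * t) * cmod (h x * k x)) + t\<^sup>2 * (cmod (k x))\<^sup>2)"
    by (simp add: power2_diff power_mult_distrib norm_mult algebra_simps)
  also have "\<dots> = ?A - 2 * t * ?B + t\<^sup>2 * ?D"
    using iA by simp
  also have "\<dots> = ?A - ?B\<^sup>2 / (?D + 1) - ?B\<^sup>2 / (?D + 1)\<^sup>2"
  proof -
    have "A - 2 * (B / E) * B + (B / E)\<^sup>2 * (E - 1) = A - B\<^sup>2 / E - B\<^sup>2 / E\<^sup>2" if "E > 0" for A B E :: real
      using that by (simp add: field_simps power2_eq_square)
    from this[of "?D + 1" ?A ?B] show ?thesis using D unfolding t_def by simp
  qed
  finally have "?B\<^sup>2 / (?D + 1) + ?B\<^sup>2 / (?D + 1)\<^sup>2 \<le> ?A" by simp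
  moreover have "0 \<le> ?B\<^sup>2 / (?D + 1)\<^sup>2" by simp
  ultimately have "?B\<^sup>2 / (?D + 1) \<le> ?A" by linarith
  then have "?B\<^sup>2 \<le> ?A * (?D + 1)" using D by (simp add: field_simps)
  then have "?B \<le> sqrt (?A * (?D + 1))" by (rule real_le_rsqrt)
  then show ?thesis by (simp add: real_sqrt_mult L2_norm_def)
qed

lemma L2_set_integrable: assumes "h \<in> L2" shows "set_integrable lborel {a..b::real} h"
  unfolding set_integrable_def
proof (rule Bochner_Integration.integrable_bound)
  have "integrable lborel (indicator {a..b} :: real \<Rightarrow> real)"
    by (rule integrable_real_indicator) (auto simp: emeasure_lborel_Icc_eq)
  then show "integrable lborel (\<lambda>x. indicator {a..b} x + (cmod (h x))\<^sup>2)"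
    by (intro Bochner_Integration.integrable_add L2_integrable_sq assms)
  have [measurable]: "h \<in> borel_measurable borel" using assms L2_measurable by auto
  show "(\<lambda>x. indicator {a..b} x *\<^sub>R h x) \<in> borel_measurable lborel" by measurable
  have "cmod (h x) \<le> 1 + (cmod (h x))\<^sup>2" for x using mult_le_sum_squares[of 1 "cmod (h x)"] by simp
  then show "AE x in lborel. norm (indicator {a..b} x *\<^sub>R h x) \<le> norm (indicator {a..b} x + (cmod (h x))\<^sup>2 :: real)"
    by (intro AE_I2) (auto simp: indicator_def)
qed

text \<open>Fundamental lemma of the calculus of variations: smooth approximations of indicators
  show that all integrals over intervals vanish, and Lebesgue differentiation recovers the function
  from them almost everywhere.\<close>

lemma L2_AE_eq_0:
  assumes d: "d \<in> L2" and z: "\<And>\<phi>. \<phi> \<in> test_fun \<Longrightarrow> (LINT x|lborel. d x * \<phi> x) = 0"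
  shows "AE x in lborel. d x = 0"
proof -
  have [measurable]: "d \<in> borel_measurable borel" using d L2_measurable by auto
  have I0: "integral {a..b} d = 0" if "a \<le> b" for a b :: real
  proof -
    \<comment> \<open>Equal to 1 on the interval and 0 beyond distance \<open>1 / (n + 1)\<close>
      from it, hence convergent to the indicator; \<open>a - 1\<close> and \<open>b + 1\<close>
      enclose all supports and give the dominating function.\<close>
    define \<tau> where "\<tau> n x = complex_of_real (step (real (Suc n) * x + (1 - real (Suc n) * a))) * complex_of_real (step (- real (Suc n) * x + (1 + real (Suc n) * b)))" for n x
    have ind: "\<tau> n x = 1" if "x \<in> {a..b}" for n x
    proof -
      have "real (Suc n) * a \<le> real (Suc n) * x" "real (Suc n) * x \<le> real (Suc n) * b"
        using that by (auto intro!: mult_left_mono)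
      then have "1 \<le> real (Suc n) * x + (1 - real (Suc n) * a)" "1 \<le> - real (Suc n) * x + (1 + real (Suc n) * b)"
        unfolding mult_minus_left by linarith+
      then show ?thesis unfolding \<tau>_def by (simp only: step_1 of_real_1 mult_1)
    qed
    have out: "\<tau> n x = 0" if "x < a - 1 / real (Suc n) \<or> x > b + 1 / real (Suc n)" for n x
    proof -
      have "real (Suc n) * x + (1 - real (Suc n) * a) \<le> 0 \<or> - real (Suc n) * x + (1 + real (Suc n) * b) \<le> 0"
        using that by (auto simp: field_simps)
      then show ?thesis unfolding \<tau>_def using step_0 by auto
    qed
    have out1: "\<tau> n x = 0" if "x \<notin> {a-1..b+1}" for n x
    proof (rule out)
      have "1 / real (Suc n) \<le> 1" by simp
      then show "x < a - 1 / real (Suc n) \<or> x > b + 1 / real (Suc n)"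
        using that unfolding atLeastAtMost_iff by linarith
    qed
    have le1: "cmod (\<tau> n x) \<le> 1" for n x
      unfolding \<tau>_def norm_mult norm_of_real using step_bounds by (intro mult_le_one) auto
    have sm: "smooth (\<tau> n)" for n unfolding \<tau>_def by (intro smooth_mult smooth_affine[OF smooth_step])
    have [measurable]: "\<tau> n \<in> borel_measurable borel" for n by (rule smooth_measurable[OF sm])
    have "\<tau> n x = 0" if "\<bar>x\<bar> > \<bar>a\<bar> + \<bar>b\<bar> + 1" for n x
      by (rule out1) (use that in auto)
    then have tf: "\<tau> n \<in> test_fun" for n using sm unfolding test_fun_def by blast
    have "(\<lambda>n. LINT x|lborel. d x * \<tau> n x) \<longlonglongrightarrow> (LINT x|lborel. indicator {a..b} x *\<^sub>R d x)"
    proof (rule integral_dominated_convergence[where w = "\<lambda>x. norm (indicator {a-1..b+1} x *\<^sub>R d x)"])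
      show "integrable lborel (\<lambda>x. norm (indicator {a-1..b+1} x *\<^sub>R d x))"
        using L2_set_integrable[OF d, of "a-1" "b+1"] unfolding set_integrable_def by (rule integrable_norm)
      show "AE x in lborel. norm (d x * \<tau> n x) \<le> norm (indicator {a-1..b+1} x *\<^sub>R d x)" for n
      proof (rule AE_I2)
        fix x show "norm (d x * \<tau> n x) \<le> norm (indicator {a-1..b+1} x *\<^sub>R d x)"
          using le1[of n x] out1[of x n] by (cases "x \<in> {a-1..b+1}") (auto simp: norm_mult mult_left_le)
      qed
      show "AE x in lborel. (\<lambda>n. d x * \<tau> n x) \<longlonglongrightarrow> indicator {a..b} x *\<^sub>R d x"
      proof (rule AE_I2)
        fix x
        have L: "(\<lambda>n. 1 / real (Suc n)) \<longlonglongrightarrow> 0" using LIMSEQ_inverse_real_of_nat by (simp add: inverse_eq_divide)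
        show "(\<lambda>n. d x * \<tau> n x) \<longlonglongrightarrow> indicator {a..b} x *\<^sub>R d x"
        proof (cases "x \<in> {a..b}")
          case True then show ?thesis using ind by simp
        next
          case False
          then consider "x < a" | "x > b" by fastforce
          then have "eventually (\<lambda>n. \<tau> n x = 0) sequentially"
          proof cases
            case 1
            then have "eventually (\<lambda>n. 1 / real (Suc n) < a - x) sequentially"
              by (intro order_tendstoD(2)[OF L]) auto
            then show ?thesis by (rule eventually_mono) (auto intro!: out)
          next
            case 2
            then have "eventually (\<lambda>n. 1 / real (Suc n) < x - b) sequentially"
              by (intro order_tendstoD(2)[OF L]) auto
            then show ?thesis by (rule eventually_mono) (auto intro!: out)
          qed
          then have "eventually (\<lambda>n. d x * \<tau> n x = 0) sequentially" by (rule eventually_mono) auto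
          then show ?thesis using False by (simp add: tendsto_eventually)
        qed
      qed
    qed measurable
    then have "(\<lambda>n. 0) \<longlonglongrightarrow> (LINT x|lborel. indicator {a..b} x *\<^sub>R d x)" using z[OF tf] by simp
    then have "(LINT x:{a..b}|lborel. d x) = 0"
      unfolding set_lebesgue_integral_def by (simp add: LIMSEQ_const_iff)
    then show ?thesis using set_borel_integral_eq_integral(2)[OF L2_set_integrable[OF d, of a b]] by simp
  qed
  have "d integrable_on cbox a b" for a b
    using set_borel_integral_eq_integral(1)[OF L2_set_integrable[OF d, of a b]] by simp
  then obtain N where N: "negligible N" and
    e: "\<And>x e. x \<notin> N \<Longrightarrow> 0 < e \<Longrightarrow> \<exists>\<delta>>0. \<forall>h. 0 < h \<and> h < \<delta> \<longrightarrow> norm (integral (cbox x (x + h *\<^sub>R One)) d /\<^sub>R h ^ DIM(real) - d x) < e"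
    using integrable_ccontinuous_explicit[of d] by blast
  have zero: "d x = 0" if xN: "x \<notin> N" for x
  proof (rule ccontr)
    assume "d x \<noteq> 0"
    then obtain \<delta> where \<delta>: "\<delta> > 0" "\<And>h. 0 < h \<Longrightarrow> h < \<delta> \<Longrightarrow> norm (integral (cbox x (x + h *\<^sub>R One)) d /\<^sub>R h ^ DIM(real) - d x) < norm (d x)"
      using e[OF xN, of "norm (d x)"] by auto
    have "integral (cbox x (x + (\<delta>/2) *\<^sub>R One)) d = 0" using I0[of x "x + \<delta>/2"] \<delta> by simp
    then show False using \<delta>(2)[of "\<delta>/2"] \<delta>(1) by simp
  qed
  \<comment> \<open>Negligible sets are null for the completed measure; the statement is carried
    back to \<open>lborel\<close> afterwards.\<close>
  have "AE x in lebesgue. d x = 0"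
    using N zero unfolding negligible_iff_null_sets by (intro AE_I'[of N]) auto
  then show ?thesis by (simp add: AE_completion_iff)
qed

section \<open>Representation and uniqueness in the weighted spaces\<close>

lemma slow_exp_weight_neg: "r > 0 \<Longrightarrow> p > 0 \<Longrightarrow> slow (exp_weight (- r) p)"
  by (intro schwartz_imp_slow exp_weight_neg_schwartz)

lemma exp_weight_cancel: "(\<lambda>x. exp_weight r p x * (exp_weight (- r) p x * \<phi> x)) = \<phi>"
  using exp_weight_inverse by (simp add: mult.assoc[symmetric])

text \<open>The multiplier relation is known on test functions only. Applied to the reciprocal
  weight times a test function it cancels the weight, and since the reciprocal weight is slow, both
  sides are \<open>seqcont\<close> and the identity extends.\<close>

lemma fourier_multiplier_repr:
  assumes pos: "r > 0" "p > 0" and m: "is_fourier_multiplier (exp_weight r p) u w" and u: "u \<in> tempered" and S: "\<phi> \<in> schwartz"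
  shows "u (fourier \<phi>) = w (fourier (\<lambda>x. exp_weight (- r) p x * \<phi> x))"
proof (rule seqcont_eqI[OF _ _ _ S, of "\<lambda>\<phi>. u (fourier \<phi>)" "\<lambda>\<phi>. w (fourier (\<lambda>x. exp_weight (- r) p x * \<phi> x))"])
  have w: "w \<in> tempered" using m unfolding is_fourier_multiplier_def by blast
  show "seqcont (\<lambda>\<phi>. u (fourier \<phi>))" by (rule seqcont_fourier[OF seqcont_tempered[OF u]])
  show "seqcont (\<lambda>\<phi>. w (fourier (\<lambda>x. exp_weight (- r) p x * \<phi> x)))"
    by (rule seqcont_mult[OF seqcont_fourier[OF seqcont_tempered[OF w]] slow_exp_weight_neg[OF pos]])
  fix \<psi> assume t: "\<psi> \<in> test_fun"
  have t1: "(\<lambda>x. exp_weight (- r) p x * \<psi> x) \<in> test_fun"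
    by (rule test_fun_mult[OF smooth_exp_weight t])
  then have "distr_fourier w (\<lambda>x. exp_weight (- r) p x * \<psi> x) = distr_fourier u \<psi>"
    using m exp_weight_cancel[of r p \<psi>] unfolding is_fourier_multiplier_def is_product_def by metis
  then show "u (fourier \<psi>) = w (fourier (\<lambda>x. exp_weight (- r) p x * \<psi> x))"
    using test_fun_schwartz[OF t] test_fun_schwartz[OF t1] unfolding distr_fourier_def by simp
qed

lemma product_repr:
  assumes pos: "r > 0" "p > 0" and m: "is_product (exp_weight r p) w (distr_of h)" and w: "w \<in> tempered" and S: "\<phi> \<in> schwartz"
  shows "w \<phi> = (LINT x|lborel. h x * (exp_weight (- r) p x * \<phi> x))"
proof -
  have h: "distr_of h \<in> tempered" using m unfolding is_product_def by blast
  have "w \<phi> = distr_of h (\<lambda>x. exp_weight (- r) p x * \<phi> x)"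
  proof (rule seqcont_eqI[OF _ _ _ S, of w "\<lambda>\<phi>. distr_of h (\<lambda>x. exp_weight (- r) p x * \<phi> x)"])
    show "seqcont w" by (rule seqcont_tempered[OF w])
    show "seqcont (\<lambda>\<phi>. distr_of h (\<lambda>x. exp_weight (- r) p x * \<phi> x))"
      by (rule seqcont_mult[OF seqcont_tempered[OF h] slow_exp_weight_neg[OF pos]])
    fix \<psi> assume t: "\<psi> \<in> test_fun"
    have "(\<lambda>x. exp_weight (- r) p x * \<psi> x) \<in> test_fun"
      by (rule test_fun_mult[OF smooth_exp_weight t])
    then show "w \<psi> = distr_of h (\<lambda>x. exp_weight (- r) p x * \<psi> x)"
      using m exp_weight_cancel[of r p \<psi>] unfolding is_product_def by metis
  qed
  then show ?thesis using schwartz_mult[OF slow_exp_weight_neg[OF pos] S] unfolding distr_of_def by simp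
qed

text \<open>The candidates agree on transforms of test functions, hence by density on transforms of
  Schwartz functions, and these are all Schwartz functions. Elsewhere both are 0 by
  normalisation.\<close>

lemma fourier_multiplier_unique:
  assumes w: "is_fourier_multiplier (exp_weight r p) u w" "is_fourier_multiplier (exp_weight r p) u w'"
  shows "w = w'"
proof
  have t: "w \<in> tempered" "w' \<in> tempered" using w unfolding is_fourier_multiplier_def by auto
  fix \<psi>
  show "w \<psi> = w' \<psi>"
  proof (cases "\<psi> \<in> schwartz")
    case True
    have "w (fourier (ifourier \<psi>)) = w' (fourier (ifourier \<psi>))"
    proof (rule seqcont_eqI[OF _ _ _ schwartz_ifourier[OF True], of "\<lambda>\<phi>. w (fourier \<phi>)" "\<lambda>\<phi>. w' (fourier \<phi>)"])
      fix \<phi> assume f: "\<phi> \<in> test_fun"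
      then have "distr_fourier w \<phi> = distr_fourier w' \<phi>"
        using w unfolding is_fourier_multiplier_def is_product_def by simp
      then show "w (fourier \<phi>) = w' (fourier \<phi>)"
        using test_fun_schwartz[OF f] unfolding distr_fourier_def by simp
    qed (use t in \<open>auto intro: seqcont_fourier seqcont_tempered\<close>)
    then show ?thesis by (simp add: fourier_ifourier[OF True])
  next
    case False then show ?thesis using t by (simp add: tempered_outside)
  qed
qed

text \<open>Removes the arbitrary choice in \<open>H_norm\<close>: the intermediate distribution
  \<open>w\<close> is unique, and the representing function is unique almost everywhere.\<close>

lemma H_rep_unique:
  assumes h: "H_rep \<theta> s r1 r2 u h" "H_rep \<theta> s r1 r2 u h'"
  shows "L2_norm h = L2_norm h'"
proof -
  have L: "h \<in> L2" "h' \<in> L2" using h unfolding H_rep_def by auto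
  obtain w where w: "is_fourier_multiplier (exp_weight r1 \<theta>) u w" "is_product (exp_weight r2 s) w (distr_of h)"
    using h(1) unfolding H_rep_def by blast
  have w': "is_product (exp_weight r2 s) w (distr_of h')"
    using h(2) fourier_multiplier_unique[OF w(1)] unfolding H_rep_def by blast
  have "AE x in lborel. (1 * h x + (-1) * h' x) = 0"
  proof (rule L2_AE_eq_0[OF L2_lincomb[OF L]])
    fix \<phi> assume t: "\<phi> \<in> test_fun"
    then have S: "\<phi> \<in> schwartz" by (rule test_fun_schwartz)
    have "distr_of h \<phi> = distr_of h' \<phi>" using w(2) w' t unfolding is_product_def by simp
    then have "(LINT x|lborel. h x * \<phi> x) = (LINT x|lborel. h' x * \<phi> x)"
      using S unfolding distr_of_def by simp
    then show "(LINT x|lborel. (1 * h x + (-1) * h' x) * \<phi> x) = 0"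
      using L2_mult_integrable[OF L(1) schwartz_L2[OF S]] L2_mult_integrable[OF L(2) schwartz_L2[OF S]]
      by (simp add: left_diff_distrib)
  qed
  then have "(LINT x|lborel. (cmod (h x))\<^sup>2) = (LINT x|lborel. (cmod (h' x))\<^sup>2)"
    using L2_measurable[OF L(1)] L2_measurable[OF L(2)]
    by (intro integral_cong_AE) auto
  then show ?thesis unfolding L2_norm_def by simp
qed

lemma H_norm_eq: "H_rep \<theta> s r1 r2 u h \<Longrightarrow> H_norm \<theta> s r1 r2 u = L2_norm h"
  unfolding H_norm_def by (rule H_rep_unique[OF someI[where P = "H_rep \<theta> s r1 r2 u"]])

lemma distr_of_lin:
  assumes "h \<in> L2" "k \<in> L2"
  shows "distr_of (\<lambda>x. a * h x + b * k x) = (\<lambda>\<phi>. a * distr_of h \<phi> + b * distr_of k \<phi>)"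
proof
  fix \<phi>
  show "distr_of (\<lambda>x. a * h x + b * k x) \<phi> = a * distr_of h \<phi> + b * distr_of k \<phi>"
  proof (cases "\<phi> \<in> schwartz")
    case True
    have "(LINT x|lborel. (a * h x + b * k x) * \<phi> x) = (LINT x|lborel. a * (h x * \<phi> x) + b * (k x * \<phi> x))"
      by (simp add: algebra_simps)
    also have "\<dots> = (LINT x|lborel. a * (h x * \<phi> x)) + (LINT x|lborel. b * (k x * \<phi> x))"
      by (intro Bochner_Integration.integral_add integrable_mult_right L2_mult_integrable schwartz_L2 assms True)
    finally show ?thesis using True unfolding distr_of_def by simp
  qed (simp add: distr_of_def)
qed

lemma H_rep_lincomb:
  assumes "H_rep \<theta> s r1 r2 u h" "H_rep \<theta> s r1 r2 v k"
  shows "H_rep \<theta> s r1 r2 (\<lambda>\<phi>. a * u \<phi> + b * v \<phi>) (\<lambda>x. a * h x + b * k x)"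
proof -
  have L: "h \<in> L2" "k \<in> L2" using assms unfolding H_rep_def by auto
  obtain w where w: "is_fourier_multiplier (exp_weight r1 \<theta>) u w" "is_product (exp_weight r2 s) w (distr_of h)"
    using assms(1) unfolding H_rep_def by blast
  obtain z where z: "is_fourier_multiplier (exp_weight r1 \<theta>) v z" "is_product (exp_weight r2 s) z (distr_of k)"
    using assms(2) unfolding H_rep_def by blast
  have df: "distr_fourier (\<lambda>\<phi>. a * w \<phi> + b * z \<phi>) = (\<lambda>\<phi>. a * distr_fourier w \<phi> + b * distr_fourier z \<phi>)" for w z
    unfolding distr_fourier_def by auto
  have "is_fourier_multiplier (exp_weight r1 \<theta>) (\<lambda>\<phi>. a * u \<phi> + b * v \<phi>) (\<lambda>\<phi>. a * w \<phi> + b * z \<phi>)"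
    using w(1) z(1) unfolding is_fourier_multiplier_def is_product_def df by (auto intro: tempered_lincomb)
  moreover have "is_product (exp_weight r2 s) (\<lambda>\<phi>. a * w \<phi> + b * z \<phi>) (distr_of (\<lambda>x. a * h x + b * k x))"
    using w(2) z(2) unfolding is_product_def distr_of_lin[OF L] by (auto intro: tempered_lincomb)
  ultimately show ?thesis using L2_lincomb[OF L] unfolding H_rep_def by blast
qed

lemma H_space_lincomb:
  assumes "u \<in> H_space \<theta> s r1 r2" "v \<in> H_space \<theta> s r1 r2"
  shows "(\<lambda>\<phi>. a * u \<phi> + b * v \<phi>) \<in> H_space \<theta> s r1 r2"
  using assms H_rep_lincomb tempered_lincomb unfolding H_space_def by blast

lemma zero_tempered: "(\<lambda>_. 0) \<in> tempered"
proof -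
  have "distr_of (\<lambda>_. 0) = (\<lambda>_. 0)" by (rule ext) (simp add: distr_of_def)
  then show ?thesis using distr_of_tempered[of "\<lambda>_. 0"] by simp
qed

lemma H_rep_zero: "H_rep \<theta> s r1 r2 (\<lambda>_. 0) (\<lambda>_. 0)"
proof -
  have "distr_of (\<lambda>_. 0) = (\<lambda>_. 0)" "distr_fourier (\<lambda>_. 0) = (\<lambda>_. 0)"
    unfolding distr_of_def distr_fourier_def by auto
  then show ?thesis using zero_tempered
    unfolding H_rep_def L2_def is_fourier_multiplier_def is_product_def by auto
qed

lemma zero_in_H_space: "(\<lambda>_. 0) \<in> H_space \<theta> s r1 r2"
  using H_rep_zero zero_tempered unfolding H_space_def by blast

lemma H_norm_zero: "H_norm \<theta> s r1 r2 (\<lambda>_. 0) = 0"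
  using H_norm_eq[OF H_rep_zero] by (simp add: L2_norm_def)

lemma zero_in_C0_H: "(\<lambda>_ _. 0) \<in> C0_H T \<theta> s r1 r2"
  unfolding C0_H_def by (simp add: zero_in_H_space H_norm_zero)

text \<open>Undoing both weights writes \<open>u \<psi>\<close> as the integral of \<open>h\<close>
  times the reciprocal spatial weight times \<open>?\<chi>\<close>. The supremum of
  \<open>?\<chi>\<close> is at most \<open>I1\<close> times the L1 norm of \<open>\<psi>\<close>
  over \<open>2 pi\<close>, and the Cauchy-Schwarz inequality bounds the rest. Only the L1 norm of
  \<open>\<psi>\<close> enters, and the radii are confined to \<open>K\<close>.\<close>

lemma H_pairing_bound:
  assumes pos: "r1 > 0" "r2 > 0" "\<theta> > 0" "s > 0"
  shows "\<exists>K>0. \<forall>u\<in>H_space \<theta> s r1 r2. \<forall>\<psi>\<in>schwartz. cmod (u \<psi>) \<le> K * H_norm \<theta> s r1 r2 u * (LINT x|lborel. cmod (\<psi> x))"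
proof -
  let ?e1 = "exp_weight (- r1) \<theta>" and ?e2 = "exp_weight (- r2) s"
  have e1: "?e1 \<in> schwartz" and e2: "?e2 \<in> schwartz" using pos by (auto intro: exp_weight_neg_schwartz)
  define I1 where "I1 = (LINT x|lborel. cmod (?e1 x))"
  define I2 where "I2 = sqrt ((LINT x|lborel. (cmod (?e2 x))\<^sup>2) + 1)"
  have I1: "I1 \<ge> 0" unfolding I1_def by (intro integral_nonneg_AE) auto
  have I2: "I2 \<ge> 0" unfolding I2_def by (intro real_sqrt_ge_zero add_nonneg_nonneg integral_nonneg_AE) auto
  have main: "cmod (u \<psi>) \<le> (I1 * I2 / (2 * pi)) * H_norm \<theta> s r1 r2 u * (LINT x|lborel. cmod (\<psi> x))"
    if u: "u \<in> H_space \<theta> s r1 r2" and S: "\<psi> \<in> schwartz" for u \<psi>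
  proof -
    obtain h where ut: "u \<in> tempered" and h: "H_rep \<theta> s r1 r2 u h" using u unfolding H_space_def by blast
    have hL: "h \<in> L2" using h unfolding H_rep_def by blast
    obtain w where w: "is_fourier_multiplier (exp_weight r1 \<theta>) u w" "is_product (exp_weight r2 s) w (distr_of h)"
      using h unfolding H_rep_def by blast
    have wt: "w \<in> tempered" using w unfolding is_fourier_multiplier_def by blast
    let ?\<phi> = "ifourier \<psi>" and ?L = "LINT x|lborel. cmod (\<psi> x)"
    let ?\<chi> = "fourier (\<lambda>x. ?e1 x * ifourier \<psi> x)"
    have Sp: "(\<lambda>x. ?e1 x * ?\<phi> x) \<in> schwartz"
      by (intro schwartz_mult slow_exp_weight_neg schwartz_ifourier S pos)
    have L0: "?L \<ge> 0" by (intro integral_nonneg_AE) auto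
    have eq: "u \<psi> = (LINT x|lborel. h x * (?e2 x * ?\<chi> x))"
      using fourier_multiplier_repr[OF pos(1,3) w(1) ut schwartz_ifourier[OF S]]
        product_repr[OF pos(2,4) w(2) wt schwartz_fourier[OF Sp]] fourier_ifourier[OF S] by simp
    have chi: "cmod (?\<chi> x) \<le> I1 * (?L / (2 * pi))" for x
    proof -
      have "cmod (?\<chi> x) \<le> (LINT x|lborel. cmod (?e1 x * ?\<phi> x))" by (rule fourier_bound)
      also have "\<dots> \<le> (LINT x|lborel. cmod (?e1 x) * (?L / (2 * pi)))"
        by (intro integral_mono integrable_norm schwartz_integrable Sp integrable_mult_left e1)
          (simp only: norm_mult, intro mult_left_mono ifourier_bound norm_ge_zero)
      finally show ?thesis unfolding I1_def by simp
    qed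
    have c0: "0 \<le> I1 * (?L / (2 * pi))" using I1 L0 by simp
    have "cmod (u \<psi>) \<le> (LINT x|lborel. cmod (h x * ?e2 x) * (I1 * (?L / (2 * pi))))"
      unfolding eq
    proof (rule Bochner_Integration.integral_norm_bound_integral)
      show "integrable lborel (\<lambda>x. h x * (?e2 x * ?\<chi> x))"
        by (intro L2_mult_integrable hL schwartz_L2 schwartz_mult schwartz_imp_slow e2 schwartz_fourier Sp)
      show "integrable lborel (\<lambda>x. cmod (h x * ?e2 x) * (I1 * (?L / (2 * pi))))"
        by (intro integrable_mult_left integrable_norm L2_mult_integrable hL schwartz_L2 e2)
      show "norm (h x * (?e2 x * ?\<chi> x)) \<le> cmod (h x * ?e2 x) * (I1 * (?L / (2 * pi)))" for x
      proof -
        have "h x * (?e2 x * ?\<chi> x) = (h x * ?e2 x) * ?\<chi> x" by (simp only: mult.assoc)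
        then show ?thesis using mult_left_mono[OF chi norm_ge_zero] by (simp only: norm_mult[of "h x * ?e2 x"])
      qed
    qed
    also have "\<dots> = (LINT x|lborel. cmod (h x * ?e2 x)) * (I1 * (?L / (2 * pi)))" by simp
    also have "\<dots> \<le> (L2_norm h * I2) * (I1 * (?L / (2 * pi)))"
      unfolding I2_def by (intro mult_right_mono L2_cauchy_schwarz hL schwartz_L2 e2 c0)
    finally show ?thesis using H_norm_eq[OF h] by (simp add: mult_ac)
  qed
  show ?thesis
  \<comment> \<open>The added 1 makes the constant strictly positive.\<close>
  proof (intro exI[of _ "I1 * I2 / (2 * pi) + 1"] conjI ballI)
    show "I1 * I2 / (2 * pi) + 1 > 0" using I1 I2 by (simp add: add_nonneg_pos)
    fix u \<psi> assume u: "u \<in> H_space \<theta> s r1 r2" and S: "\<psi> \<in> schwartz"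
    obtain h where h: "H_rep \<theta> s r1 r2 u h" using u unfolding H_space_def by blast
    have "H_norm \<theta> s r1 r2 u \<ge> 0" unfolding H_norm_eq[OF h] L2_norm_def
      by (intro real_sqrt_ge_zero integral_nonneg_AE) auto
    moreover have "(LINT x|lborel. cmod (\<psi> x)) \<ge> 0" by (intro integral_nonneg_AE) auto
    ultimately have "(I1 * I2 / (2 * pi)) * H_norm \<theta> s r1 r2 u * (LINT x|lborel. cmod (\<psi> x)) \<le>
       (I1 * I2 / (2 * pi) + 1) * H_norm \<theta> s r1 r2 u * (LINT x|lborel. cmod (\<psi> x))"
      by (intro mult_right_mono) auto
    with main[OF u S] show "cmod (u \<psi>) \<le> (I1 * I2 / (2 * pi) + 1) * H_norm \<theta> s r1 r2 u * (LINT x|lborel. cmod (\<psi> x))"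
      by linarith
  qed
qed

text \<open>The pairing bound, applied to the difference quotients minus \<open>v t\<close>, turns
  convergence in the norm into convergence of every pairing.\<close>

lemma C1_H_weak_derivative:
  assumes pos: "r1 > 0" "r2 > 0" "\<theta> > 0" "s > 0" and u: "u \<in> C1_H T \<theta> s r1 r2"
  shows "\<exists>v. \<forall>t\<in>{0..T}. \<forall>\<psi>\<in>schwartz. ((\<lambda>\<tau>. u \<tau> \<psi>) has_vector_derivative v t \<psi>) (at t within {0..T})"
proof -
  obtain K where K: "K > 0" "\<And>u \<psi>. u \<in> H_space \<theta> s r1 r2 \<Longrightarrow> \<psi> \<in> schwartz \<Longrightarrow> cmod (u \<psi>) \<le> K * H_norm \<theta> s r1 r2 u * (LINT x|lborel. cmod (\<psi> x))"
    using H_pairing_bound[OF pos] by blast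
  obtain v where v: "v \<in> C0_H T \<theta> s r1 r2" and
    l: "\<And>t. t \<in> {0..T} \<Longrightarrow> ((\<lambda>\<tau>. H_norm \<theta> s r1 r2 (\<lambda>\<phi>. (u \<tau> \<phi> - u t \<phi>) / complex_of_real (\<tau> - t) - v t \<phi>)) \<longlongrightarrow> 0) (at t within {0..T})"
    using u unfolding C1_H_def by blast
  have uH: "u t \<in> H_space \<theta> s r1 r2" "v t \<in> H_space \<theta> s r1 r2" if "t \<in> {0..T}" for t
    using u v that unfolding C1_H_def C0_H_def by auto
  have "((\<lambda>\<tau>. u \<tau> \<psi>) has_vector_derivative v t \<psi>) (at t within {0..T})"
    if t: "t \<in> {0..T}" and S: "\<psi> \<in> schwartz" for t \<psi>
    unfolding has_vector_derivative_def has_derivative_within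
  proof
    show "bounded_linear (\<lambda>x. x *\<^sub>R v t \<psi>)" by (rule bounded_linear_scaleR_left)
    let ?q = "\<lambda>\<tau> \<phi>. (u \<tau> \<phi> - u t \<phi>) / complex_of_real (\<tau> - t) - v t \<phi>"
    let ?L = "LINT x|lborel. cmod (\<psi> x)"
    show "((\<lambda>y. (1 / norm (y - t)) *\<^sub>R (u y \<psi> - (u t \<psi> + (y - t) *\<^sub>R v t \<psi>))) \<longlongrightarrow> 0) (at t within {0..T})"
    proof (rule Lim_null_comparison[where g = "\<lambda>y. K * H_norm \<theta> s r1 r2 (?q y) * ?L"])
      have "((\<lambda>y. K * H_norm \<theta> s r1 r2 (?q y) * ?L) \<longlongrightarrow> K * 0 * ?L) (at t within {0..T})"
        by (intro tendsto_intros l t)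
      then show "((\<lambda>y. K * H_norm \<theta> s r1 r2 (?q y) * ?L) \<longlongrightarrow> 0) (at t within {0..T})" by simp
      show "\<forall>\<^sub>F y in at t within {0..T}. norm ((1 / norm (y - t)) *\<^sub>R (u y \<psi> - (u t \<psi> + (y - t) *\<^sub>R v t \<psi>))) \<le> K * H_norm \<theta> s r1 r2 (?q y) * ?L"
        unfolding eventually_at_filter
      proof (rule always_eventually, intro allI impI)
        fix y assume y: "y \<noteq> t" "y \<in> {0..T}"
        let ?c = "1 / complex_of_real (y - t)"
        have "(\<lambda>\<phi>. 1 * (?c * u y \<phi> + (- ?c) * u t \<phi>) + (-1) * v t \<phi>) \<in> H_space \<theta> s r1 r2"
          by (intro H_space_lincomb uH t y)
        moreover have "(\<lambda>\<phi>. 1 * (?c * u y \<phi> + (- ?c) * u t \<phi>) + (-1) * v t \<phi>) = ?q y"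
          by (simp add: diff_divide_distrib)
        ultimately have "?q y \<in> H_space \<theta> s r1 r2" by simp
        then have "cmod (?q y \<psi>) \<le> K * H_norm \<theta> s r1 r2 (?q y) * ?L" by (rule K(2)[OF _ S])
        moreover have "norm ((1 / norm (y - t)) *\<^sub>R (u y \<psi> - (u t \<psi> + (y - t) *\<^sub>R v t \<psi>))) = cmod (?q y \<psi>)"
        proof -
          have nz: "complex_of_real (y - t) \<noteq> 0" using y by simp
          have "u y \<psi> - (u t \<psi> + (y - t) *\<^sub>R v t \<psi>) = complex_of_real (y - t) * ?q y \<psi>"
            using nz by (simp add: field_simps scaleR_conv_of_real)
          moreover have "norm (complex_of_real (y - t)) = norm (y - t)" by (simp only: norm_of_real real_norm_def)
          ultimately show ?thesis using y by (simp add: norm_mult del: of_real_diff)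
        qed
        ultimately show "norm ((1 / norm (y - t)) *\<^sub>R (u y \<psi> - (u t \<psi> + (y - t) *\<^sub>R v t \<psi>))) \<le> K * H_norm \<theta> s r1 r2 (?q y) * ?L"
          by simp
      qed
    qed
  qed
  then show ?thesis by blast
qed

section \<open>A Jost-type solution on a bounded window\<close>

lemma mean_value_bound:
  fixes f :: "real \<Rightarrow> complex"
  assumes ab: "a \<le> b" and d: "\<And>x. x \<in> {a..b} \<Longrightarrow> (f has_vector_derivative f' x) (at x within {a..b})"
    and M: "\<And>x. x \<in> {a..b} \<Longrightarrow> cmod (f' x) \<le> M"
  shows "cmod (f b - f a) \<le> M * (b - a)"
proof (cases "a = b")
  case False
  then have "a < b" using ab by simp
  have "\<exists>x\<in>{a<..<b}. norm (f b - f a) \<le> norm ((b - a) *\<^sub>R f' x)"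
  proof (rule mvt_general[OF \<open>a < b\<close>])
    show "continuous_on {a..b} f"
      unfolding continuous_on_eq_continuous_within
      by (intro ballI has_vector_derivative_continuous[OF d])
    fix x assume x: "a < x" "x < b"
    then have "at x within {a..b} = at x" by (intro at_within_interior) auto
    then show "(f has_derivative (\<lambda>h. h *\<^sub>R f' x)) (at x)"
      using d[of x] x unfolding has_vector_derivative_def by auto
  qed
  then obtain x where x: "x \<in> {a<..<b}" "norm (f b - f a) \<le> norm ((b - a) *\<^sub>R f' x)" by blast
  have "norm ((b - a) *\<^sub>R f' x) \<le> M * (b - a)"
    using M[of x] x(1) by (simp add: mult.commute mult_right_mono)
  then show ?thesis using x(2) by linarith
qed simp

lemma exists_antiderivative:
  fixes f :: "real \<Rightarrow> 'a::euclidean_space"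
  assumes "continuous_on UNIV f"
  shows "\<exists>P. (\<forall>x. (P has_vector_derivative f x) (at x)) \<and> P c = 0"
proof -
  have "\<exists>F. \<forall>x. - \<infinity> < ereal x \<longrightarrow> ereal x < \<infinity> \<longrightarrow> (F has_vector_derivative f x) (at x)"
    by (rule einterval_antiderivative) (use assms in \<open>auto simp: continuous_on_eq_continuous_at\<close>)
  then obtain F where F: "\<And>x. (F has_vector_derivative f x) (at x)" by auto
  have "((\<lambda>x. F x - F c) has_vector_derivative (f x - 0)) (at x)" for x
    by (intro has_vector_derivative_diff F has_vector_derivative_const)
  then show ?thesis by (intro exI[of _ "\<lambda>x. F x - F c"]) auto
qed

text \<open>\<open>exp (z x) * P x\<close> is the integral of \<open>exp (z (x - y)) * f y\<close>
  over \<open>y\<close> from \<open>p\<close> to \<open>x\<close>, with a kernel bounded by 1 as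
  \<open>Re z \<le> 0\<close>. It vanishes to the left of \<open>p\<close>; to the right of
  \<open>q\<close> the factor \<open>P\<close> is constant and the exponential does not
  grow.\<close>

lemma volterra_bound:
  fixes P f :: "real \<Rightarrow> complex"
  assumes P: "\<And>x. (P has_vector_derivative exp (- z * complex_of_real x) * f x) (at x)" and Pp: "P p = 0"
    and pq: "p \<le> q" and f0: "\<And>x. x \<le> p \<or> x \<ge> q \<Longrightarrow> f x = 0" and fM: "\<And>x. cmod (f x) \<le> M" and z: "Re z \<le> 0"
  shows "cmod (exp (z * complex_of_real x) * P x) \<le> M * (q - p)"
proof -
  have M: "M \<ge> 0" using order_trans[OF norm_ge_zero fM] .
  have Pw: "(P has_vector_derivative exp (- z * complex_of_real y) * f y) (at y within A)" for y A
    by (rule has_vector_derivative_at_within[OF P])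
  have inner: "cmod (exp (z * complex_of_real x) * P x) \<le> M * (q - p)" if x: "x \<in> {p..q}" for x
  proof -
    \<comment> \<open>The outer \<open>x\<close> stays fixed while \<open>y\<close> varies, so the
      derivative in \<open>y\<close> is exactly the kernel times \<open>f y\<close>.\<close>
    let ?g = "\<lambda>y. exp (z * complex_of_real x) * P y"
    have "cmod (?g x - ?g p) \<le> M * (x - p)"
    proof (rule mean_value_bound)
      show "(?g has_vector_derivative exp (z * complex_of_real x) * (exp (- z * complex_of_real y) * f y)) (at y within {p..x})" for y
        by (rule has_vector_derivative_mult_right[OF Pw])
      fix y assume y: "y \<in> {p..x}"
      have eq: "exp (z * complex_of_real x) * (exp (- z * complex_of_real y) * f y) = exp (z * complex_of_real (x - y)) * f y"
        by (simp only: mult.assoc[symmetric] mult_exp_exp) (simp add: algebra_simps)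
      have "cmod (exp (z * complex_of_real (x - y))) \<le> 1"
        using z y by (simp add: mult_nonpos_nonneg)
      from mult_mono[OF this fM[of y]]
      show "cmod (exp (z * complex_of_real x) * (exp (- z * complex_of_real y) * f y)) \<le> M"
        unfolding eq norm_mult by simp
    qed (use x in auto)
    also have "\<dots> \<le> M * (q - p)" using x M by (intro mult_left_mono) auto
    finally show ?thesis using Pp by simp
  qed
  consider "x \<in> {p..q}" | "x < p" | "x > q" by fastforce
  then show ?thesis
  proof cases
    case 2
    have "cmod (P p - P x) \<le> 0 * (p - x)"
      by (rule mean_value_bound[OF _ Pw]) (use 2 f0 in auto)
    then show ?thesis using Pp M pq by simp
  next
    case 3
    have "cmod (P x - P q) \<le> 0 * (x - q)"
      by (rule mean_value_bound[OF _ Pw]) (use 3 f0 in auto)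
    then have "exp (z * complex_of_real x) * P x = exp (z * complex_of_real (x - q)) * (exp (z * complex_of_real q) * P q)"
      by (simp only: mult.assoc[symmetric] mult_exp_exp) (simp add: algebra_simps)
    moreover have "cmod (exp (z * complex_of_real (x - q))) \<le> 1"
      using z 3 by (simp add: mult_nonpos_nonneg)
    ultimately have "cmod (exp (z * complex_of_real x) * P x) \<le> 1 * cmod (exp (z * complex_of_real q) * P q)"
      unfolding norm_mult[of "exp (z * complex_of_real (x - q))"] by (metis mult_right_mono norm_ge_zero norm_mult)
    then show ?thesis using inner[of q] pq by simp
  qed (rule inner)
qed

text \<open>The solution is the fixed point of a Volterra operator whose kernel is bounded because
  \<open>Im k \<ge> 0\<close>; for large \<open>k\<close> the operator is a contraction.\<close>

lemma jost_solution:
  fixes U :: "real \<Rightarrow> complex"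
  assumes U: "continuous_on UNIV U" "\<And>x. cmod (U x) \<le> 1" "\<And>x. x \<le> p \<or> x \<ge> q \<Longrightarrow> U x = 0"
    and pq: "p < q" and k: "Im k \<ge> 0" "cmod k \<ge> 4 * (q - p)"
  shows "\<exists>m n. (\<forall>x. (m has_vector_derivative n x) (at x)) \<and>
     (\<forall>x. (n has_vector_derivative 2 * \<i> * k * n x - U x * m x) (at x)) \<and>
     (\<forall>x. cmod (m x - 1) \<le> 1 / 3) \<and> (\<forall>x. cmod (n x) \<le> (4 / 3) * (q - p))"
proof -
  \<comment> \<open>The hypothesis on \<open>k\<close> becomes \<open>|z| \<ge> 8 (q - p)\<close>:
    two Volterra integrals, each of size \<open>M (q - p)\<close>, divided by \<open>z\<close> give
    the contraction factor 1/4.\<close>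
  define z where "z = 2 * \<i> * k"
  have z: "Re z \<le> 0" "cmod z \<ge> 8 * (q - p)" using k by (auto simp: z_def norm_mult)
  have z0: "z \<noteq> 0" "cmod z > 0" using z(2) pq by auto
  have "\<forall>g::real \<Rightarrow> complex. \<exists>P. continuous_on UNIV g \<longrightarrow> (\<forall>x. (P has_vector_derivative g x) (at x)) \<and> P p = 0"
    using exists_antiderivative[where c = p] by blast
  from choice[OF this] obtain P :: "(real \<Rightarrow> complex) \<Rightarrow> real \<Rightarrow> complex"
    where Pvd: "\<And>g x. continuous_on UNIV g \<Longrightarrow> (P g has_vector_derivative g x) (at x)" and Pp: "\<And>g. continuous_on UNIV g \<Longrightarrow> P g p = 0"
    by blast
  define E where "E x = exp (- z * complex_of_real x)" for x
  have cE: "continuous_on UNIV E" unfolding E_def by (intro continuous_intros)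
  \<comment> \<open>Variation of constants for \<open>m'' = z m' - U m\<close> with
    \<open>m = 1\<close> and \<open>m' = 0\<close> to the left of the window. The subtracted
    integral has the kernel \<open>(exp (z (x - y)) - 1) / z\<close>; differentiation leaves only
    the exponential part, which is \<open>n\<close>.\<close>
  define K where "K m x = 1 - (exp (z * complex_of_real x) * P (\<lambda>y. E y * (U y * m y)) x - P (\<lambda>y. U y * m y) x) / z" for m x
  define n where "n m x = - (exp (z * complex_of_real x) * P (\<lambda>y. E y * (U y * m y)) x)" for m x
  have cUm: "continuous_on UNIV (\<lambda>y. E y * (U y * m y))" "continuous_on UNIV (\<lambda>y. U y * m y)" if "continuous_on UNIV m" for m
    using that cE U(1) by (auto intro!: continuous_intros)
  have ezd: "((\<lambda>x. exp (z * complex_of_real x)) has_vector_derivative z * exp (z * complex_of_real x)) (at x)" for x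
    by (rule exp_vd[OF linear_vd])
  have eE: "exp (z * complex_of_real x) * (E x * y) = y" for x y
    unfolding E_def mult.assoc[symmetric] by (simp add: mult_exp_exp)
  have d1: "((\<lambda>x. exp (z * complex_of_real x) * P (\<lambda>y. E y * (U y * m y)) x) has_vector_derivative
       U x * m x + z * (exp (z * complex_of_real x) * P (\<lambda>y. E y * (U y * m y)) x)) (at x)" if "continuous_on UNIV m" for m x
    using has_vector_derivative_mult[OF ezd Pvd[OF cUm(1)[OF that]], of x] by (simp add: eE mult.assoc)
  have Kvd: "(K m has_vector_derivative n m x) (at x)" if "continuous_on UNIV m" for m x
  proof -
    have "(K m has_vector_derivative 0 - ((U x * m x + z * (exp (z * complex_of_real x) * P (\<lambda>y. E y * (U y * m y)) x)) - U x * m x) / z) (at x)"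
      unfolding K_def by (intro has_vector_derivative_diff has_vector_derivative_const has_vector_derivative_divide d1 Pvd cUm that)
    then show ?thesis using z0 by (simp add: n_def)
  qed
  have nvd: "(n m has_vector_derivative z * n m x - U x * m x) (at x)" if "continuous_on UNIV m" for m x
  proof -
    have eq: "z * n m x - U x * m x = - (U x * m x + z * (exp (z * complex_of_real x) * P (\<lambda>y. E y * (U y * m y)) x))"
      unfolding n_def by (simp add: algebra_simps)
    show ?thesis unfolding eq unfolding n_def by (rule has_vector_derivative_minus[OF d1[OF that]])
  qed
  have bE: "cmod (exp (z * complex_of_real x) * Q x) \<le> M * (q - p)"
    if "\<And>x. (Q has_vector_derivative E x * (U x * f x)) (at x)" "Q p = 0" "\<And>x. cmod (f x) \<le> M" for Q f M x
  proof (rule volterra_bound)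
    show "(Q has_vector_derivative exp (- z * complex_of_real x) * (U x * f x)) (at x)" for x using that(1) unfolding E_def .
    show "cmod (U x * f x) \<le> M" for x
      using mult_mono[OF U(2) that(3), of x x] by (simp add: norm_mult)
  qed (use that pq U(3) z in auto)
  have b1: "cmod (Q x) \<le> M * (q - p)"
    if "\<And>x. (Q has_vector_derivative (U x * f x)) (at x)" "Q p = 0" "\<And>x. cmod (f x) \<le> M" for Q f M x
  proof -
    have "cmod (exp (0 * complex_of_real x) * Q x) \<le> M * (q - p)"
    proof (rule volterra_bound)
      show "(Q has_vector_derivative exp (- 0 * complex_of_real x) * (U x * f x)) (at x)" for x using that(1) by simp
      show "cmod (U x * f x) \<le> M" for x
        using mult_mono[OF U(2) that(3), of x x] by (simp add: norm_mult)
    qed (use that pq U(3) in auto)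
    then show ?thesis by simp
  qed
  have Kdiff: "cmod (K m x - K m' x) \<le> M / 4"
    if m: "continuous_on UNIV m" "continuous_on UNIV m'" and M: "\<And>x. cmod (m x - m' x) \<le> M" for m m' M x
  proof -
    let ?Q = "\<lambda>x. P (\<lambda>y. E y * (U y * m y)) x - P (\<lambda>y. E y * (U y * m' y)) x"
    let ?S = "\<lambda>x. P (\<lambda>y. U y * m y) x - P (\<lambda>y. U y * m' y) x"
    have M0: "M \<ge> 0" using order_trans[OF norm_ge_zero M] .
    have Q: "cmod (exp (z * complex_of_real x) * ?Q x) \<le> M * (q - p)"
    proof (rule bE)
      show "(?Q has_vector_derivative E x * (U x * (m x - m' x))) (at x)" for x
        using has_vector_derivative_diff[OF Pvd[OF cUm(1)[OF m(1)]] Pvd[OF cUm(1)[OF m(2)]], of x] by (simp add: algebra_simps)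
    qed (use m M Pp cUm in auto)
    have S: "cmod (?S x) \<le> M * (q - p)"
    proof (rule b1)
      show "(?S has_vector_derivative (U x * (m x - m' x))) (at x)" for x
        using has_vector_derivative_diff[OF Pvd[OF cUm(2)[OF m(1)]] Pvd[OF cUm(2)[OF m(2)]], of x] by (simp add: algebra_simps)
    qed (use m M Pp cUm in auto)
    have "K m x - K m' x = (?S x - exp (z * complex_of_real x) * ?Q x) / z"
      unfolding K_def using z0 by (simp add: field_simps)
    then have "cmod (K m x - K m' x) = cmod (?S x - exp (z * complex_of_real x) * ?Q x) / cmod z" by (simp add: norm_divide)
    also have "\<dots> \<le> (2 * M * (q - p)) / cmod z"
      using norm_triangle_ineq4[of "?S x" "exp (z * complex_of_real x) * ?Q x"] Q S by (intro divide_right_mono) auto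
    also have "\<dots> \<le> M / 4"
      using z0 mult_left_mono[OF z(2) M0] by (simp add: field_simps)
    finally show ?thesis .
  qed
  have K0: "K (\<lambda>_. 0) x = 1" for x
  proof -
    have "cmod (exp (z * complex_of_real x) * P (\<lambda>y. E y * (U y * 0)) x) \<le> 0 * (q - p)"
      by (rule bE[where f = "\<lambda>_. 0"]) (use Pvd[of "\<lambda>_. 0"] Pp[of "\<lambda>_. 0"] in auto)
    moreover have "cmod (P (\<lambda>y. U y * 0) x) \<le> 0 * (q - p)"
      by (rule b1[where f = "\<lambda>_. 0"]) (use Pvd[of "\<lambda>_. 0"] Pp[of "\<lambda>_. 0"] in auto)
    ultimately show ?thesis unfolding K_def by simp
  qed
  have K1: "cmod (K m x - 1) \<le> M / 4" if "continuous_on UNIV m" "\<And>x. cmod (m x) \<le> M" for m M x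
    using Kdiff[OF that(1) continuous_on_const[of UNIV 0], of M x] that(2) K0 by simp
  have cK: "continuous_on UNIV (K m)" if "continuous_on UNIV m" for m
    using Kvd[OF that] by (intro continuous_at_imp_continuous_on ballI has_vector_derivative_continuous)
  \<comment> \<open>The fixed point is sought among bounded continuous functions on the whole line;
    \<open>K\<close> preserves boundedness because \<open>U\<close> vanishes outside the
    window.\<close>
  define F :: "(real \<Rightarrow>\<^sub>C complex) \<Rightarrow> (real \<Rightarrow>\<^sub>C complex)" where "F m = Bcontfun (K (apply_bcontfun m))" for m
  have Fapp: "apply_bcontfun (F m) = K (apply_bcontfun m)" for m
    unfolding F_def
  proof (rule Bcontfun_inverse, rule bcontfun_normI)
    fix x
    have "cmod (K (apply_bcontfun m) x) \<le> cmod (K (apply_bcontfun m) x - 1) + cmod 1"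
      by (metis diff_add_cancel norm_triangle_ineq)
    also have "\<dots> \<le> norm m / 4 + 1"
      using K1[of "apply_bcontfun m" "norm m" x] norm_bounded[of m] by simp
    finally show "norm (K (apply_bcontfun m) x) \<le> norm m / 4 + 1" .
  qed (simp add: cK)
  have "\<exists>!m. F m = m"
  proof (rule banach_fix_type[of "1/4"])
    show "\<forall>x y. dist (F x) (F y) \<le> 1 / 4 * dist x y"
    proof (intro allI dist_bound)
      fix m m' x
      have "cmod (K (apply_bcontfun m) x - K (apply_bcontfun m') x) \<le> dist m m' / 4"
        by (rule Kdiff) (use dist_bounded[of m _ m'] in \<open>auto simp: dist_norm\<close>)
      then show "dist (F m x) (F m' x) \<le> 1 / 4 * dist m m'" unfolding Fapp by (simp add: dist_norm)
    qed
  qed auto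
  then obtain M where M: "F M = M" by blast
  define m where "m = apply_bcontfun M"
  have Km: "K m = m" using Fapp[of M] M unfolding m_def by simp
  have cm: "continuous_on UNIV m" unfolding m_def by simp
  have mM: "cmod (m x) \<le> norm M" for x unfolding m_def by (rule norm_bounded)
  have m1: "cmod (m x - 1) \<le> norm M / 4" for x using K1[OF cm mM] Km by metis
  \<comment> \<open>The fixed point bounds itself: this gives \<open>norm M \<le> 4/3\<close>, and
    then the distance from 1 is at most a quarter of it, that is 1/3.\<close>
  have "norm M \<le> norm M / 4 + 1"
  proof (rule norm_bound)
    fix x
    have "cmod (m x) \<le> cmod (m x - 1) + cmod 1" by (metis diff_add_cancel norm_triangle_ineq)
    then show "norm (apply_bcontfun M x) \<le> norm M / 4 + 1" using m1[of x] unfolding m_def by simp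
  qed
  then have nM: "norm M \<le> 4 / 3" by simp
  have "(m has_vector_derivative n m x) (at x)" for x using Kvd[OF cm] Km by simp
  moreover have "(n m has_vector_derivative 2 * \<i> * k * n m x - U x * m x) (at x)" for x
    using nvd[OF cm] unfolding z_def .
  moreover have "cmod (m x - 1) \<le> 1 / 3" for x using m1[of x] nM by simp
  moreover have "cmod (n m x) \<le> (4 / 3) * (q - p)" for x
    unfolding n_def norm_minus_cancel
    by (rule bE) (use Pvd Pp cUm cm order_trans[OF mM nM] in auto)
  ultimately show ?thesis by blast
qed

text \<open>Both derivatives are combinations of \<open>m\<close> and \<open>n\<close> with smooth
  coefficients, so the pair gains one order at a time.\<close>

lemma smooth_system:
  assumes m: "\<And>x. (m has_vector_derivative n x) (at x)"
    and n: "\<And>x. (n has_vector_derivative c * n x - U x * m x) (at x)" and U: "smooth U"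
  shows "smooth m" "smooth n"
proof -
  have "cls (\<lambda>_. True) k (\<lambda>_. m) \<and> cls (\<lambda>_. True) k (\<lambda>_. n)" for k
  proof (induction k)
    case (Suc k)
    have "cls (\<lambda>_. True) k (\<lambda>_ x. c * n x + (- 1 * U x) * m x)"
      using Suc U[unfolded smooth_cls]
      by (intro cls_add[of "\<lambda>_. True"] cls_mult[of "\<lambda>_. True" "\<lambda>_. True" "\<lambda>_. True"] cls_const) auto
    then have "cls (\<lambda>_. True) k (\<lambda>_ x. c * n x - U x * m x)" by simp
    then show ?case using Suc by (auto intro!: cls_SucI[OF m] cls_SucI[OF n] simp del: cls.simps)
  qed simp
  then show "smooth m" "smooth n" unfolding smooth_cls by blast+
qed

section \<open>The exponent of the quasimode\<close>

text \<open>Normalised at 0 so that the exponent of the quasimode vanishes where the right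
  transition of the cutoff begins.\<close>

definition jint :: "real \<Rightarrow> real \<Rightarrow> real" where
  "jint \<sigma> = (SOME A. (\<forall>x. (A has_real_derivative jap x powr (- \<sigma>)) (at x)) \<and> A 0 = 0)"

lemma jap_powr_isCont: "isCont (\<lambda>x. jap x powr p) x"
  using jap_powr_deriv DERIV_isCont by blast

lemma jint: "(jint \<sigma> has_real_derivative jap x powr (- \<sigma>)) (at x)" "jint \<sigma> 0 = 0"
proof -
  have "continuous_on UNIV (\<lambda>x. jap x powr (- \<sigma>))"
    by (intro continuous_at_imp_continuous_on ballI jap_powr_isCont)
  then have "\<exists>A. (\<forall>x. (A has_real_derivative jap x powr (- \<sigma>)) (at x)) \<and> A 0 = 0"
    unfolding has_real_derivative_iff_has_vector_derivative by (rule exists_antiderivative)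
  from someI_ex[OF this] show "(jint \<sigma> has_real_derivative jap x powr (- \<sigma>)) (at x)" "jint \<sigma> 0 = 0"
    unfolding jint_def by auto
qed

lemma jap_powr_antimono:
  assumes "\<sigma> \<ge> 0" "\<bar>x\<bar> \<le> \<bar>y\<bar>" shows "jap y powr (- \<sigma>) \<le> jap x powr (- \<sigma>)"
proof (rule powr_mono2')
  have "x\<^sup>2 \<le> y\<^sup>2" using assms(2) by (simp add: abs_le_square_iff)
  then show "jap x \<le> jap y" unfolding jap_def by simp
qed (use assms jap_pos in auto)

lemma jap_powr_le_1: "\<sigma> \<ge> 0 \<Longrightarrow> jap x powr (- \<sigma>) \<le> 1"
  using powr_mono[of "- \<sigma>" 0 "jap x"] jap_ge_1[of x] jap_pos[of x] by simp

text \<open>Logarithm of the modulus of \<open>exp (- A / 2 - i k x)\<close> when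
  \<open>Im k = a(X) / 2\<close>. For \<open>\<sigma> \<ge> 0\<close> the slope is nonpositive
  between \<open>- X\<close> and \<open>X\<close> and nonnegative outside.\<close>

definition Phi :: "real \<Rightarrow> real \<Rightarrow> real \<Rightarrow> real" where
  "Phi \<sigma> X x = jap X powr (- \<sigma>) / 2 * x - jint \<sigma> x / 2"

lemma Phi_deriv: "(Phi \<sigma> X has_real_derivative (jap X powr (- \<sigma>) - jap x powr (- \<sigma>)) / 2) (at x)"
proof -
  have "((\<lambda>x. jap X powr (- \<sigma>) / 2 * x - jint \<sigma> x / 2) has_real_derivative
     jap X powr (- \<sigma>) / 2 * 1 - jap x powr (- \<sigma>) / 2) (at x)"
    by (intro DERIV_diff DERIV_cdivide jint DERIV_cmult DERIV_ident)
  then show ?thesis unfolding Phi_def[abs_def] by (simp add: diff_divide_distrib)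
qed

lemma Phi_0: "Phi \<sigma> X 0 = 0"
  by (simp add: Phi_def jint)

lemma Phi_mono_left:
  assumes "\<sigma> \<ge> 0" "x \<le> y" "y \<le> - X" "X \<ge> 0" shows "Phi \<sigma> X x \<le> Phi \<sigma> X y"
proof (rule DERIV_nonneg_imp_nondecreasing[OF assms(2)])
  fix t assume "x \<le> t" "t \<le> y"
  then have "jap t powr (- \<sigma>) \<le> jap X powr (- \<sigma>)" using assms by (intro jap_powr_antimono) auto
  then show "\<exists>d. (Phi \<sigma> X has_real_derivative d) (at t) \<and> 0 \<le> d" using Phi_deriv[of \<sigma> X t] by (intro exI conjI) auto
qed

lemma Phi_antimono:
  assumes "\<sigma> \<ge> 0" "x \<le> y" "- X \<le> x" "y \<le> X" shows "Phi \<sigma> X y \<le> Phi \<sigma> X x"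
proof (rule DERIV_nonpos_imp_nonincreasing[OF assms(2)])
  fix t assume "x \<le> t" "t \<le> y"
  then have "jap X powr (- \<sigma>) \<le> jap t powr (- \<sigma>)" using assms by (intro jap_powr_antimono) auto
  then show "\<exists>d. (Phi \<sigma> X has_real_derivative d) (at t) \<and> d \<le> 0" using Phi_deriv[of \<sigma> X t] by (intro exI conjI) auto
qed

lemma Phi_le_max: "\<sigma> \<ge> 0 \<Longrightarrow> X \<ge> 0 \<Longrightarrow> x \<le> X \<Longrightarrow> Phi \<sigma> X x \<le> Phi \<sigma> X (- X)"
  using Phi_mono_left[of \<sigma> x "-X" X] Phi_antimono[of \<sigma> "-X" x X] by (cases "x \<le> - X") auto

text \<open>Origin of \<open>Y^2 = X^(1+\<sigma>)\<close>. Since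
  \<open>|a'| \<le> X^(-1-\<sigma>)\<close> beyond distance \<open>X\<close>, the slope on the
  interval is at most \<open>X^(-1-\<sigma>) Y / 2\<close>, and over a length \<open>Y\<close> the
  drop is at most \<open>X^(-1-\<sigma>) Y^2 / 2 = 1/2\<close>.\<close>

lemma Phi_near_max:
  assumes s: "0 < \<sigma>" "\<sigma> < 1" and X: "X > 0" and Y: "Y \<ge> 0" "Y\<^sup>2 = X powr (1 + \<sigma>)" and x: "- X - Y \<le> x" "x \<le> - X"
  shows "Phi \<sigma> X (- X) - 1 / 2 \<le> Phi \<sigma> X x"
proof -
  let ?c = "X powr (- 1 - \<sigma>)"
  have a: "jap X powr (- \<sigma>) - jap t powr (- \<sigma>) \<le> ?c * Y" if t: "x \<le> t" "t \<le> - X" for t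
  proof -
    \<comment> \<open>Mean value inequality in monotone form: \<open>a\<close> plus a linear
      function of slope \<open>?c\<close> is nondecreasing beyond \<open>X\<close>.\<close>
    define g where "g y = jap y powr (- \<sigma>) + ?c * y" for y
    have "g X \<le> g (- t)"
    proof (rule DERIV_nonneg_imp_nondecreasing[where f = g])
      fix y assume y: "X \<le> y" "y \<le> - t"
      have d: "(g has_real_derivative - \<sigma> * y * jap y powr (- \<sigma> - 2) + ?c * 1) (at y)"
        unfolding g_def by (intro DERIV_add jap_powr_deriv DERIV_cmult DERIV_ident)
      have "\<sigma> * y * jap y powr (- \<sigma> - 2) \<le> 1 * jap y * jap y powr (- \<sigma> - 2)"
        using s y X jap_ge[of y] jap_pos[of y] by (intro mult_right_mono mult_mono) auto
      also have "\<dots> = jap y powr (- 1 - \<sigma>)"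
        using jap_pos[of y] powr_add[of "jap y" 1 "- \<sigma> - 2"] by simp
      also have "\<dots> \<le> ?c" using s y X jap_ge[of y] by (intro powr_mono2') auto
      finally have "0 \<le> - \<sigma> * y * jap y powr (- \<sigma> - 2) + ?c * 1" by simp
      with d show "\<exists>d. (g has_real_derivative d) (at y) \<and> 0 \<le> d" by blast
    qed (use t in auto)
    then have "jap X powr (- \<sigma>) - jap t powr (- \<sigma>) \<le> ?c * (- t - X)"
      unfolding g_def by (simp add: jap_minus algebra_simps)
    also have "\<dots> \<le> ?c * Y" using t x by (intro mult_left_mono) auto
    finally show ?thesis .
  qed
  define h where "h y = Phi \<sigma> X y - ?c * Y / 2 * y" for y
  have "h (- X) \<le> h x"
  proof (rule DERIV_nonpos_imp_nonincreasing[where f = h])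
    fix t assume t: "x \<le> t" "t \<le> - X"
    have "(h has_real_derivative (jap X powr (- \<sigma>) - jap t powr (- \<sigma>)) / 2 - ?c * Y / 2 * 1) (at t)"
      unfolding h_def by (intro DERIV_diff Phi_deriv DERIV_cmult DERIV_ident)
    moreover have "(jap X powr (- \<sigma>) - jap t powr (- \<sigma>)) / 2 - ?c * Y / 2 * 1 \<le> 0" using a[OF t] by argo
    ultimately show "\<exists>d. (h has_real_derivative d) (at t) \<and> d \<le> 0" by blast
  qed (use x in auto)
  then have "Phi \<sigma> X (- X) - Phi \<sigma> X x \<le> ?c * Y / 2 * (- X - x)"
    unfolding h_def by (simp add: algebra_simps)
  also have "\<dots> \<le> ?c * Y / 2 * Y" using x Y by (intro mult_left_mono) auto
  also have "\<dots> = (X powr (- 1 - \<sigma>) * X powr (1 + \<sigma>)) / 2" using Y(2) by (simp add: power2_eq_square)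
  also have "\<dots> = 1 / 2" using X by (simp add: powr_add[symmetric])
  finally show ?thesis by simp
qed

text \<open>For \<open>t\<close> in \<open>[- X/4, 0]\<close> the assumption
  \<open>X \<ge> 4\<close> gives \<open>jap t \<le> X / 2\<close>, hence
  \<open>a(t) - a(X) \<ge> D\<close>. The slope is then at most \<open>- D / 2\<close> over a length
  \<open>X / 4\<close>, which lifts the value at \<open>- X / 4\<close> to at least
  \<open>D X / 8\<close>.\<close>

lemma Phi_max_ge:
  assumes s: "0 < \<sigma>" "\<sigma> < 1" and X: "X \<ge> 4"
  shows "(2 powr \<sigma> - 1) / 8 * X powr (1 - \<sigma>) \<le> Phi \<sigma> X (- X)"
proof -
  define D where "D = (2 powr \<sigma> - 1) * X powr (- \<sigma>)"
  have a: "D \<le> jap t powr (- \<sigma>) - jap X powr (- \<sigma>)" if t: "- X / 4 \<le> t" "t \<le> 0" for t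
  proof -
    have "jap X powr (- \<sigma>) \<le> X powr (- \<sigma>)"
      using s X jap_ge[of X] by (intro powr_mono2') auto
    moreover have "2 powr \<sigma> * X powr (- \<sigma>) = (X / 2) powr (- \<sigma>)"
      using X by (simp add: powr_divide powr_minus_divide)
    moreover have "(X / 2) powr (- \<sigma>) \<le> jap t powr (- \<sigma>)"
      using s X t jap_le[of t] jap_pos[of t] by (intro powr_mono2') auto
    ultimately show ?thesis unfolding D_def by (simp add: algebra_simps)
  qed
  define h where "h y = Phi \<sigma> X y + D / 2 * y" for y
  have "h 0 \<le> h (- X / 4)"
  proof (rule DERIV_nonpos_imp_nonincreasing[where f = h])
    fix t assume t: "- X / 4 \<le> t" "t \<le> 0"
    have "(h has_real_derivative (jap X powr (- \<sigma>) - jap t powr (- \<sigma>)) / 2 + D / 2 * 1) (at t)"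
      unfolding h_def by (intro DERIV_add Phi_deriv DERIV_cmult DERIV_ident)
    moreover have "(jap X powr (- \<sigma>) - jap t powr (- \<sigma>)) / 2 + D / 2 * 1 \<le> 0" using a[OF t] by argo
    ultimately show "\<exists>d. (h has_real_derivative d) (at t) \<and> d \<le> 0" by blast
  qed (use X in auto)
  then have "D * X / 8 \<le> Phi \<sigma> X (- X / 4)" unfolding h_def by (simp add: Phi_0)
  also have "\<dots> \<le> Phi \<sigma> X (- X)" using s X by (intro Phi_le_max) auto
  also have "D * X / 8 = (2 powr \<sigma> - 1) / 8 * X powr (1 - \<sigma>)"
    using X powr_add[of X "-\<sigma>" 1] unfolding D_def by (simp add: add.commute)
  finally show ?thesis .
qed

text \<open>The linear term wins far out, because the integral of \<open>a\<close> over
  \<open>[- L, 0]\<close> grows only like \<open>L^(1-\<sigma>)\<close>. The choice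
  \<open>Z^\<sigma> = 8 / (1 - \<sigma>)\<close> makes the bound for this integral exactly half of
  the lower bound \<open>2^(-\<sigma>) X^(-\<sigma>) L\<close> for the linear term.\<close>

lemma Phi_far_le_0:
  assumes s: "0 < \<sigma>" "\<sigma> < 1" and X: "X \<ge> 1" and x: "x \<le> - ((8 / (1 - \<sigma>)) powr (1 / \<sigma>) * X)"
  shows "Phi \<sigma> X x \<le> 0"
proof -
  define Z where "Z = (8 / (1 - \<sigma>)) powr (1 / \<sigma>)"
  have "8 / (1 - \<sigma>) \<ge> 8" using s by (simp add: field_simps)
  have Zs: "Z powr \<sigma> = 8 / (1 - \<sigma>)" using s unfolding Z_def by (simp add: powr_powr)
  have Z1: "Z \<ge> 1"
    unfolding Z_def using powr_mono2[of "1/\<sigma>" 1 "8 / (1 - \<sigma>)"] \<open>8 / (1 - \<sigma>) \<ge> 8\<close> s by simp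
  define L where "L = Z * X"
  have L: "L \<ge> X" "L \<ge> 1" using X Z1 mult_mono[of 1 Z 1 X] mult_right_mono[of 1 Z X] by (auto simp: L_def)
  \<comment> \<open>Nondecreasing, because \<open>1 + y \<le> 2 jap y\<close> gives
    \<open>a(y) \<le> 2 (1 + y)^(-\<sigma>)\<close>; comparing \<open>F L\<close> with
    \<open>F 0 \<ge> 0\<close> bounds the integral of \<open>a\<close>.\<close>
  define F where "F y = 2 / (1 - \<sigma>) * (1 + y) powr (1 - \<sigma>) + jint \<sigma> (- y)" for y
  have "F 0 \<le> F L"
  proof (rule DERIV_nonneg_imp_nondecreasing[where f = F])
    fix y :: real assume y: "0 \<le> y" "y \<le> L"
    have d1: "((\<lambda>y. (1 + y) powr (1 - \<sigma>)) has_real_derivative (1 - \<sigma>) * (1 + y) powr (1 - \<sigma> - 1)) (at y)"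
      using y by (auto intro!: derivative_eq_intros)
    have d2: "((\<lambda>y. jint \<sigma> (- y)) has_real_derivative jap (- y) powr (- \<sigma>) * (- 1)) (at y)"
      by (rule DERIV_chain2[OF jint(1)]) (auto intro!: derivative_eq_intros)
    have d: "(F has_real_derivative 2 / (1 - \<sigma>) * ((1 - \<sigma>) * (1 + y) powr (1 - \<sigma> - 1)) + jap (- y) powr (- \<sigma>) * (- 1)) (at y)"
      unfolding F_def by (intro DERIV_add DERIV_cmult d1 d2)
    have "jap (- y) powr (- \<sigma>) \<le> ((1 + y) / 2) powr (- \<sigma>)"
      using s y jap_ge[of "- y"] jap_ge_1[of "- y"] by (intro powr_mono2') auto
    also have "\<dots> = 2 powr \<sigma> * (1 + y) powr (- \<sigma>)"
      using y by (simp add: powr_divide powr_minus_divide)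
    also have "\<dots> \<le> 2 * (1 + y) powr (- \<sigma>)"
      using s powr_mono[of \<sigma> 1 2] by (intro mult_right_mono) auto
    finally have "0 \<le> 2 / (1 - \<sigma>) * ((1 - \<sigma>) * (1 + y) powr (1 - \<sigma> - 1)) + jap (- y) powr (- \<sigma>) * (- 1)"
      using s by simp
    with d show "\<exists>d. (F has_real_derivative d) (at y) \<and> 0 \<le> d" by blast
  qed (use L in auto)
  moreover have "F 0 \<ge> 0" unfolding F_def using s by (simp add: jint)
  ultimately have j: "- jint \<sigma> (- L) \<le> 2 / (1 - \<sigma>) * (1 + L) powr (1 - \<sigma>)" unfolding F_def by simp
  have "(1 + L) powr (1 - \<sigma>) \<le> (2 * L) powr (1 - \<sigma>)" using L s by (intro powr_mono2) auto
  also have "\<dots> = 2 powr (1 - \<sigma>) * L powr (1 - \<sigma>)" using L by (simp add: powr_mult)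
  also have "\<dots> = 2 powr (1 - \<sigma>) * (L * L powr (- \<sigma>))"
    using L powr_add[of L 1 "-\<sigma>"] by simp
  finally have p: "(1 + L) powr (1 - \<sigma>) \<le> 2 powr (1 - \<sigma>) * (L * L powr (- \<sigma>))" .
  have "(2 * X) powr (- \<sigma>) \<le> jap X powr (- \<sigma>)"
    using X s jap_le[of X] jap_pos[of X] by (intro powr_mono2') auto
  then have k: "2 powr (- \<sigma>) * X powr (- \<sigma>) \<le> jap X powr (- \<sigma>)" using X by (simp add: powr_mult)
  have "2 * Phi \<sigma> X (- L) = - (jap X powr (- \<sigma>)) * L - jint \<sigma> (- L)"
    unfolding Phi_def by simp
  also have "\<dots> \<le> - (2 powr (- \<sigma>) * X powr (- \<sigma>)) * L + 2 / (1 - \<sigma>) * (2 powr (1 - \<sigma>) * (L * L powr (- \<sigma>)))"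
  proof -
    have "2 powr (- \<sigma>) * X powr (- \<sigma>) * L \<le> jap X powr (- \<sigma>) * L" using k L by (intro mult_right_mono) auto
    moreover have "2 / (1 - \<sigma>) * (1 + L) powr (1 - \<sigma>) \<le> 2 / (1 - \<sigma>) * (2 powr (1 - \<sigma>) * (L * L powr (- \<sigma>)))"
      using p s by (intro mult_left_mono) auto
    ultimately show ?thesis using j unfolding mult_minus_left by linarith
  qed
  also have "L powr (- \<sigma>) = (1 - \<sigma>) / 8 * X powr (- \<sigma>)"
    unfolding L_def using X Z1 Zs s by (simp add: powr_mult powr_minus field_simps)
  also have "2 powr (1 - \<sigma>) = 2 * 2 powr (- \<sigma>)" using powr_add[of 2 1 "-\<sigma>"] by simp
  also have "- (2 powr (- \<sigma>) * X powr (- \<sigma>)) * L + 2 / (1 - \<sigma>) * (2 * 2 powr (- \<sigma>) * (L * ((1 - \<sigma>) / 8 * X powr (- \<sigma>))))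
      = - (2 powr (- \<sigma>) * X powr (- \<sigma>)) * L / 2"
    using s by (simp add: field_simps)
  also have "\<dots> \<le> 0" using L by simp
  finally have "Phi \<sigma> X (- L) \<le> 0" by simp
  moreover have "Phi \<sigma> X x \<le> Phi \<sigma> X (- L)"
    using x L X s by (intro Phi_mono_left) (auto simp: L_def Z_def)
  ultimately show ?thesis by linarith
qed

section \<open>The quasimode\<close>

lemma Dfun_local:
  assumes g: "smooth g" and S: "open S" and eq: "\<And>y. y \<in> S \<Longrightarrow> f y = g y" and x: "x \<in> S"
  shows "Dfun f x = Dfun g x" "Dfun (Dfun f) x = Dfun (Dfun g) x"
proof -
  have loc: "Dfun f x = Dfun g x" if "smooth g" "\<And>y. y \<in> S \<Longrightarrow> f y = g y" "x \<in> S" for f g x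
  proof -
    have "(f has_vector_derivative Dfun g x) (at x)"
      by (rule has_vector_derivative_transform_within_open[OF smooth_vd[OF that(1)] S that(3)]) (simp add: that(2))
    then show ?thesis unfolding Dfun_def[of f] by (rule vector_derivative_at)
  qed
  have 1: "Dfun f y = Dfun g y" if "y \<in> S" for y by (rule loc[OF g eq that])
  show "Dfun f x = Dfun g x" by (rule 1[OF x])
  show "Dfun (Dfun f) x = Dfun (Dfun g) x" by (rule loc[OF smooth_Dfun[OF g] 1 x])
qed

lemma Dfun_shift:
  assumes "smooth f" shows "Dfun (\<lambda>x. f (1 * x + b)) = (\<lambda>x. Dfun f (1 * x + b))"
  by (rule Dfun_eqI) (use affine_vd[OF smooth_vd[OF assms], of 1 b] in simp)

text \<open>The constant must not depend on \<open>L\<close>. Near its left end the cutoff is a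
  translate of \<open>plateau 0 1\<close>, near its right end it coincides with
  \<open>plateau (- 1) 0\<close>, and \<open>L \<ge> 2\<close> keeps the two transitions
  apart.\<close>

lemma cutoff_bounds:
  "\<exists>C\<ge>0. \<forall>L\<ge>2. \<forall>x. let \<eta> = (\<lambda>x. complex_of_real (plateau (- L) 0 x)) in
     cmod (Dfun \<eta> x) \<le> C \<and> cmod (Dfun (Dfun \<eta>) x) \<le> C \<and>
     (x \<notin> {- L - 1..- L} \<union> {0..1} \<longrightarrow> Dfun \<eta> x = 0 \<and> Dfun (Dfun \<eta>) x = 0)"
proof -
  let ?p = "\<lambda>a b x. complex_of_real (plateau a b x)"
  have "\<exists>B. \<forall>x. cmod (f x) \<le> B" if "f \<in> schwartz" for f
    using schwartz_le_seminorm[OF that] by blast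
  then obtain B where B: "\<And>f x. f \<in> schwartz \<Longrightarrow> cmod (f x) \<le> B f" by metis
  have S: "?p a b \<in> schwartz" for a b by (rule test_fun_schwartz[OF test_fun_plateau])
  define C where "C = Max {0, B (Dfun (?p 0 1)), B (Dfun (Dfun (?p 0 1))), B (Dfun (?p (-1) 0)), B (Dfun (Dfun (?p (-1) 0)))}"
  have C: "0 \<le> C" "B (Dfun (?p 0 1)) \<le> C" "B (Dfun (Dfun (?p 0 1))) \<le> C" "B (Dfun (?p (-1) 0)) \<le> C" "B (Dfun (Dfun (?p (-1) 0))) \<le> C"
    unfolding C_def by (intro Max_ge; simp)+
  have main: "cmod (Dfun (?p (- L) 0) x) \<le> C \<and> cmod (Dfun (Dfun (?p (- L) 0)) x) \<le> C \<and>
     (x \<notin> {- L - 1..- L} \<union> {0..1} \<longrightarrow> Dfun (?p (- L) 0) x = 0 \<and> Dfun (Dfun (?p (- L) 0)) x = 0)" if L: "L \<ge> 2" for L x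
  proof -
    have const: "Dfun (?p (- L) 0) x = 0 \<and> Dfun (Dfun (?p (- L) 0)) x = 0"
      if "open A" "x \<in> A" "\<And>y. y \<in> A \<Longrightarrow> plateau (- L) 0 y = c" for A c
      using Dfun_local[OF smooth_const[of "complex_of_real c"] that(1) _ that(2), of "?p (- L) 0"] that(3)
      by (simp add: Dfun_const)
    have mid: "Dfun (?p (- L) 0) x = 0 \<and> Dfun (Dfun (?p (- L) 0)) x = 0" if "x \<in> {- L<..<0}"
      by (rule const[OF _ that, of 1]) (auto intro: plateau_1)
    have left: "Dfun (?p (- L) 0) x = 0 \<and> Dfun (Dfun (?p (- L) 0)) x = 0" if "x \<in> {..<- L - 1}"
      by (rule const[OF _ that, of 0]) (auto intro: plateau_0)
    have right: "Dfun (?p (- L) 0) x = 0 \<and> Dfun (Dfun (?p (- L) 0)) x = 0" if "x \<in> {1<..}"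
      by (rule const[OF _ that, of 0]) (auto intro: plateau_0)
    have vanish: "x \<notin> {- L - 1..- L} \<union> {0..1} \<longrightarrow> Dfun (?p (- L) 0) x = 0 \<and> Dfun (Dfun (?p (- L) 0)) x = 0"
      using mid left right by fastforce
    have "cmod (Dfun (?p (- L) 0) x) \<le> C \<and> cmod (Dfun (Dfun (?p (- L) 0)) x) \<le> C"
    proof -
      consider "x \<in> {..<1 - L}" | "x \<in> {- L<..<0}" | "x \<in> {-1<..}" by fastforce
      then show ?thesis
      proof cases
        case 1
        have e: "?p (- L) 0 y = ?p 0 1 (1 * y + L)" if "y \<in> {..<1 - L}" for y
        proof -
          have "step (0 + 1 - y) = 1" "step (1 + 1 - (1 * y + L)) = 1" using that L by (auto intro!: step_1)
          then show ?thesis unfolding plateau_def by (simp add: algebra_simps)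
        qed
        have "smooth (\<lambda>y. ?p 0 1 (1 * y + L))" by (rule smooth_affine[OF smooth_plateau])
        from Dfun_local[OF this _ e 1]
        have "Dfun (?p (- L) 0) x = Dfun (?p 0 1) (1 * x + L)" "Dfun (Dfun (?p (- L) 0)) x = Dfun (Dfun (?p 0 1)) (1 * x + L)"
          unfolding Dfun_shift[OF smooth_plateau] Dfun_shift[OF smooth_Dfun[OF smooth_plateau]] by simp_all
        then show ?thesis
          using order_trans[OF B C(2), of "1 * x + L"] order_trans[OF B C(3), of "1 * x + L"] S schwartz_Dfun by metis
      next
        case 2 then show ?thesis using mid C(1) by simp
      next
        case 3
        have e: "?p (- L) 0 y = ?p (-1) 0 y" if "y \<in> {-1<..}" for y
        proof -
          have "step (y - (- L) + 1) = 1" "step (y - (- 1) + 1) = 1" using that L by (auto intro!: step_1)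
          then show ?thesis unfolding plateau_def by simp
        qed
        from Dfun_local[OF smooth_plateau _ e 3]
        have "Dfun (?p (- L) 0) x = Dfun (?p (-1) 0) x" "Dfun (Dfun (?p (- L) 0)) x = Dfun (Dfun (?p (-1) 0)) x"
          by simp_all
        then show ?thesis
          using order_trans[OF B C(4), of x] order_trans[OF B C(5), of x] S schwartz_Dfun by metis
      qed
    qed
    then show ?thesis using vanish by blast
  qed
  show ?thesis unfolding Let_def using C(1) main by blast
qed

lemma jap_powr_deriv_le_1:
  assumes "0 < \<sigma>" "\<sigma> < 1"
  shows "cmod ((complex_of_real (- \<sigma>) * complex_of_real x) * complex_of_real (jap x powr (- \<sigma> - 2))) \<le> 1"
proof -
  have "cmod ((complex_of_real (- \<sigma>) * complex_of_real x) * complex_of_real (jap x powr (- \<sigma> - 2))) = \<sigma> * \<bar>x\<bar> * jap x powr (- \<sigma> - 2)"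
    using assms by (simp add: norm_mult)
  also have "\<dots> \<le> 1 * jap x * jap x powr (- \<sigma> - 2)"
    using assms jap_ge[of x] jap_pos[of x] by (intro mult_right_mono mult_mono) auto
  also have "\<dots> = jap x powr (- (1 + \<sigma>))" using jap_pos[of x] powr_add[of "jap x" 1 "- \<sigma> - 2"] by simp
  also have "\<dots> \<le> 1" using assms by (intro jap_powr_le_1) auto
  finally show ?thesis .
qed

text \<open>The pairing involves no complex conjugation, so the phase with \<open>+ \<nu>\<close>
  cancels the factor \<open>exp (- i \<nu> x)\<close> of the quasimode; the Gaussian has width
  \<open>Y\<close> around the maximum at \<open>- X\<close>.\<close>

definition packet :: "real \<Rightarrow> real \<Rightarrow> real \<Rightarrow> real \<Rightarrow> complex" where
  "packet \<nu> X Y = (\<lambda>x. cis (\<nu> * x) * gauss (1 / Y) (1 * x + X))"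

text \<open>\<open>\<psi>\<close> has size \<open>B = exp (Phi \<sigma> X (- X))\<close> while the
  bound on the defect \<open>R\<close> carries no factor \<open>B\<close>. The last clause says that
  the packet detects a mass comparable to \<open>Y B\<close>. \<open>N\<close> and \<open>C\<close>
  are to be independent of \<open>X\<close>.\<close>

definition is_quasimode ::
  "real \<Rightarrow> real \<Rightarrow> real \<Rightarrow> real \<Rightarrow> (real \<Rightarrow> complex) \<Rightarrow> (real \<Rightarrow> complex) \<Rightarrow> bool" where
  "is_quasimode \<sigma> N C X \<psi> R \<longleftrightarrow> \<psi> \<in> schwartz \<and> R \<in> schwartz \<and>
     (\<forall>x. Dfun (Dfun \<psi>) x + Dfun (\<lambda>x. complex_of_real (jap x powr (- \<sigma>)) * \<psi> x) x
        = - ((Complex (N * X) (jap X powr (- \<sigma>) / 2))\<^sup>2 * \<psi> x) - R x) \<and>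
     (LINT x|lborel. cmod (\<psi> x)) \<le> C * X * exp (Phi \<sigma> X (- X)) \<and>
     (LINT x|lborel. cmod (R x)) \<le> C * X \<and>
     (\<forall>Y>0. Y\<^sup>2 = X powr (1 + \<sigma>) \<longrightarrow> Y \<le> X \<longrightarrow>
        1 / 5 * Y * exp (Phi \<sigma> X (- X)) \<le> Re (LINT x|lborel. packet (N * X) X Y x * \<psi> x))"

lemma quasimode:
  assumes s: "0 < \<sigma>" "\<sigma> < 1"
  shows "\<exists>N\<ge>1. \<exists>C>0. \<forall>X\<ge>4. \<exists>\<psi> R. is_quasimode \<sigma> N C X \<psi> R"
proof -
  define Z where "Z = (8 / (1 - \<sigma>)) powr (1 / \<sigma>)"
  have "8 / (1 - \<sigma>) \<ge> 8" using s by (simp add: field_simps)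
  then have Z8: "Z \<ge> 8"
    unfolding Z_def using powr_mono[of 1 "1/\<sigma>" "8 / (1 - \<sigma>)"] s by simp
  obtain B where B0: "B \<ge> 0" and B: "\<And>L x. L \<ge> 2 \<Longrightarrow> cmod (Dfun (\<lambda>x. complex_of_real (plateau (- L) 0 x)) x) \<le> B"
    "\<And>L x. L \<ge> 2 \<Longrightarrow> cmod (Dfun (Dfun (\<lambda>x. complex_of_real (plateau (- L) 0 x))) x) \<le> B"
    "\<And>L x. L \<ge> 2 \<Longrightarrow> x \<notin> {- L - 1..- L} \<union> {0..1} \<Longrightarrow> Dfun (\<lambda>x. complex_of_real (plateau (- L) 0 x)) x = 0 \<and>
       Dfun (Dfun (\<lambda>x. complex_of_real (plateau (- L) 0 x))) x = 0"
    using cutoff_bounds unfolding Let_def by blast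
  \<comment> \<open>Ensures \<open>\<nu> = N X \<ge> 4 (L + 4)\<close> for \<open>X \<ge> 4\<close>,
    the contraction threshold for the window \<open>[- L - 2, 2]\<close>.\<close>
  define N where "N = 4 * (Z + 1)"
  \<comment> \<open>The first summand serves the L1 norm of \<open>\<psi>\<close>, the second that
    of \<open>R\<close>.\<close>
  define C where "C = 8 * (Z + 2) + 2 * B * (8 * N + 8)"
  have N1: "N \<ge> 1" using Z8 by (simp add: N_def)
  have C0: "C > 0" unfolding C_def using Z8 B0 N1 by (intro add_pos_nonneg mult_nonneg_nonneg) auto
  have main: "\<exists>\<psi> R. is_quasimode \<sigma> N C X \<psi> R" if X: "X \<ge> 4" for X
  proof -
    define \<kappa> where "\<kappa> = jap X powr (- \<sigma>) / 2"
    define \<nu> where "\<nu> = N * X"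
    define k where "k = Complex \<nu> \<kappa>"
    define L where "L = Z * X"
    have L: "L \<ge> 8 * X" unfolding L_def using Z8 X by (intro mult_right_mono) auto
    have \<kappa>: "0 \<le> \<kappa>" "\<kappa> \<le> 1 / 2" using jap_powr_le_1[of \<sigma> X] s by (auto simp: \<kappa>_def)
    have \<nu>: "\<nu> \<ge> 4 * (L + 4)" "\<nu> \<ge> 1"
      using X mult_mono[of 1 N 1 X] N1 by (auto simp: \<nu>_def N_def L_def algebra_simps)
    have k: "Im k \<ge> 0" "cmod k \<ge> \<nu>" "cmod k \<le> \<nu> + 1 / 2"
    proof -
      show "Im k \<ge> 0" using \<kappa> by (simp add: k_def)
      show "cmod k \<ge> \<nu>" using abs_Re_le_cmod[of k] by (simp add: k_def)
      show "cmod k \<le> \<nu> + 1 / 2" using cmod_le[of k] \<nu> \<kappa> by (simp add: k_def)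
    qed
    let ?a = "\<lambda>x. complex_of_real (jap x powr (- \<sigma>))"
    let ?b = "\<lambda>x. (complex_of_real (- \<sigma>) * complex_of_real x) * complex_of_real (jap x powr (- \<sigma> - 2))"
    have a1: "cmod (?a x) \<le> 1" for x using jap_powr_le_1[of \<sigma> x] s by simp
    have b1: "cmod (?b x) \<le> 1" for x by (rule jap_powr_deriv_le_1[OF s])
    \<comment> \<open>The potential \<open>a' / 2 - a^2 / 4\<close> left by the conjugation, of
      modulus at most 3/4.\<close>
    define V where "V x = 1 / 2 * ?b x + (- 1 / 4) * (?a x * ?a x)" for x
    have Vs: "smooth V" unfolding V_def
      by (intro smooth_add smooth_mult smooth_const slow_smooth[OF slow_jap] slow_smooth[OF slow_jap_deriv])
    have V1: "cmod (V x) \<le> 1" for x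
    proof -
      have "cmod (V x) \<le> 1 / 2 * cmod (?b x) + 1 / 4 * (cmod (?a x) * cmod (?a x))"
        unfolding V_def by (rule order_trans[OF norm_triangle_ineq]) (simp add: norm_mult)
      also have "\<dots> \<le> 1 / 2 * 1 + 1 / 4 * (1 * 1)"
        by (intro add_mono mult_left_mono mult_mono a1 b1) auto
      finally show ?thesis by simp
    qed
    \<comment> \<open>Truncated so as to live in the window, yet equal to \<open>V\<close> on
      \<open>[- L - 1, 1]\<close>, which contains the support of the cutoff
      \<open>plateau (- L) 0\<close>.\<close>
    define U where "U x = V x * complex_of_real (plateau (- L - 1) 1 x)" for x
    have Us: "smooth U" unfolding U_def by (intro smooth_mult Vs smooth_plateau)
    have "\<exists>m n. (\<forall>x. (m has_vector_derivative n x) (at x)) \<and>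
     (\<forall>x. (n has_vector_derivative 2 * \<i> * k * n x - U x * m x) (at x)) \<and>
     (\<forall>x. cmod (m x - 1) \<le> 1 / 3) \<and> (\<forall>x. cmod (n x) \<le> (4 / 3) * (2 - (- L - 2)))"
    proof (rule jost_solution)
      show "continuous_on UNIV U" by (rule smooth_continuous[OF Us])
      show "cmod (U x) \<le> 1" for x
        unfolding U_def norm_mult using V1[of x] plateau_bounds[of "- L - 1" 1 x] by (intro mult_le_one) auto
      show "U x = 0" if "x \<le> - L - 2 \<or> x \<ge> 2" for x
        unfolding U_def using plateau_0[of x "- L - 1" 1] that by auto
    qed (use L X k \<nu> in auto)
    then obtain m n where mn: "\<And>x. (m has_vector_derivative n x) (at x)"
       "\<And>x. (n has_vector_derivative 2 * \<i> * k * n x - U x * m x) (at x)"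
       and m1: "\<And>x. cmod (m x - 1) \<le> 1 / 3" and n1: "\<And>x. cmod (n x) \<le> (4 / 3) * (2 - (- L - 2))"
      by blast
    have mns: "smooth m" "smooth n" using smooth_system[OF mn Us] by auto
    have m43: "cmod (m x) \<le> 4 / 3" for x
    proof -
      have "cmod (m x) \<le> cmod (m x - 1) + cmod 1" by (metis diff_add_cancel norm_triangle_ineq)
      then show ?thesis using m1[of x] by simp
    qed
    have mRe: "Re (m x) \<ge> 2 / 3" for x
      using abs_Re_le_cmod[of "m x - 1"] m1[of x] by simp
    have nk: "cmod (n x) \<le> \<nu>" for x using n1[of x] \<nu> L X by simp
    \<comment> \<open>Logarithmic derivative of \<open>E\<close>. This form shows the derivative of
      \<open>Phi\<close> as its real part; the next fact gives the form \<open>- a / 2 - i k\<close>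
      for the algebra.\<close>
    define c where "c x = complex_of_real ((jap X powr (- \<sigma>) - jap x powr (- \<sigma>)) / 2) - \<i> * complex_of_real \<nu>" for x
    have c: "c x = - ?a x / 2 - \<i> * k" for x
      unfolding c_def k_def \<kappa>_def by (simp add: complex_eq_iff diff_divide_distrib)
    define E where "E x = exp (complex_of_real (Phi \<sigma> X x) - \<i> * complex_of_real \<nu> * complex_of_real x)" for x
    have hvd: "((\<lambda>x. complex_of_real (Phi \<sigma> X x) - \<i> * complex_of_real \<nu> * complex_of_real x) has_vector_derivative c x) (at x)" for x
      unfolding c_def by (intro has_vector_derivative_diff has_vector_derivative_of_real Phi_deriv linear_vd)
    have Evd: "(E has_vector_derivative c x * E x) (at x)" for x
      unfolding E_def by (rule exp_vd[OF hvd])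
    have cs: "smooth c"
    proof -
      have "smooth (\<lambda>x. - 1 / 2 * ?a x + (- \<i> * k))" by (intro smooth_add smooth_mult smooth_const slow_smooth[OF slow_jap])
      moreover have "(\<lambda>x. - 1 / 2 * ?a x + (- \<i> * k)) = c" unfolding c by (rule ext) simp
      ultimately show ?thesis by simp
    qed
    have Es: "smooth E" by (rule smooth_linear_ode[OF Evd cs])
    have cE: "cmod (E x) = exp (Phi \<sigma> X x)" for x unfolding E_def by simp
    have cvd: "(c has_vector_derivative - ?b x / 2) (at x)" for x
    proof -
      have "((\<lambda>x. - ?a x / 2 - \<i> * k) has_vector_derivative - ?b x / 2 - 0) (at x)"
        by (intro has_vector_derivative_diff has_vector_derivative_const has_vector_derivative_divide has_vector_derivative_minus jap_powr_vd)
      moreover have "(\<lambda>x. - ?a x / 2 - \<i> * k) = c" unfolding c by simp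
      ultimately show ?thesis by simp
    qed
    define \<phi> where "\<phi> x = E x * m x" for x
    define \<phi>1 where "\<phi>1 x = E x * n x + c x * \<phi> x" for x
    define \<phi>2 where "\<phi>2 x = (E x * (2 * \<i> * k * n x - U x * m x) + (c x * E x) * n x) + (c x * \<phi>1 x + (- ?b x / 2) * \<phi> x)" for x
    have \<phi>vd: "(\<phi> has_vector_derivative \<phi>1 x) (at x)" for x
      using has_vector_derivative_mult[OF Evd mn(1), of x] unfolding \<phi>_def \<phi>1_def by (simp add: mult.assoc)
    have \<phi>1vd: "(\<phi>1 has_vector_derivative \<phi>2 x) (at x)" for x
      unfolding \<phi>1_def \<phi>2_def[unfolded \<phi>1_def]
      by (intro has_vector_derivative_add has_vector_derivative_mult Evd mn(2) cvd \<phi>vd[unfolded \<phi>1_def])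
    have \<phi>s: "smooth \<phi>" unfolding \<phi>_def by (intro smooth_mult Es mns)
    let ?\<eta> = "\<lambda>x. complex_of_real (plateau (- L) 0 x)"
    have \<eta>s: "smooth ?\<eta>" by (rule smooth_plateau)
    have \<eta>vd: "(?\<eta> has_vector_derivative Dfun ?\<eta> x) (at x)" "(Dfun ?\<eta> has_vector_derivative Dfun (Dfun ?\<eta>) x) (at x)" for x
      by (intro smooth_vd smooth_Dfun \<eta>s)+
    define \<psi> where "\<psi> x = \<phi> x * ?\<eta> x" for x
    have \<psi>T: "\<psi> \<in> schwartz" unfolding \<psi>_def by (intro test_fun_schwartz test_fun_mult \<phi>s test_fun_plateau)
    have D1: "Dfun \<psi> = (\<lambda>x. \<phi> x * Dfun ?\<eta> x + \<phi>1 x * ?\<eta> x)"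
      unfolding \<psi>_def by (intro Dfun_eqI has_vector_derivative_mult \<phi>vd \<eta>vd)
    have D2: "Dfun (Dfun \<psi>) = (\<lambda>x. (\<phi> x * Dfun (Dfun ?\<eta>) x + \<phi>1 x * Dfun ?\<eta> x) + (\<phi>1 x * Dfun ?\<eta> x + \<phi>2 x * ?\<eta> x))"
      unfolding D1 by (intro Dfun_eqI has_vector_derivative_add has_vector_derivative_mult \<phi>vd \<phi>1vd \<eta>vd)
    have D3: "Dfun (\<lambda>x. ?a x * \<psi> x) = (\<lambda>x. ?a x * (\<phi> x * Dfun ?\<eta> x + \<phi>1 x * ?\<eta> x) + ?b x * \<psi> x)"
      unfolding \<psi>_def by (intro Dfun_eqI has_vector_derivative_mult \<phi>vd \<eta>vd jap_powr_vd)
    \<comment> \<open>Defined by the equation itself, so that it is Schwartz at once; its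
      localisation is derived below.\<close>
    define R where "R x = (- (k\<^sup>2)) * \<psi> x + (- 1) * (Dfun (Dfun \<psi>) x + Dfun (\<lambda>x. ?a x * \<psi> x) x)" for x
    have RT: "R \<in> schwartz" unfolding R_def
      by (intro schwartz_add schwartz_cmult schwartz_Dfun \<psi>T schwartz_mult slow_jap)
    \<comment> \<open>\<open>\<phi>\<close> solves the equation up to \<open>E m (V - U)\<close>,
      which vanishes on the support of the cutoff.\<close>
    have zero: "?\<eta> x * (\<phi>2 x + ?a x * \<phi>1 x + ?b x * \<phi> x + k\<^sup>2 * \<phi> x) = 0" for x
    proof -
      have "\<phi>2 x + ?a x * \<phi>1 x + ?b x * \<phi> x + k\<^sup>2 * \<phi> x = E x * m x * (V x - U x)"
      proof -
        have alg: "(e * (2 * \<i> * k * n - u * m) + (c * e) * n) + (c * (e * n + c * (e * m)) + (- b / 2) * (e * m)) + a * (e * n + c * (e * m)) + b * (e * m) + k\<^sup>2 * (e * m)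
           = e * m * ((1 / 2 * b + (- 1 / 4) * (a * a)) - u)" if "c = - a / 2 - \<i> * k" for e n u m c b a :: complex
          unfolding that by (simp add: field_simps power2_eq_square)
        show ?thesis unfolding \<phi>2_def \<phi>1_def \<phi>_def V_def by (rule alg[OF c])
      qed
      moreover have "?\<eta> x * (V x - U x) = 0"
      proof (cases "x \<le> - L - 1 \<or> x \<ge> 0 + 1")
        case True then show ?thesis by (simp add: plateau_0)
      next
        case False then show ?thesis unfolding U_def by (simp add: plateau_1)
      qed
      ultimately show ?thesis by (simp add: mult.left_commute)
    qed
    \<comment> \<open>Only terms containing a derivative of the cutoff survive, so \<open>R\<close>
      lives on the two transition intervals.\<close>
    have Req: "R x = - (\<phi> x * Dfun (Dfun ?\<eta>) x + 2 * (\<phi>1 x * Dfun ?\<eta> x) + ?a x * (\<phi> x * Dfun ?\<eta> x))" for x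
    proof -
      have "R x = - (\<phi> x * Dfun (Dfun ?\<eta>) x + 2 * (\<phi>1 x * Dfun ?\<eta> x) + ?a x * (\<phi> x * Dfun ?\<eta> x))
        - ?\<eta> x * (\<phi>2 x + ?a x * \<phi>1 x + ?b x * \<phi> x + k\<^sup>2 * \<phi> x)"
        unfolding R_def D2 D3 unfolding \<psi>_def by (simp add: algebra_simps)
      then show ?thesis unfolding zero by simp
    qed
    have L2: "L \<ge> 2" using L X by simp
    have \<phi>b: "cmod (\<phi> x) \<le> 4 / 3 * exp (Phi \<sigma> X x)" for x
      unfolding \<phi>_def norm_mult cE using mult_left_mono[OF m43, of "exp (Phi \<sigma> X x)" x] by (simp add: mult.commute)
    have cb: "cmod (c x) \<le> \<nu> + 1" for x
    proof -
      have "cmod (c x) \<le> cmod (?a x) / 2 + cmod k"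
        unfolding c using norm_triangle_ineq4[of "- ?a x / 2" "\<i> * k"] by (simp add: norm_divide norm_mult)
      then show ?thesis using a1[of x] k by linarith
    qed
    have \<phi>1b: "cmod (\<phi>1 x) \<le> (\<nu> + 4 / 3 * (\<nu> + 1)) * exp (Phi \<sigma> X x)" for x
    proof -
      have "cmod (\<phi>1 x) \<le> cmod (E x) * cmod (n x) + cmod (c x) * cmod (\<phi> x)"
        unfolding \<phi>1_def by (metis norm_triangle_ineq norm_mult)
      also have "\<dots> \<le> exp (Phi \<sigma> X x) * \<nu> + (\<nu> + 1) * (4 / 3 * exp (Phi \<sigma> X x))"
        unfolding cE by (intro add_mono mult_mono nk cb \<phi>b) (use \<nu> in auto)
      finally show ?thesis by (simp add: algebra_simps)
    qed
    let ?I = "\<lambda>x. indicator {- L - 1..- L} x + indicator {0..1} x :: real"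
    have Rb: "cmod (R x) \<le> B * (8 * \<nu> + 8) * ?I x" for x
    proof (cases "x \<in> {- L - 1..- L} \<union> {0..1}")
      case False
      then show ?thesis unfolding Req using B(3)[OF L2 False] by simp
    next
      case True
      \<comment> \<open>On the left transition this is the choice of \<open>L\<close>; on the right
        one \<open>Phi\<close> decreases from its value 0 at the origin.\<close>
      have "Phi \<sigma> X x \<le> 0"
      proof (cases "x \<le> - L")
        case True then show ?thesis using X by (intro Phi_far_le_0 s) (auto simp: L_def Z_def)
      next
        case False
        then have "0 \<le> x" "x \<le> 1" using \<open>x \<in> {- L - 1..- L} \<union> {0..1}\<close> by auto
        then show ?thesis using Phi_antimono[of \<sigma> 0 x X] s X by (simp add: Phi_0)
      qed
      then have e1: "exp (Phi \<sigma> X x) \<le> 1" by simp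
      have p0: "cmod (\<phi> x) \<le> 4 / 3" using order_trans[OF \<phi>b mult_left_mono[OF e1]] by simp
      have p1: "cmod (\<phi>1 x) \<le> \<nu> + 4 / 3 * (\<nu> + 1)" using order_trans[OF \<phi>1b mult_left_mono[OF e1]] \<nu> by simp
      have "cmod (R x) \<le> cmod (\<phi> x) * cmod (Dfun (Dfun ?\<eta>) x) + 2 * (cmod (\<phi>1 x) * cmod (Dfun ?\<eta> x)) + cmod (?a x) * (cmod (\<phi> x) * cmod (Dfun ?\<eta> x))"
        unfolding Req norm_minus_cancel by (rule order_trans[OF norm_triangle_le[OF add_mono[OF norm_triangle_ineq order_refl]]]) (simp_all add: norm_mult)
      also have "\<dots> \<le> 4 / 3 * B + 2 * ((\<nu> + 4 / 3 * (\<nu> + 1)) * B) + 1 * (4 / 3 * B)"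
        by (intro add_mono mult_mono mult_left_mono p0 p1 a1 B L2) (use \<nu> B0 in auto)
      also have "\<dots> = B * (14 / 3 * \<nu> + 16 / 3)" by (simp add: field_simps)
      also have "\<dots> \<le> B * (8 * \<nu> + 8)" using B0 \<nu> by (intro mult_left_mono) auto
      also have "\<dots> \<le> B * (8 * \<nu> + 8) * ?I x"
      proof -
        have "?I x \<ge> 1" using True by (auto simp: indicator_def)
        then show ?thesis using mult_left_mono[of 1 "?I x" "B * (8 * \<nu> + 8)"] B0 \<nu> by simp
      qed
      finally show ?thesis .
    qed
    have iI: "integrable lborel (indicator {u..v} :: real \<Rightarrow> real)" for u v :: real
      by (rule integrable_real_indicator) (auto simp: emeasure_lborel_Icc_eq)
    have II: "(LINT x|lborel. indicator {u..v} x :: real) = v - u" if "u \<le> v" for u v :: real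
      using that by (simp add: measure_def emeasure_lborel_Icc)
    have Rint: "(LINT x|lborel. cmod (R x)) \<le> C * X"
    proof -
      have "(LINT x|lborel. cmod (R x)) \<le> (LINT x|lborel. B * (8 * \<nu> + 8) * ?I x)"
        by (intro integral_mono integrable_norm schwartz_integrable RT Rb integrable_mult_right Bochner_Integration.integrable_add iI)
      also have "\<dots> = B * (8 * \<nu> + 8) * (LINT x|lborel. ?I x)" by simp
      also have "(LINT x|lborel. ?I x) = 2"
        by (subst Bochner_Integration.integral_add[OF iI iI]) (use II[of "- L - 1" "- L"] II[of 0 1] in simp)
      also have "B * (8 * \<nu> + 8) * 2 \<le> (2 * B * (8 * N + 8)) * X"
      proof -
        have "8 * \<nu> + 8 \<le> (8 * N + 8) * X" using X by (simp add: \<nu>_def algebra_simps)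
        then have "2 * B * (8 * \<nu> + 8) \<le> 2 * B * ((8 * N + 8) * X)" using B0 by (intro mult_left_mono) auto
        then show ?thesis by (simp add: mult_ac)
      qed
      also have "\<dots> \<le> C * X" unfolding C_def using X Z8 B0 N1 by (intro mult_right_mono) auto
      finally show ?thesis .
    qed
    have \<psi>int: "(LINT x|lborel. cmod (\<psi> x)) \<le> C * X * exp (Phi \<sigma> X (- X))"
    proof -
      have pb: "cmod (\<psi> x) \<le> (4 / 3 * exp (Phi \<sigma> X (- X))) * indicator {- L - 1..1} x" for x
      proof (cases "x \<in> {- L - 1..1}")
        case True
        have "exp (Phi \<sigma> X x) \<le> exp (Phi \<sigma> X (- X))" using Phi_le_max[of \<sigma> X x] s X True by simp
        then have "cmod (\<phi> x) \<le> 4 / 3 * exp (Phi \<sigma> X (- X))" using \<phi>b[of x] by linarith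
        then have "cmod (\<psi> x) \<le> (4 / 3 * exp (Phi \<sigma> X (- X))) * 1"
          unfolding \<psi>_def norm_mult using plateau_bounds[of "- L" 0 x] by (intro mult_mono) auto
        then show ?thesis using True by simp
      next
        case False
        then have "plateau (- L) 0 x = 0" by (intro plateau_0) auto
        then show ?thesis using False unfolding \<psi>_def by simp
      qed
      have "(LINT x|lborel. cmod (\<psi> x)) \<le> (LINT x|lborel. (4 / 3 * exp (Phi \<sigma> X (- X))) * indicator {- L - 1..1} x)"
        by (intro integral_mono integrable_norm schwartz_integrable \<psi>T pb integrable_mult_right iI)
      also have "\<dots> = (4 / 3 * exp (Phi \<sigma> X (- X))) * (L + 2)"
        using II[of "- L - 1" 1] L2 by simp
      also have "\<dots> = (4 / 3 * (L + 2)) * exp (Phi \<sigma> X (- X))" by simp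
      also have "\<dots> \<le> (C * X) * exp (Phi \<sigma> X (- X))"
      proof (rule mult_right_mono)
        have "4 / 3 * (L + 2) \<le> 8 * L + 16 * X" using X L by (simp add: field_simps)
        also have "\<dots> = (8 * (Z + 2)) * X" unfolding L_def by (simp add: algebra_simps)
        also have "\<dots> \<le> C * X" unfolding C_def using X B0 N1 by (intro mult_right_mono) auto
        finally show "4 / 3 * (L + 2) \<le> C * X" .
      qed simp
      finally show ?thesis .
    qed
    have low: "1 / 5 * Y * exp (Phi \<sigma> X (- X)) \<le> Re (LINT x|lborel. (cis (N * X * x) * gauss (1 / Y) (1 * x + X)) * \<psi> x)"
      if Y: "Y > 0" "Y\<^sup>2 = X powr (1 + \<sigma>)" "Y \<le> X" for Y
    proof -
      let ?f = "\<lambda>x. (cis (N * X * x) * gauss (1 / Y) (1 * x + X)) * \<psi> x"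
      have gS: "(\<lambda>x. gauss (1 / Y) (1 * x + X)) \<in> schwartz"
        using Y by (intro schwartz_isometry gauss_schwartz) auto
      have fS: "?f \<in> schwartz"
        by (rule schwartz_mult[OF slow_mult[OF slow_cis schwartz_imp_slow[OF gS]] \<psi>T])
      \<comment> \<open>The phases cancel, and with \<open>Re (m x) \<ge> 2/3\<close> the real part
        is nonnegative everywhere; restricting the integral to \<open>[- X - Y, - X]\<close> can
        only decrease it.\<close>
      have fRe: "Re (?f x) = exp (- ((x + X) / Y)\<^sup>2 / 2) * exp (Phi \<sigma> X x) * plateau (- L) 0 x * Re (m x)" for x
      proof -
        have "E x = complex_of_real (exp (Phi \<sigma> X x)) * cis (- (\<nu> * x))"
          unfolding E_def by (simp add: exp_diff exp_of_real[symmetric] cis_conv_exp exp_minus field_simps)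
        then have "?f x = complex_of_real (exp (- ((x + X) / Y)\<^sup>2 / 2) * exp (Phi \<sigma> X x) * plateau (- L) 0 x) * m x * (cis (\<nu> * x) * cis (- (\<nu> * x)))"
          unfolding \<psi>_def \<phi>_def gauss_def \<nu>_def by (simp add: mult_ac)
        also have "cis (\<nu> * x) * cis (- (\<nu> * x)) = 1" by (simp add: cis_mult)
        finally show ?thesis by simp
      qed
      have fnn: "0 \<le> Re (?f x)" for x
        unfolding fRe using plateau_bounds(1)[of "- L" 0 x] mRe[of x] by (intro mult_nonneg_nonneg) auto
      have flow: "(1 / 5 * exp (Phi \<sigma> X (- X))) * indicator {- X - Y..- X} x \<le> Re (?f x)" for x
      proof (cases "x \<in> {- X - Y..- X}")
        case True
        have "((x + X) / Y)\<^sup>2 \<le> 1"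
        proof -
          have "\<bar>x + X\<bar> \<le> Y" using True by auto
          then have "\<bar>(x + X) / Y\<bar> \<le> 1" using Y by simp
          then show ?thesis by (rule abs_square_le_1[THEN iffD2])
        qed
        then have g1: "exp (- (1/2)) \<le> exp (- ((x + X) / Y)\<^sup>2 / 2)" by simp
        have g2: "exp (Phi \<sigma> X (- X) - 1 / 2) \<le> exp (Phi \<sigma> X x)"
          using Phi_near_max[OF s, of X Y x] X Y True by simp
        have g3: "plateau (- L) 0 x = 1" using True L X Y by (intro plateau_1) auto
        \<comment> \<open>The Gaussian and the exponent each lose a factor of at worst
          \<open>exp (- 1/2)\<close>; with \<open>exp (- 1) \<ge> 1/3\<close> and
          \<open>Re (m x) \<ge> 2/3\<close> this leaves \<open>2/9\<close>, more than
          \<open>1/5\<close>.\<close>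
        have e3: "exp (- 1) \<ge> (1 / 3 :: real)"
          using exp_le by (simp add: exp_minus field_simps)
        have "1 / 5 * exp (Phi \<sigma> X (- X)) \<le> (exp (- 1) * exp (Phi \<sigma> X (- X))) * (2 / 3)"
          using mult_right_mono[OF e3, of "exp (Phi \<sigma> X (- X))"] by simp
        also have "exp (- 1) * exp (Phi \<sigma> X (- X)) = exp (- (1/2)) * exp (Phi \<sigma> X (- X) - 1 / 2)"
          by (simp add: mult_exp_exp)
        also have "(exp (- (1/2)) * exp (Phi \<sigma> X (- X) - 1 / 2)) * (2 / 3) \<le> (exp (- ((x + X) / Y)\<^sup>2 / 2) * exp (Phi \<sigma> X x)) * Re (m x)"
          by (intro mult_mono g1 g2 mRe) auto
        also have "\<dots> = Re (?f x)" unfolding fRe g3 by simp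
        finally show ?thesis using True by simp
      next
        case False then show ?thesis using fnn by simp
      qed
      have fi: "integrable lborel ?f" by (rule schwartz_integrable[OF fS])
      have "1 / 5 * Y * exp (Phi \<sigma> X (- X)) = (LINT x|lborel. (1 / 5 * exp (Phi \<sigma> X (- X))) * indicator {- X - Y..- X} x)"
        using II[of "- X - Y" "- X"] Y by simp
      also have "\<dots> \<le> (LINT x|lborel. Re (?f x))"
        by (intro integral_mono flow integrable_mult_right iI integrable_Re fi)
      also have "\<dots> = Re (LINT x|lborel. ?f x)" by (rule integral_Re[OF fi])
      finally show ?thesis .
    qed
    have pde: "Dfun (Dfun \<psi>) x + Dfun (\<lambda>x. ?a x * \<psi> x) x = - ((Complex (N * X) (jap X powr (- \<sigma>) / 2))\<^sup>2 * \<psi> x) - R x" for x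
      unfolding R_def k_def \<nu>_def \<kappa>_def by simp
    show ?thesis unfolding is_quasimode_def packet_def using \<psi>T RT pde \<psi>int Rint low by blast
  qed
  then show ?thesis using N1 C0 by blast
qed

section \<open>The initial data\<close>

lemma distr_fourier_distr_of:
  assumes "f \<in> schwartz" shows "distr_fourier (distr_of f) = distr_of (fourier f)"
proof
  fix \<phi> show "distr_fourier (distr_of f) \<phi> = distr_of (fourier f) \<phi>"
  proof (cases "\<phi> \<in> schwartz")
    case True
    then show ?thesis
      using fourier_multiplication_formula[OF schwartz_integrable[OF assms] schwartz_integrable[OF True]] schwartz_fourier[OF True]
      unfolding distr_fourier_def distr_of_def by simp
  qed (simp add: distr_fourier_def distr_of_def)
qed

lemma schwartz_distr_of_tempered: "f \<in> schwartz \<Longrightarrow> distr_of f \<in> tempered"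
  by (intro distr_of_tempered schwartz_integrable)

text \<open>Data are built backwards: the reciprocal multiplier is applied to \<open>W\<close>, so
  the multiplier gives back \<open>W\<close> exactly and the norm of the datum is a weighted L2 norm
  of \<open>W\<close> alone.\<close>

lemma H_rep_inverse_multiplier:
  assumes pos: "r1 > 0" "\<theta> > 0" and W: "W \<in> schwartz"
    and h: "(\<lambda>x. exp_weight r2 s x * W x) \<in> L2" "integrable lborel (\<lambda>x. exp_weight r2 s x * W x)"
  shows "H_rep \<theta> s r1 r2 (distr_of (ifourier (\<lambda>\<xi>. exp_weight (- r1) \<theta> \<xi> * fourier W \<xi>))) (\<lambda>x. exp_weight r2 s x * W x)"
  unfolding H_rep_def
proof (intro conjI exI[of _ "distr_of W"])
  let ?K = "\<lambda>\<xi>. exp_weight (- r1) \<theta> \<xi> * fourier W \<xi>"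
  have K: "?K \<in> schwartz" by (intro schwartz_mult slow_exp_weight_neg pos schwartz_fourier W)
  show "is_fourier_multiplier (exp_weight r1 \<theta>) (distr_of (ifourier ?K)) (distr_of W)"
    unfolding is_fourier_multiplier_def is_product_def distr_fourier_distr_of[OF W] distr_fourier_distr_of[OF schwartz_ifourier[OF K]] fourier_ifourier[OF K]
  proof (intro conjI ballI schwartz_distr_of_tempered W schwartz_fourier)
    fix \<phi> assume t: "\<phi> \<in> test_fun"
    have "?K x * (exp_weight r1 \<theta> x * \<phi> x) = fourier W x * \<phi> x" for x
    proof -
      have "?K x * (exp_weight r1 \<theta> x * \<phi> x) = (exp_weight r1 \<theta> x * exp_weight (- r1) \<theta> x) * (fourier W x * \<phi> x)"
        by (simp only: mult_ac)
      then show ?thesis by (simp add: exp_weight_inverse)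
    qed
    then show "distr_of (fourier W) \<phi> = distr_of ?K (\<lambda>x. exp_weight r1 \<theta> x * \<phi> x)"
      using test_fun_schwartz[OF t] test_fun_schwartz[OF test_fun_mult[OF smooth_exp_weight t]]
      unfolding distr_of_def by (simp only: if_True)
  qed
  show "is_product (exp_weight r2 s) (distr_of W) (distr_of (\<lambda>x. exp_weight r2 s x * W x))"
    unfolding is_product_def
  proof (intro conjI ballI distr_of_tempered h)
    fix \<phi> assume t: "\<phi> \<in> test_fun"
    then show "distr_of (\<lambda>x. exp_weight r2 s x * W x) \<phi> = distr_of W (\<lambda>x. exp_weight r2 s x * \<phi> x)"
      using test_fun_schwartz[OF t] test_fun_schwartz[OF test_fun_mult[OF smooth_exp_weight t]]
      unfolding distr_of_def by (simp add: mult_ac)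
  qed
qed (rule h)

section \<open>Gaussian packets: transform, multiplier error and weighted norm\<close>

lemma packet_schwartz: "Y > 0 \<Longrightarrow> packet \<nu> X Y \<in> schwartz"
  unfolding packet_def by (intro schwartz_mult slow_cis schwartz_isometry gauss_schwartz) auto

lemma cmod_packet: "cmod (packet \<nu> X Y x) = exp (- ((x + X) / Y)\<^sup>2 / 2)"
  unfolding packet_def gauss_def by (simp add: norm_mult)

lemma cmod_fourier_packet:
  assumes "Y > 0" shows "cmod (fourier (packet \<nu> X Y) \<xi>) = Y * sqrt (2 * pi) * exp (- (Y * (\<xi> - \<nu>))\<^sup>2 / 2)"
proof -
  have "fourier (packet \<nu> X Y) \<xi> = \<bar>1\<bar> *\<^sub>R (LINT y|lborel. cis (- \<xi> * (- X + 1 * y)) * packet \<nu> X Y (- X + 1 * y))"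
    unfolding fourier_eq by (rule lborel_integral_real_affine) simp
  also have "\<dots> = (LINT y|lborel. cis (X * (\<xi> - \<nu>)) * (cis (- (\<xi> - \<nu>) * y) * gauss (1 / Y) y))"
  proof -
    have "cis (- \<xi> * (- X + 1 * y)) * cis (\<nu> * (- X + 1 * y)) = cis (X * (\<xi> - \<nu>)) * cis (- (\<xi> - \<nu>) * y)" for y
      unfolding cis_mult by (simp add: algebra_simps)
    then show ?thesis unfolding packet_def
      by (simp add: mult.assoc[symmetric] del: Bochner_Integration.integral_mult_right_zero)
  qed
  also have "\<dots> = cis (X * (\<xi> - \<nu>)) * fourier (gauss (1 / Y)) (\<xi> - \<nu>)" unfolding fourier_eq by simp
  finally show ?thesis using assms by (simp add: fourier_gauss norm_mult gauss_def)
qed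

lemma gaussian_integral:
  assumes "a > 0"
  shows "integrable lborel (\<lambda>x::real. exp (- (a * (x - b))\<^sup>2 / 2))" "(LINT x|lborel. exp (- (a * (x - b))\<^sup>2 / 2)) = sqrt (2 * pi) / a"
proof -
  have S: "gauss a \<in> schwartz" using assms by (intro gauss_schwartz) simp
  have g: "integrable lborel (\<lambda>x. Re (gauss a x))" by (intro integrable_Re schwartz_integrable S)
  have e: "exp (- (a * (x - b))\<^sup>2 / 2) = Re (gauss a (- b + 1 * x))" for x by (simp add: gauss_def)
  show "integrable lborel (\<lambda>x::real. exp (- (a * (x - b))\<^sup>2 / 2))"
    unfolding e by (rule lborel_integrable_real_affine[OF g]) simp
  have "(LINT x|lborel. Re (gauss a x)) = \<bar>1\<bar> *\<^sub>R (LINT x|lborel. Re (gauss a (- b + 1 * x)))"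
    by (rule lborel_integral_real_affine) simp
  moreover have "(LINT x|lborel. Re (gauss a x)) = Re (LINT x|lborel. gauss a x)"
    by (rule integral_Re[OF schwartz_integrable[OF S]])
  moreover have "(LINT x|lborel. gauss a x) = complex_of_real (1 / a * sqrt (2 * pi))"
    using integral_gauss[of "1 / a"] assms by simp
  ultimately show "(LINT x|lborel. exp (- (a * (x - b))\<^sup>2 / 2)) = sqrt (2 * pi) / a"
    unfolding e by simp
qed

text \<open>The derivative is bounded by \<open>jap(t)^(q-1)\<close>, which is at most 1 as
  \<open>q \<le> 1\<close>.\<close>

lemma jap_powr_lipschitz:
  assumes q: "0 \<le> q" "q \<le> 1" shows "\<bar>jap x powr q - jap y powr q\<bar> \<le> \<bar>x - y\<bar>"
proof -
  have d: "\<bar>q * t * jap t powr (q - 2)\<bar> \<le> 1" for t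
  proof -
    have "\<bar>q * t * jap t powr (q - 2)\<bar> \<le> 1 * jap t * jap t powr (q - 2)"
      using q jap_ge[of t] jap_pos[of t] unfolding abs_mult by (intro mult_mono) auto
    also have "\<dots> = jap t powr (- (1 - q))" using jap_pos[of t] powr_add[of "jap t" 1 "q - 2"] by simp
    also have "\<dots> \<le> 1" using q by (intro jap_powr_le_1) auto
    finally show ?thesis .
  qed
  have main: "\<bar>jap x powr q - jap y powr q\<bar> \<le> y - x" if xy: "x \<le> y" for x y
  proof -
    have "cmod (complex_of_real (jap y powr q) - complex_of_real (jap x powr q)) \<le> 1 * (y - x)"
    proof (rule mean_value_bound[OF xy])
      show "((\<lambda>x. complex_of_real (jap x powr q)) has_vector_derivative complex_of_real (q * t * jap t powr (q - 2))) (at t within {x..y})" for t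
        by (rule has_vector_derivative_at_within[OF has_vector_derivative_of_real[OF jap_powr_deriv]])
      show "cmod (complex_of_real (q * t * jap t powr (q - 2))) \<le> 1" for t
        unfolding norm_of_real by (rule d)
    qed
    then show ?thesis by (metis abs_minus_commute mult_1 norm_of_real of_real_diff)
  qed
  show ?thesis using main[of x y] main[of y x] by (cases "x \<le> y") auto
qed

lemma abs_exp_minus_1_le: "\<bar>exp d - 1\<bar> \<le> \<bar>d\<bar> * exp \<bar>d\<bar>" for d :: real
proof (cases "d \<ge> 0")
  case True
  have "1 - d \<le> exp (- d)" using exp_ge_add_one_self[of "- d"] by simp
  then have "(1 - d) * exp d \<le> exp (- d) * exp d" by (intro mult_right_mono) auto
  then have "exp d - 1 \<le> d * exp d" by (simp add: mult_exp_exp algebra_simps)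
  then show ?thesis using True by simp
next
  case False
  have "1 + d \<le> exp d" by (rule exp_ge_add_one_self)
  then have "1 - exp d \<le> - d" by linarith
  then have "\<bar>exp d - 1\<bar> \<le> \<bar>d\<bar> * 1" using False by (simp add: abs_if)
  also have "\<dots> \<le> \<bar>d\<bar> * exp \<bar>d\<bar>" by (intro mult_left_mono) auto
  finally show ?thesis .
qed

text \<open>A wide packet is almost an eigenfunction of the multiplier \<open>exp (- \<langle>D\<rangle>^(1/\<theta>))\<close>, since
  \<open>\<langle>\<xi>\<rangle>^(1/\<theta>)\<close> is Lipschitz and the frequencies are within \<open>O(1/Y)\<close> of \<open>\<nu>\<close>.\<close>

lemma multiplier_packet:
  assumes Y: "Y \<ge> 1" and \<theta>: "\<theta> \<ge> 1"
  shows "cmod (ifourier (\<lambda>\<xi>. exp_weight (- 1) \<theta> \<xi> * fourier (packet \<nu> X Y) \<xi>) x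
           - complex_of_real (exp (- (jap \<nu> powr (1 / \<theta>)))) * packet \<nu> X Y x)
         \<le> exp (- (jap \<nu> powr (1 / \<theta>))) * (exp 4 * sqrt 2 / Y)"
proof -
  let ?W = "packet \<nu> X Y" and ?c = "exp (- (jap \<nu> powr (1 / \<theta>)))"
  let ?K = "\<lambda>\<xi>. exp_weight (- 1) \<theta> \<xi> * fourier ?W \<xi>"
  have W: "?W \<in> schwartz" using Y by (intro packet_schwartz) simp
  have FW: "fourier ?W \<in> schwartz" by (rule schwartz_fourier[OF W])
  have K: "?K \<in> schwartz" using \<theta> by (intro schwartz_mult slow_exp_weight_neg FW) auto
  let ?D = "\<lambda>\<xi>. 1 * ?K \<xi> + (- complex_of_real ?c) * fourier ?W \<xi>"
  have D: "?D \<in> schwartz" by (intro schwartz_add schwartz_cmult K FW)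
  have "ifourier ?D x = 1 * ifourier ?K x + (- complex_of_real ?c) * ifourier (fourier ?W) x"
    unfolding ifourier_def fourier_lin[OF K FW] by (simp add: algebra_simps)
  then have eq: "ifourier ?K x - complex_of_real ?c * ?W x = ifourier ?D x"
    unfolding ifourier_fourier[OF W] by simp
  have b: "cmod (?D \<xi>) \<le> (?c * sqrt (2 * pi) * exp 4) * exp (- ((Y / sqrt 2) * (\<xi> - \<nu>))\<^sup>2 / 2)" for \<xi>
  proof -
    define d where "d = jap \<nu> powr (1 / \<theta>) - jap \<xi> powr (1 / \<theta>)"
    \<comment> \<open>The factor \<open>Y\<close> in the transform of the packet turns
      \<open>|\<xi> - \<nu>|\<close> into \<open>t\<close>, and the remaining integral in
      \<open>\<xi>\<close> then produces the gain \<open>1 / Y\<close>.\<close>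
    define t where "t = Y * \<bar>\<xi> - \<nu>\<bar>"
    have t: "\<bar>\<xi> - \<nu>\<bar> \<le> t" "Y * \<bar>\<xi> - \<nu>\<bar> = t" "t \<ge> 0" using Y mult_right_mono[of 1 Y "\<bar>\<xi> - \<nu>\<bar>"] by (auto simp: t_def)
    have dl: "\<bar>d\<bar> \<le> \<bar>\<xi> - \<nu>\<bar>"
      unfolding d_def using jap_powr_lipschitz[of "1 / \<theta>" \<nu> \<xi>] \<theta> by (simp add: abs_minus_commute)
    have "exp_weight (- 1) \<theta> \<xi> = complex_of_real (?c * exp d)"
      unfolding exp_weight_def d_def by (simp add: mult_exp_exp del: of_real_mult)
    then have "?D \<xi> = complex_of_real (?c * (exp d - 1)) * fourier ?W \<xi>"
      by (simp add: algebra_simps)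
    then have "cmod (?D \<xi>) = ?c * \<bar>exp d - 1\<bar> * (Y * sqrt (2 * pi) * exp (- (Y * (\<xi> - \<nu>))\<^sup>2 / 2))"
      using Y by (simp only: norm_mult norm_of_real cmod_fourier_packet abs_mult) simp
    also have "\<dots> \<le> ?c * (\<bar>\<xi> - \<nu>\<bar> * exp t) * (Y * sqrt (2 * pi) * exp (- (Y * (\<xi> - \<nu>))\<^sup>2 / 2))"
    proof (intro mult_right_mono mult_left_mono)
      have "\<bar>exp d - 1\<bar> \<le> \<bar>d\<bar> * exp \<bar>d\<bar>" by (rule abs_exp_minus_1_le)
      also have "\<dots> \<le> \<bar>\<xi> - \<nu>\<bar> * exp t" using dl t by (intro mult_mono) auto
      finally show "\<bar>exp d - 1\<bar> \<le> \<bar>\<xi> - \<nu>\<bar> * exp t" .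
    qed (use Y in auto)
    also have "\<dots> = ?c * sqrt (2 * pi) * (t * exp t * exp (- t\<^sup>2 / 2))"
      unfolding t_def by (simp add: power_mult_distrib)
    also have "\<dots> \<le> ?c * sqrt (2 * pi) * (exp 4 * exp (- t\<^sup>2 / 4))"
    proof (intro mult_left_mono)
      have "t * exp t * exp (- t\<^sup>2 / 2) \<le> exp t * exp t * exp (- t\<^sup>2 / 2)"
      proof (intro mult_right_mono)
        show "t \<le> exp t" using exp_ge_add_one_self[of t] by linarith
      qed auto
      also have "\<dots> = exp (2 * t - t\<^sup>2 / 2)" by (simp add: mult_exp_exp)
      \<comment> \<open>Half of the Gaussian absorbs \<open>exp (2 t)\<close>; completing the square
        leaves the constant \<open>exp 4\<close>.\<close>
      also have "\<dots> \<le> exp (4 - t\<^sup>2 / 4)"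
      proof -
        have "0 \<le> (t / 2 - 2)\<^sup>2" by simp
        then show ?thesis by (simp add: power2_diff power_divide)
      qed
      also have "\<dots> = exp 4 * exp (- t\<^sup>2 / 4)" by (simp add: mult_exp_exp)
      finally show "t * exp t * exp (- t\<^sup>2 / 2) \<le> exp 4 * exp (- t\<^sup>2 / 4)" .
    qed auto
    also have "\<dots> = (?c * sqrt (2 * pi) * exp 4) * exp (- ((Y / sqrt 2) * (\<xi> - \<nu>))\<^sup>2 / 2)"
      unfolding t_def by (simp add: power_mult_distrib power_divide)
    finally show ?thesis .
  qed
  have Y2: "Y / sqrt 2 > 0" using Y by simp
  have "cmod (ifourier ?D x) \<le> (LINT \<xi>|lborel. cmod (?D \<xi>)) / (2 * pi)" by (rule ifourier_bound)
  also have "\<dots> \<le> (LINT \<xi>|lborel. (?c * sqrt (2 * pi) * exp 4) * exp (- ((Y / sqrt 2) * (\<xi> - \<nu>))\<^sup>2 / 2)) / (2 * pi)"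
    by (intro divide_right_mono integral_mono integrable_norm schwartz_integrable D b integrable_mult_right gaussian_integral Y2) auto
  also have "\<dots> = (?c * sqrt (2 * pi) * exp 4) * (sqrt (2 * pi) / (Y / sqrt 2)) / (2 * pi)"
    using gaussian_integral(2)[OF Y2, of \<nu>] by simp
  also have "\<dots> = ?c * (exp 4 * sqrt 2 / Y) * ((sqrt (2 * pi) * sqrt (2 * pi)) / (2 * pi))"
  proof -
    have "(c * s * e) * (s / (Y / r)) / P = c * (e * r / Y) * ((s * s) / P)" for c s e r P :: real
      by (simp add: mult_ac)
    then show ?thesis .
  qed
  also have "\<dots> = ?c * (exp 4 * sqrt 2 / Y)" by simp
  finally show ?thesis unfolding eq .
qed

text \<open>For \<open>z = |x + X| \<le> X\<close> the exponent of the weight is at most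
  \<open>(3 X)^p\<close>. For \<open>z > X\<close> one has \<open>z^p \<le> z^2 X^(p-2)\<close>, and
  half of the Gaussian exponent absorbs this because \<open>X^(p-2) Y^2 = X^(p+\<sigma>-1)\<close>,
  which is small for large \<open>X\<close> when \<open>p < 1 - \<sigma>\<close>.\<close>

lemma weighted_packet_bound:
  assumes p: "0 < p" "p \<le> 1" and X: "X \<ge> 1" and Y: "Y > 0" "Y\<^sup>2 = X powr (1 + \<sigma>)" and big: "12 * X powr (p + \<sigma> - 1) \<le> 1"
  shows "(exp (jap x powr p) * exp (- ((x + X) / Y)\<^sup>2 / 2))\<^sup>2 \<le> exp (2 * (3 * X) powr p) * exp (- ((1 / Y) * (x - (- X)))\<^sup>2 / 2)"
proof -
  define z where "z = \<bar>x + X\<bar>"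
  have z: "z\<^sup>2 = (x + X)\<^sup>2" "z \<ge> 0" by (auto simp: z_def)
  have j: "jap x \<le> 1 + X + z" using jap_le[of x] X unfolding z_def by linarith
  have "2 * jap x powr p \<le> 2 * (3 * X) powr p + z\<^sup>2 / (2 * Y\<^sup>2)"
  proof (cases "z \<le> X")
    case True
    have "jap x powr p \<le> (3 * X) powr p" using j True X p jap_pos[of x] by (intro powr_mono2) auto
    moreover have "0 \<le> z\<^sup>2 / (2 * Y\<^sup>2)" by simp
    ultimately show ?thesis by linarith
  next
    case False
    have zX: "z \<ge> X" "z > 0" using False X by auto
    have "jap x powr p \<le> (3 * z) powr p" using j zX X p jap_pos[of x] by (intro powr_mono2) auto
    also have "\<dots> = 3 powr p * z powr p" using zX by (simp add: powr_mult)
    also have "\<dots> \<le> 3 * z powr p" using p powr_mono[of p 1 3] by (intro mult_right_mono) auto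
    also have "z powr p = z\<^sup>2 * z powr (p - 2)"
      using zX powr_add[of z 2 "p - 2"] by simp
    also have "3 * (z\<^sup>2 * z powr (p - 2)) \<le> 3 * (z\<^sup>2 * X powr (p - 2))"
      using zX X p by (intro mult_left_mono powr_mono2') auto
    finally have 1: "2 * jap x powr p \<le> z\<^sup>2 * (6 * X powr (p - 2))" by simp
    have "X powr (p - 2) * X powr (1 + \<sigma>) = X powr (p + \<sigma> - 1)" using X by (simp add: powr_add[symmetric])
    then have "6 * X powr (p - 2) * Y\<^sup>2 \<le> 1 / 2" using big Y(2) by simp
    then have "6 * X powr (p - 2) \<le> 1 / (2 * Y\<^sup>2)" using Y(1) by (simp add: field_simps)
    then have "z\<^sup>2 * (6 * X powr (p - 2)) \<le> z\<^sup>2 * (1 / (2 * Y\<^sup>2))" by (intro mult_left_mono) auto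
    then have "z\<^sup>2 * (6 * X powr (p - 2)) \<le> z\<^sup>2 / (2 * Y\<^sup>2)" by simp
    moreover have "0 \<le> (3 * X) powr p" by simp
    ultimately show ?thesis using 1 by linarith
  qed
  then have "2 * jap x powr p - (x + X)\<^sup>2 / Y\<^sup>2 \<le> 2 * (3 * X) powr p - (x + X)\<^sup>2 / (2 * Y\<^sup>2)"
  proof -
    have "(x + X)\<^sup>2 / (2 * Y\<^sup>2) = ((x + X)\<^sup>2 / Y\<^sup>2) / 2" by simp
    then show ?thesis using \<open>2 * jap x powr p \<le> 2 * (3 * X) powr p + z\<^sup>2 / (2 * Y\<^sup>2)\<close> unfolding z(1) by linarith
  qed
  then have "exp (2 * jap x powr p - (x + X)\<^sup>2 / Y\<^sup>2) \<le> exp (2 * (3 * X) powr p - (x + X)\<^sup>2 / (2 * Y\<^sup>2))" by simp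
  moreover have "(exp (jap x powr p) * exp (- ((x + X) / Y)\<^sup>2 / 2))\<^sup>2 = exp (2 * jap x powr p - (x + X)\<^sup>2 / Y\<^sup>2)"
    unfolding power_mult_distrib exp_double[symmetric] by (simp add: mult_exp_exp power_divide)
  moreover have "exp (2 * (3 * X) powr p) * exp (- ((1 / Y) * (x - (- X)))\<^sup>2 / 2) = exp (2 * (3 * X) powr p - (x + X)\<^sup>2 / (2 * Y\<^sup>2))"
    by (simp add: mult_exp_exp power_divide)
  ultimately show ?thesis by simp
qed

lemma packet_data:
  fixes \<nu> :: real
  assumes s: "s \<ge> 1" and \<theta>: "\<theta> \<ge> 1" and X: "X \<ge> 1" and Y: "Y \<ge> 1" "Y \<le> X" "Y\<^sup>2 = X powr (1 + \<sigma>)"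
    and big: "12 * X powr (1 / s + \<sigma> - 1) \<le> 1"
  defines "G \<equiv> ifourier (\<lambda>\<xi>. exp_weight (- 1) \<theta> \<xi> * fourier (packet \<nu> X Y) \<xi>)"
  shows "G \<in> schwartz" "distr_of G \<in> H_space \<theta> s 1 1" "H_norm \<theta> s 1 1 (distr_of G) \<le> 3 * X * exp ((3 * X) powr (1 / s))"
proof -
  let ?W = "packet \<nu> X Y"
  let ?h = "\<lambda>x. exp_weight 1 s x * ?W x"
  let ?e = "\<lambda>x. exp (- ((1 / Y) * (x - (- X)))\<^sup>2 / 2)"
  have W: "?W \<in> schwartz" using Y by (intro packet_schwartz) simp
  have "(\<lambda>\<xi>. exp_weight (- 1) \<theta> \<xi> * fourier ?W \<xi>) \<in> schwartz"
    using \<theta> by (intro schwartz_mult slow_exp_weight_neg schwartz_fourier W) auto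
  then show G: "G \<in> schwartz" unfolding G_def by (rule schwartz_ifourier)
  have hb: "(cmod (?h x))\<^sup>2 \<le> exp (2 * (3 * X) powr (1 / s)) * ?e x" for x
  proof -
    have "cmod (?h x) = exp (jap x powr (1 / s)) * exp (- ((x + X) / Y)\<^sup>2 / 2)"
      by (simp add: norm_mult cmod_packet exp_weight_def)
    then show ?thesis
      using weighted_packet_bound[of "1 / s" X Y \<sigma> x] s X Y big by simp
  qed
  have Y1: "1 / Y > 0" using Y by simp
  have meas: "?h \<in> borel_measurable borel"
    by (intro smooth_measurable smooth_mult smooth_exp_weight schwartz_smooth W)
  have ie: "integrable lborel (\<lambda>x. exp (2 * (3 * X) powr (1 / s)) * ?e x)"
    by (intro integrable_mult_right gaussian_integral Y1)
  have sq: "integrable lborel (\<lambda>x. (cmod (?h x))\<^sup>2)"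
    by (rule Bochner_Integration.integrable_bound[OF ie]) (use meas hb in \<open>auto intro!: AE_I2\<close>)
  have hL: "?h \<in> L2" using meas sq unfolding L2_def by simp
  have hi: "integrable lborel ?h"
  proof (rule Bochner_Integration.integrable_bound)
    \<comment> \<open>The square root of the bound \<open>hb\<close>: a Gaussian wider than
      \<open>?e\<close> by the factor \<open>sqrt 2\<close>.\<close>
    show "integrable lborel (\<lambda>x. exp ((3 * X) powr (1 / s)) * exp (- ((1 / (sqrt 2 * Y)) * (x - (- X)))\<^sup>2 / 2))"
      using Y by (intro integrable_mult_right gaussian_integral) auto
    show "AE x in lborel. norm (?h x) \<le> norm (exp ((3 * X) powr (1 / s)) * exp (- ((1 / (sqrt 2 * Y)) * (x - (- X)))\<^sup>2 / 2))"
    proof (rule AE_I2)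
      fix x
      have "exp (2 * (3 * X) powr (1 / s)) * ?e x = (exp ((3 * X) powr (1 / s)) * exp (- ((1 / (sqrt 2 * Y)) * (x - (- X)))\<^sup>2 / 2))\<^sup>2"
        unfolding power_mult_distrib exp_double[symmetric] by (simp add: power_divide power_mult_distrib)
      with hb[of x] have "(cmod (?h x))\<^sup>2 \<le> (exp ((3 * X) powr (1 / s)) * exp (- ((1 / (sqrt 2 * Y)) * (x - (- X)))\<^sup>2 / 2))\<^sup>2" by simp
      then have "cmod (?h x) \<le> exp ((3 * X) powr (1 / s)) * exp (- ((1 / (sqrt 2 * Y)) * (x - (- X)))\<^sup>2 / 2)"
        by (rule power2_le_imp_le) simp
      then show "norm (?h x) \<le> norm (exp ((3 * X) powr (1 / s)) * exp (- ((1 / (sqrt 2 * Y)) * (x - (- X)))\<^sup>2 / 2))" by simp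
    qed
  qed (use meas in simp)
  have rep: "H_rep \<theta> s 1 1 (distr_of G) ?h"
    unfolding G_def using H_rep_inverse_multiplier[of 1 \<theta> ?W 1 s] \<theta> W hL hi by simp
  then show "distr_of G \<in> H_space \<theta> s 1 1"
    using schwartz_distr_of_tempered[OF G] unfolding H_space_def by blast
  have "(LINT x|lborel. (cmod (?h x))\<^sup>2) \<le> (LINT x|lborel. exp (2 * (3 * X) powr (1 / s)) * ?e x)"
    by (intro integral_mono sq ie hb)
  also have "\<dots> = exp (2 * (3 * X) powr (1 / s)) * (sqrt (2 * pi) * Y)"
    using gaussian_integral(2)[OF Y1, of "- X"] by simp
  also have "\<dots> \<le> exp (2 * (3 * X) powr (1 / s)) * (3 * X)\<^sup>2"
  proof (rule mult_left_mono)
    have "sqrt (2 * pi) \<le> 3" using pi_less_4 by (intro real_le_lsqrt) auto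
    then have "sqrt (2 * pi) * Y \<le> 3 * X" using Y X by (intro mult_mono) auto
    also have "\<dots> \<le> (3 * X)\<^sup>2" using X by (intro self_le_power) auto
    finally show "sqrt (2 * pi) * Y \<le> (3 * X)\<^sup>2" .
  qed simp
  also have "\<dots> = (3 * X * exp ((3 * X) powr (1 / s)))\<^sup>2"
    unfolding exp_double by (simp add: power_mult_distrib mult.commute)
  finally have "L2_norm ?h \<le> sqrt ((3 * X * exp ((3 * X) powr (1 / s)))\<^sup>2)"
    unfolding L2_norm_def by (rule real_sqrt_le_mono)
  then show "H_norm \<theta> s 1 1 (distr_of G) \<le> 3 * X * exp ((3 * X) powr (1 / s))"
    using H_norm_eq[OF rep] X by simp
qed

text \<open>The datum is replaced by a multiple of the packet, at the price of the uniform error of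
  \<open>multiplier_packet\<close> times the L1 norm of \<open>\<psi>\<close>.\<close>

lemma packet_pairing:
  fixes \<nu> X :: real
  assumes s: "\<theta> \<ge> 1" and Y: "Y \<ge> 1" and \<psi>: "\<psi> \<in> schwartz"
  defines "G \<equiv> ifourier (\<lambda>\<xi>. exp_weight (- 1) \<theta> \<xi> * fourier (packet \<nu> X Y) \<xi>)"
  shows "exp (- (jap \<nu> powr (1 / \<theta>))) * (Re (LINT x|lborel. packet \<nu> X Y x * \<psi> x) - exp 4 * sqrt 2 / Y * (LINT x|lborel. cmod (\<psi> x)))
     \<le> cmod (distr_of G \<psi>)"
proof -
  let ?W = "packet \<nu> X Y" and ?c = "exp (- (jap \<nu> powr (1 / \<theta>)))"
  have W: "?W \<in> schwartz" using Y by (intro packet_schwartz) simp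
  have "(\<lambda>\<xi>. exp_weight (- 1) \<theta> \<xi> * fourier ?W \<xi>) \<in> schwartz"
    using s by (intro schwartz_mult slow_exp_weight_neg schwartz_fourier W) auto
  then have G: "G \<in> schwartz" unfolding G_def by (rule schwartz_ifourier)
  let ?d = "\<lambda>x. (G x - complex_of_real ?c * ?W x) * \<psi> x"
  have dS: "(\<lambda>x. G x - complex_of_real ?c * ?W x) \<in> schwartz" by (intro schwartz_diff schwartz_cmult G W)
  have di: "integrable lborel ?d" by (intro schwartz_integrable schwartz_mult schwartz_imp_slow dS \<psi>)
  have Wi: "integrable lborel (\<lambda>x. ?W x * \<psi> x)" by (intro schwartz_integrable schwartz_mult schwartz_imp_slow W \<psi>)
  have "distr_of G \<psi> = (LINT x|lborel. complex_of_real ?c * (?W x * \<psi> x) + ?d x)"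
    using \<psi> unfolding distr_of_def by (simp add: algebra_simps)
  also have "\<dots> = complex_of_real ?c * (LINT x|lborel. ?W x * \<psi> x) + (LINT x|lborel. ?d x)"
    by (subst Bochner_Integration.integral_add[OF integrable_mult_right[OF Wi] di]) simp
  finally have eq: "distr_of G \<psi> = complex_of_real ?c * (LINT x|lborel. ?W x * \<psi> x) + (LINT x|lborel. ?d x)" .
  have "cmod (LINT x|lborel. ?d x) \<le> (LINT x|lborel. ?c * (exp 4 * sqrt 2 / Y) * cmod (\<psi> x))"
  proof (rule Bochner_Integration.integral_norm_bound_integral[OF di])
    show "integrable lborel (\<lambda>x. ?c * (exp 4 * sqrt 2 / Y) * cmod (\<psi> x))"
      by (intro integrable_mult_right integrable_norm schwartz_integrable \<psi>)
    show "norm (?d x) \<le> ?c * (exp 4 * sqrt 2 / Y) * cmod (\<psi> x)" for x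
      unfolding norm_mult[of _ "\<psi> x"] G_def
      by (intro mult_right_mono multiplier_packet Y s) auto
  qed
  then have db: "cmod (LINT x|lborel. ?d x) \<le> ?c * (exp 4 * sqrt 2 / Y * (LINT x|lborel. cmod (\<psi> x)))" by simp
  have "?c * Re (LINT x|lborel. ?W x * \<psi> x) = Re (distr_of G \<psi> - (LINT x|lborel. ?d x))" unfolding eq by simp
  also have "\<dots> \<le> cmod (distr_of G \<psi> - (LINT x|lborel. ?d x))" by (rule complex_Re_le_cmod)
  also have "\<dots> \<le> cmod (distr_of G \<psi>) + cmod (LINT x|lborel. ?d x)" by (rule norm_triangle_ineq4)
  finally show ?thesis using db by (simp add: right_diff_distrib)
qed

section \<open>Necessity of the index condition\<close>

text \<open>Growth read backwards. The factor \<open>exp (i k^2 t)\<close> has modulus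
  \<open>exp (- 2 Re k Im k t) \<le> 1\<close> and removes the term with \<open>k^2\<close>, so the
  product with \<open>u t \<psi>\<close> changes by at most \<open>b T\<close> up to time
  \<open>T\<close>. A bound at time \<open>T\<close> thus forces the datum to pair weakly with
  \<open>\<psi>\<close>.\<close>

lemma weak_solution_growth:
  assumes T: "T > 0" and pos: "r1 > 0" "r2 > 0" "\<theta> > 0" "s > 0" and u: "u \<in> C1_H T \<theta> s r1 r2"
    and sol: "solves_Cauchy T \<sigma> (\<lambda>_ _. 0) g u"
    and \<psi>: "\<psi> \<in> schwartz" and R: "R \<in> schwartz" and k: "0 \<le> Re k" "0 \<le> Im k"
    and pde: "\<And>x. Dfun (Dfun \<psi>) x + Dfun (\<lambda>x. complex_of_real (jap x powr (- \<sigma>)) * \<psi> x) x = - (k\<^sup>2 * \<psi> x) - R x"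
    and b: "\<And>t. t \<in> {0..T} \<Longrightarrow> cmod (u t R) \<le> b"
  shows "cmod (g \<psi>) \<le> exp (- (2 * Re k * Im k * T)) * cmod (u T \<psi>) + b * T"
proof -
  let ?a = "\<lambda>x. complex_of_real (jap x powr (- \<sigma>))"
  obtain v where v: "\<And>t \<psi>. t \<in> {0..T} \<Longrightarrow> \<psi> \<in> schwartz \<Longrightarrow> ((\<lambda>\<tau>. u \<tau> \<psi>) has_vector_derivative v t \<psi>) (at t within {0..T})"
    using C1_H_weak_derivative[OF pos u] by blast
  have D: "Dfun \<psi> \<in> schwartz" "Dfun (Dfun \<psi>) \<in> schwartz" "(\<lambda>x. ?a x * \<psi> x) \<in> schwartz" "Dfun (\<lambda>x. ?a x * \<psi> x) \<in> schwartz"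
    by (intro schwartz_Dfun schwartz_mult slow_jap \<psi>)+
  have ode: "v t \<psi> = - \<i> * (k\<^sup>2 * u t \<psi> + u t R)" if t: "t \<in> {0..T}" for t
  proof -
    have ut: "u t \<in> tempered" using u t unfolding C1_H_def C0_H_def H_space_def by blast
    have "M_op T \<sigma> u t \<psi> = 0" using sol t unfolding solves_Cauchy_def by simp
    moreover have "vector_derivative (\<lambda>\<tau>. u \<tau> \<psi>) (at t within {0..T}) = v t \<psi>"
      by (rule vector_derivative_within_closed_interval[OF T t v[OF t \<psi>]])
    \<comment> \<open>For the second derivative the two transposition signs cancel and
      \<open>(- i)^2 = - 1\<close> remains; for the drift \<open>i * (- i) = 1\<close> and one
      transposition sign remains.\<close>
    moreover have "M_op T \<sigma> u t \<psi> = - \<i> * vector_derivative (\<lambda>\<tau>. u \<tau> \<psi>) (at t within {0..T})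
       - u t (Dfun (Dfun \<psi>)) - u t (Dfun (\<lambda>x. ?a x * \<psi> x))"
      using D \<psi> unfolding M_op_def Dt_def Dx_def distr_mult_def distr_deriv_def by simp
    ultimately have "- \<i> * v t \<psi> - u t (Dfun (Dfun \<psi>)) - u t (Dfun (\<lambda>x. ?a x * \<psi> x)) = 0" by simp
    moreover have "u t (\<lambda>x. 1 * Dfun (Dfun \<psi>) x + 1 * Dfun (\<lambda>x. ?a x * \<psi> x) x) = 1 * u t (Dfun (Dfun \<psi>)) + 1 * u t (Dfun (\<lambda>x. ?a x * \<psi> x))"
      by (rule tempered_lin[OF ut D(2) D(4)])
    moreover have "(\<lambda>x. 1 * Dfun (Dfun \<psi>) x + 1 * Dfun (\<lambda>x. ?a x * \<psi> x) x) = (\<lambda>x. (- k\<^sup>2) * \<psi> x + (- 1) * R x)"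
      using pde by simp
    moreover have "u t (\<lambda>x. (- k\<^sup>2) * \<psi> x + (- 1) * R x) = (- k\<^sup>2) * u t \<psi> + (- 1) * u t R"
      by (rule tempered_lin[OF ut \<psi> R])
    ultimately have "- \<i> * v t \<psi> = - (k\<^sup>2 * u t \<psi> + u t R)" by (simp add: diff_diff_eq)
    then have "\<i> * (- \<i> * v t \<psi>) = \<i> * (- (k\<^sup>2 * u t \<psi> + u t R))" by simp
    then show ?thesis by (simp add: mult.assoc[symmetric]) (simp add: algebra_simps)
  qed
  let ?e = "\<lambda>t. exp (\<i> * k\<^sup>2 * complex_of_real t)"
  let ?z = "\<lambda>t. ?e t * u t \<psi>"
  have ne: "cmod (?e t) = exp (- (2 * Re k * Im k * t))" for t
    by (simp add: power2_eq_square algebra_simps)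
  have "cmod (?z T - ?z 0) \<le> b * (T - 0)"
  proof (rule mean_value_bound)
    fix t assume t: "t \<in> {0..T}"
    have "(?z has_vector_derivative ?e t * v t \<psi> + (\<i> * k\<^sup>2 * ?e t) * u t \<psi>) (at t within {0..T})"
      by (intro has_vector_derivative_mult v t \<psi> has_vector_derivative_at_within[OF exp_vd[OF linear_vd]])
    moreover have "?e t * v t \<psi> + (\<i> * k\<^sup>2 * ?e t) * u t \<psi> = - \<i> * ?e t * u t R"
      unfolding ode[OF t] by (simp add: algebra_simps)
    ultimately show "(?z has_vector_derivative - \<i> * ?e t * u t R) (at t within {0..T})" by simp
    have "cmod (?e t) \<le> 1" unfolding ne using k t by simp
    then have "cmod (?e t) * cmod (u t R) \<le> 1 * b" by (intro mult_mono b t) auto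
    then show "cmod (- \<i> * ?e t * u t R) \<le> b" by (simp add: norm_mult)
  qed (use T in auto)
  moreover have "?z 0 = g \<psi>" using sol unfolding solves_Cauchy_def by simp
  ultimately have "cmod (?z T - g \<psi>) \<le> b * T" by simp
  moreover have "cmod (g \<psi>) \<le> cmod (?z T) + cmod (?z T - g \<psi>)"
    by (metis norm_minus_commute norm_triangle_sub)
  moreover have "cmod (?z T) = exp (- (2 * Re k * Im k * T)) * cmod (u T \<psi>)"
    unfolding norm_mult ne ..
  ultimately show ?thesis by linarith
qed

lemma powr_eventually_le:
  fixes A q r c :: real
  assumes "q < r" "A > 0" "c > 0"
  shows "eventually (\<lambda>X. (A * X) powr q \<le> c * X powr r) at_top"
proof -
  have "((\<lambda>X. A powr q * X powr (q - r)) \<longlongrightarrow> A powr q * 0) at_top"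
    using tendsto_neg_powr[of "q - r" "\<lambda>X. X" at_top] assms by (intro tendsto_intros) (auto simp: filterlim_ident)
  then have "eventually (\<lambda>X. A powr q * X powr (q - r) < c) at_top"
    using assms by (intro order_tendstoD(2)) auto
  then show ?thesis using eventually_gt_at_top[of 0]
  proof eventually_elim
    case (elim X)
    have "(A * X) powr q = (A powr q * X powr (q - r)) * X powr r"
      using assms elim by (simp add: powr_mult mult.assoc powr_add[symmetric])
    also have "\<dots> \<le> c * X powr r" using elim by (intro mult_right_mono) auto
    finally show ?case .
  qed
qed

lemma H_norm_nonneg: "H_norm \<theta> s r1 r2 u \<ge> 0"
  unfolding H_norm_def L2_norm_def by (intro real_sqrt_ge_zero integral_nonneg_AE) auto

theorem proposition1:
  fixes T \<sigma> \<theta> s :: real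
  assumes "T > 0" and "\<sigma> > 0" and "\<theta> > 1" and "s \<ge> 1"
    and "well_posed T \<sigma> \<theta> s"
  shows "max (1 / \<theta>) (1 / s) \<ge> 1 - \<sigma>"
proof (rule ccontr)
  assume "\<not> max (1 / \<theta>) (1 / s) \<ge> 1 - \<sigma>"
  then have q: "1 / \<theta> < 1 - \<sigma>" and p: "1 / s < 1 - \<sigma>" by auto
  \<comment> \<open>Confines \<open>\<sigma>\<close> to the interval from 0 to 1:
    \<open>1 - \<sigma>\<close> exceeds a positive number.\<close>
  have "1 / s > 0" using assms(4) by simp
  then have \<sigma>: "0 < \<sigma>" "\<sigma> < 1" using p assms(2) by linarith+
  \<comment> \<open>The radii \<open>(1, 1)\<close> of the data already lead to the contradiction;
    the radii \<open>r1\<close> and \<open>r2\<close> that come back are unknown.\<close>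
  obtain r1 r2 Cw where pos: "r1 > 0" "r2 > 0" and Cw: "Cw > 0"
    and wp: "\<forall>f \<in> C0_H T \<theta> s 1 1. \<forall>g \<in> H_space \<theta> s 1 1. \<exists>u \<in> C1_H T \<theta> s r1 r2. solves_Cauchy T \<sigma> f g u \<and>
            (\<forall>v \<in> C1_H T \<theta> s r1 r2. solves_Cauchy T \<sigma> f g v \<longrightarrow> (\<forall>t\<in>{0..T}. v t = u t)) \<and>
            (\<forall>t\<in>{0..T}. (H_norm \<theta> s r1 r2 (u t))\<^sup>2 \<le>
               Cw * ((H_norm \<theta> s 1 1 g)\<^sup>2 + integral {0..t} (\<lambda>\<tau>. (H_norm \<theta> s 1 1 (f \<tau>))\<^sup>2)))"
    using assms(5)[unfolded well_posed_def, THEN spec[of _ 1], THEN mp, OF zero_less_one, THEN spec[of _ 1], THEN mp, OF zero_less_one]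
    by blast
  have \<theta>0: "\<theta> > 0" "s > 0" using assms by auto
  obtain K where K: "K > 0" and pair: "\<And>u \<psi>. u \<in> H_space \<theta> s r1 r2 \<Longrightarrow> \<psi> \<in> schwartz \<Longrightarrow>
      cmod (u \<psi>) \<le> K * H_norm \<theta> s r1 r2 u * (LINT x|lborel. cmod (\<psi> x))"
    using H_pairing_bound[OF pos \<theta>0] by blast
  obtain N C where N: "N \<ge> 1" and C: "C > 0" and quasi: "\<And>X. X \<ge> 4 \<Longrightarrow> \<exists>\<psi> R. is_quasimode \<sigma> N C X \<psi> R"
    using quasimode[OF \<sigma>] by blast
  \<comment> \<open>The first entry is the constant in the lower bound for \<open>Phi\<close> at
    \<open>- X\<close>, the second comes from
    \<open>2 \<nu> \<kappa> T \<ge> N T 2^(-\<sigma>) X^(1-\<sigma>)\<close>; so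
    \<open>c2 X^(1-\<sigma>)\<close> lies below both exponents.\<close>
  define c2 where "c2 = min ((2 powr \<sigma> - 1) / 8) (N * T * 2 powr (- \<sigma>))"
  have "2 powr \<sigma> > (1::real)" using \<sigma> by simp
  then have c2: "c2 > 0" unfolding c2_def using N assms by simp
  \<comment> \<open>In 30, the factor 10 stems from the lower bound \<open>B / 10\<close> and 3 from
    the norm of the datum.\<close>
  define M where "M = 30 * K * C * sqrt Cw * (1 + T)"
  have M: "M > 0" unfolding M_def using K C Cw assms by simp
  \<comment> \<open>Two powers of \<open>X\<close> arise from the estimates; the third is added at
    the end to reach \<open>X \<le> M * C4\<close>.\<close>
  obtain C4 where C4: "\<And>y. y \<ge> 1 \<Longrightarrow> exp (- (c2 / 2) * y powr (1 - \<sigma>)) * y ^ 3 \<le> C4"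
    using exp_neg_powr_bound[of "c2 / 2" "1 - \<sigma>" 3] c2 \<sigma> by auto
  \<comment> \<open>The packet absorbs the spatial weight, the multiplier error is at most half of
    the main term, and the two costs of the data consume a quarter of \<open>c2\<close> each, which
    leaves half of the exponent.\<close>
  have "eventually (\<lambda>X. 4 \<le> X \<and> (1 * X) powr (1 / s + \<sigma> - 1) \<le> 1 / 12 * X powr 0 \<and>
      (1 * X) powr 0 \<le> 1 / (10 * exp 4 * sqrt 2 * C) * X powr \<sigma> \<and>
      (2 * N * X) powr (1 / \<theta>) \<le> c2 / 4 * X powr (1 - \<sigma>) \<and> (3 * X) powr (1 / s) \<le> c2 / 4 * X powr (1 - \<sigma>) \<and> M * C4 < X) at_top"
    by (intro eventually_conj eventually_ge_at_top eventually_gt_at_top powr_eventually_le)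
      (use p q c2 N C \<sigma> in auto)
  then obtain X where X4: "4 \<le> X" and x1: "(1 * X) powr (1 / s + \<sigma> - 1) \<le> 1 / 12 * X powr 0" and
      x2: "(1 * X) powr 0 \<le> 1 / (10 * exp 4 * sqrt 2 * C) * X powr \<sigma>" and
      x3: "(2 * N * X) powr (1 / \<theta>) \<le> c2 / 4 * X powr (1 - \<sigma>)" and x4: "(3 * X) powr (1 / s) \<le> c2 / 4 * X powr (1 - \<sigma>)"
      and x5: "M * C4 < X"
    using eventually_happens'[OF trivial_limit_at_top_linorder] by blast
  define Y where "Y = X powr ((1 + \<sigma>) / 2)"
  have Y: "Y \<ge> 1" "Y \<le> X" "Y\<^sup>2 = X powr (1 + \<sigma>)"
  proof -
    show "Y \<ge> 1" unfolding Y_def using X4 \<sigma> by (intro ge_one_powr_ge_zero) auto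
    have "Y \<le> X powr 1" unfolding Y_def using X4 \<sigma> by (intro powr_mono) auto
    then show "Y \<le> X" using X4 by simp
    show "Y\<^sup>2 = X powr (1 + \<sigma>)" unfolding Y_def using X4 by (simp add: power2_eq_square powr_add[symmetric])
  qed
  obtain \<psi> R where \<psi>: "\<psi> \<in> schwartz" and R: "R \<in> schwartz" and
    pde: "\<And>x. Dfun (Dfun \<psi>) x + Dfun (\<lambda>x. complex_of_real (jap x powr (- \<sigma>)) * \<psi> x) x
        = - ((Complex (N * X) (jap X powr (- \<sigma>) / 2))\<^sup>2 * \<psi> x) - R x" and
    \<psi>1: "(LINT x|lborel. cmod (\<psi> x)) \<le> C * X * exp (Phi \<sigma> X (- X))" and R1: "(LINT x|lborel. cmod (R x)) \<le> C * X" and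
    low': "\<forall>Y>0. Y\<^sup>2 = X powr (1 + \<sigma>) \<longrightarrow> Y \<le> X \<longrightarrow> 1 / 5 * Y * exp (Phi \<sigma> X (- X)) \<le>
          Re (LINT x|lborel. packet (N * X) X Y x * \<psi> x)"
    using quasi[OF X4] unfolding is_quasimode_def by blast
  have low: "1 / 5 * Y * exp (Phi \<sigma> X (- X)) \<le> Re (LINT x|lborel. packet (N * X) X Y x * \<psi> x)"
    using low'[THEN spec, of Y] Y by simp
  define B where "B = exp (Phi \<sigma> X (- X))"
  define w where "w = c2 * X powr (1 - \<sigma>)"
  define G where "G = ifourier (\<lambda>\<xi>. exp_weight (- 1) \<theta> \<xi> * fourier (packet (N * X) X Y) \<xi>)"
  have "12 * X powr (1 / s + \<sigma> - 1) \<le> 1" using x1 X4 by simp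
  note data = packet_data[OF assms(4) less_imp_le[OF assms(3)] _ Y this, of "N * X", folded G_def]
  have g: "distr_of G \<in> H_space \<theta> s 1 1" and gn: "H_norm \<theta> s 1 1 (distr_of G) \<le> 3 * X * exp ((3 * X) powr (1 / s))"
    using data X4 by auto
  obtain u where u: "u \<in> C1_H T \<theta> s r1 r2" and sol: "solves_Cauchy T \<sigma> (\<lambda>_ _. 0) (distr_of G) u"
    and est: "\<And>t. t \<in> {0..T} \<Longrightarrow> (H_norm \<theta> s r1 r2 (u t))\<^sup>2 \<le>
               Cw * ((H_norm \<theta> s 1 1 (distr_of G))\<^sup>2 + integral {0..t} (\<lambda>\<tau>. (H_norm \<theta> s 1 1 (\<lambda>_. 0))\<^sup>2))"
    using bspec[OF bspec[OF wp zero_in_C0_H] g] by blast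
  define S where "S = sqrt Cw * (3 * X * exp ((3 * X) powr (1 / s)))"
  have S0: "S \<ge> 0" unfolding S_def using Cw X4 by simp
  have uS: "H_norm \<theta> s r1 r2 (u t) \<le> S" if t: "t \<in> {0..T}" for t
  proof -
    have "(H_norm \<theta> s r1 r2 (u t))\<^sup>2 \<le> Cw * (H_norm \<theta> s 1 1 (distr_of G))\<^sup>2"
      using est[OF t] by (simp add: H_norm_zero)
    then have "H_norm \<theta> s r1 r2 (u t) \<le> sqrt (Cw * (H_norm \<theta> s 1 1 (distr_of G))\<^sup>2)" by (rule real_le_rsqrt)
    also have "\<dots> = sqrt Cw * H_norm \<theta> s 1 1 (distr_of G)" using H_norm_nonneg by (simp add: real_sqrt_mult)
    also have "\<dots> \<le> S" unfolding S_def using gn Cw by (intro mult_left_mono) auto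
    finally show ?thesis .
  qed
  have up: "cmod (u t \<phi>) \<le> K * S * A" if t: "t \<in> {0..T}" and \<phi>: "\<phi> \<in> schwartz" and A: "(LINT x|lborel. cmod (\<phi> x)) \<le> A" for t \<phi> A
  proof -
    have "u t \<in> H_space \<theta> s r1 r2" using u t unfolding C1_H_def C0_H_def by blast
    then have "cmod (u t \<phi>) \<le> K * H_norm \<theta> s r1 r2 (u t) * (LINT x|lborel. cmod (\<phi> x))" by (rule pair[OF _ \<phi>])
    also have "\<dots> \<le> K * S * A"
      using K S0 uS[OF t] A H_norm_nonneg by (intro mult_mono mult_left_mono) (auto intro!: integral_nonneg_AE)
    finally show ?thesis .
  qed
  let ?k = "Complex (N * X) (jap X powr (- \<sigma>) / 2)"
  have "cmod (distr_of G \<psi>) \<le> exp (- (2 * Re ?k * Im ?k * T)) * cmod (u T \<psi>) + (K * S * (C * X)) * T"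
    by (rule weak_solution_growth[OF assms(1) pos \<theta>0 u sol \<psi> R _ _ pde up[OF _ R R1]]) (use N X4 in auto)
  moreover have "cmod (u T \<psi>) \<le> K * S * (C * X * B)" unfolding B_def by (rule up[OF _ \<psi> \<psi>1]) (use assms in auto)
  moreover have w1: "w \<le> 2 * Re ?k * Im ?k * T"
  proof -
    have "w \<le> (N * T * 2 powr (- \<sigma>)) * X powr (1 - \<sigma>)"
      unfolding w_def c2_def by (intro mult_right_mono) auto
    also have "\<dots> = N * X * (2 * X) powr (- \<sigma>) * T"
      using X4 powr_add[of X 1 "- \<sigma>"] by (simp add: powr_mult)
    also have "\<dots> \<le> N * X * jap X powr (- \<sigma>) * T"
    proof -
      have "(2 * X) powr (- \<sigma>) \<le> jap X powr (- \<sigma>)"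
        using X4 \<sigma> jap_le[of X] jap_pos[of X] by (intro powr_mono2') auto
      then show ?thesis using N X4 assms by (intro mult_right_mono mult_left_mono) auto
    qed
    finally show ?thesis by simp
  qed
  ultimately have up': "cmod (distr_of G \<psi>) \<le> exp (- w) * (K * S * (C * X * B)) + (K * S * (C * X)) * T"
    by (smt (verit) exp_le_cancel_iff mult_mono exp_ge_zero norm_ge_zero)
  have wB: "exp w \<le> B"
  proof -
    have "w \<le> (2 powr \<sigma> - 1) / 8 * X powr (1 - \<sigma>)"
      unfolding w_def c2_def by (intro mult_right_mono min.cobounded1) simp
    also have "\<dots> \<le> Phi \<sigma> X (- X)" by (rule Phi_max_ge[OF \<sigma> X4])
    finally show ?thesis unfolding B_def by simp
  qed
  have B0: "B > 0" unfolding B_def by simp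
  have "cmod (distr_of G \<psi>) \<le> (K * S * (C * X)) * (1 + T) * exp (- w) * B"
  proof -
    \<comment> \<open>The defect term carries no \<open>B\<close>; multiplying it by
      \<open>exp (- w) * B\<close> gives both terms the same shape.\<close>
    have "1 \<le> exp (- w) * B" using mult_left_mono[OF wB, of "exp (- w)"] by (simp add: mult_exp_exp)
    then have "(K * S * (C * X)) * T * 1 \<le> (K * S * (C * X)) * T * (exp (- w) * B)"
      using K S0 C X4 assms by (intro mult_left_mono) auto
    then show ?thesis using up' by (simp add: algebra_simps)
  qed
  moreover have "exp (- ((2 * N * X) powr (1 / \<theta>))) * (B / 10) \<le> cmod (distr_of G \<psi>)"
  proof -
    let ?I = "LINT x|lborel. cmod (\<psi> x)"
    \<comment> \<open>With \<open>Y^2 = X^(1+\<sigma>)\<close> the multiplier error, of order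
      \<open>X B / Y\<close>, is at most \<open>Y B / 10\<close>, half of the main term
      \<open>Y B / 5\<close>.\<close>
    have "10 * exp 4 * sqrt 2 * C \<le> X powr \<sigma>" using x2 X4 C by (simp add: field_simps)
    then have "10 * exp 4 * sqrt 2 * C * X \<le> X powr \<sigma> * X" using X4 by (intro mult_right_mono) auto
    also have "\<dots> = Y\<^sup>2" using Y(3) X4 by (simp add: powr_add mult.commute)
    finally have "exp 4 * sqrt 2 / Y * (C * X) \<le> Y / 10" using Y(1) by (simp add: field_simps power2_eq_square)
    then have "exp 4 * sqrt 2 / Y * (C * X) * B \<le> Y / 10 * B" using B0 by (intro mult_right_mono) auto
    moreover have "exp 4 * sqrt 2 / Y * ?I \<le> exp 4 * sqrt 2 / Y * (C * X * B)"
      using \<psi>1 Y unfolding B_def by (intro mult_left_mono) auto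
    moreover have "exp 4 * sqrt 2 / Y * (C * X * B) = exp 4 * sqrt 2 / Y * (C * X) * B" "1 / 5 * Y * B = 2 * (Y / 10 * B)"
      by simp_all
    ultimately have "Y / 10 * B \<le> 1 / 5 * Y * B - exp 4 * sqrt 2 / Y * ?I" by linarith
    also have "\<dots> \<le> Re (LINT x|lborel. packet (N * X) X Y x * \<psi> x) - exp 4 * sqrt 2 / Y * ?I"
      using low unfolding B_def by simp
    finally have *: "Y / 10 * B \<le> Re (LINT x|lborel. packet (N * X) X Y x * \<psi> x) - exp 4 * sqrt 2 / Y * ?I" .
    have 1: "B / 10 \<le> Re (LINT x|lborel. packet (N * X) X Y x * \<psi> x) - exp 4 * sqrt 2 / Y * ?I"
    proof -
      have "1 * (B / 10) \<le> Y * (B / 10)" using Y(1) B0 by (intro mult_right_mono) auto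
      moreover have "Y * (B / 10) = Y / 10 * B" by simp
      ultimately show ?thesis using * by linarith
    qed
    have "1 \<le> N * X" using mult_mono[of 1 N 1 X] N X4 by simp
    then have "jap (N * X) \<le> 2 * N * X" using jap_le[of "N * X"] by simp
    then have "jap (N * X) powr (1 / \<theta>) \<le> (2 * N * X) powr (1 / \<theta>)"
      using \<theta>0 jap_pos[of "N * X"] by (intro powr_mono2) auto
    then have "exp (- ((2 * N * X) powr (1 / \<theta>))) * (B / 10) \<le> exp (- (jap (N * X) powr (1 / \<theta>))) *
       (Re (LINT x|lborel. packet (N * X) X Y x * \<psi> x) - exp 4 * sqrt 2 / Y * ?I)"
      using B0 by (intro mult_mono 1) auto
    also have "\<dots> \<le> cmod (distr_of G \<psi>)"
      unfolding G_def by (rule packet_pairing[OF less_imp_le[OF assms(3)] Y(1) \<psi>])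
    finally show ?thesis .
  qed
  ultimately have "exp (- ((2 * N * X) powr (1 / \<theta>))) / 10 * B \<le> (K * S * (C * X)) * (1 + T) * exp (- w) * B" by simp
  then have "exp (- ((2 * N * X) powr (1 / \<theta>))) / 10 \<le> (K * S * (C * X)) * (1 + T) * exp (- w)"
    using B0 by (simp only: mult_le_cancel_right_pos)
  then have "exp ((2 * N * X) powr (1 / \<theta>)) * (exp (- ((2 * N * X) powr (1 / \<theta>))) / 10) \<le>
     exp ((2 * N * X) powr (1 / \<theta>)) * ((K * S * (C * X)) * (1 + T) * exp (- w))"
    by (rule mult_left_mono) simp
  then have "1 \<le> 10 * exp ((2 * N * X) powr (1 / \<theta>)) * ((K * S * (C * X)) * (1 + T) * exp (- w))"
    by (simp add: mult_exp_exp[symmetric] exp_minus)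
  also have "\<dots> = M * X\<^sup>2 * (exp ((2 * N * X) powr (1 / \<theta>)) * exp ((3 * X) powr (1 / s)) * exp (- w))"
    unfolding M_def S_def by (simp add: power2_eq_square mult_ac)
  also have "\<dots> \<le> M * X\<^sup>2 * exp (- (c2 / 2) * X powr (1 - \<sigma>))"
  proof (rule mult_left_mono)
    have "(2 * N * X) powr (1 / \<theta>) + (3 * X) powr (1 / s) + (- w) \<le> - (c2 / 2) * X powr (1 - \<sigma>)"
      using x3 x4 unfolding w_def by (simp add: field_simps)
    then show "exp ((2 * N * X) powr (1 / \<theta>)) * exp ((3 * X) powr (1 / s)) * exp (- w) \<le> exp (- (c2 / 2) * X powr (1 - \<sigma>))"
      unfolding mult_exp_exp by simp
  qed (use M in simp)
  finally have "X \<le> M * X\<^sup>2 * exp (- (c2 / 2) * X powr (1 - \<sigma>)) * X"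
    using X4 mult_right_mono[of 1 "M * X\<^sup>2 * exp (- (c2 / 2) * X powr (1 - \<sigma>))" X] by simp
  also have "\<dots> = M * (exp (- (c2 / 2) * X powr (1 - \<sigma>)) * X ^ 3)"
    by (simp add: power2_eq_square power3_eq_cube)
  also have "\<dots> \<le> M * C4" using C4[of X] X4 M by (intro mult_left_mono) auto
  finally show False using x5 by simp
qed

end
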